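(* Let $\mathcal{H}$, $\mathcal{G}$, $\mathcal{K}$ be real Hilbert spaces, let $g\in\Gamma_0(\mathcal{K})$, $f\in\Gamma_0(\mathcal{H})$, and let $T\colon\mathcal{K}\to\mathcal{G}$ and $K\colon\mathcal{G}\to\mathcal{H}$ be non-zero bounded linear operators such that $\mathrm{ran}\,T^*\cap\mathrm{dom}\,g^*\neq\varnothing$. Let $S_P$, $S_D$, $S_{P^*}$ be the sets of solutions to, respectively, $$\min_{y\in\mathcal{K}}\big(g(y)+f(KTy)\big),\qquad\min_{x\in\mathcal{H}}\big(f^*(x)+g^*(-T^*K^*x)\big),\qquad\min_{u\in\mathcal{G}}\big((g^*\circ-T^* )^*(u)+f(-Ku)\big).$$ Suppose that there exists $(\hat x,\hat u)\in\mathcal{H}\times\mathcal{G}$ such that $0\in\partial f^*(\hat x)+K\hat u$ and $0\in\partial(g^*\circ-T^* )^*(\hat u)-K^*\hat x$. Set $$A=\partial f^*,\qquad B=\partial(g^*\circ(-T^* )),\qquad L=K^*,$$ and assume that $0\in\mathrm{sri}(\mathrm{dom}\,g^*-\mathrm{ran}\,T^* )$. Let $\Sigma\colon\mathcal{G}\to\mathcal{G}$ and $\Upsilon\colon\mathcal{H}\to\mathcal{H}$ be strongly monotone self-adjoint linear operators such that $\Sigma^{-1}-K^*\Upsilon K$ is monotone, and consider the algorithms SDR and SADMM defined in the context with these data. Then the sequence $(p_n)_{n\in\mathbb{N}}$ in SADMM exists (i.e., the minimization problem defining $p_{n+1}$ always admits a solution), and the following hold. (i) (SDR reduces to SADMM)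 Let $(\tilde x_n)_{n\in\mathbb{N}}$, $(\tilde u_n)_{n\in\mathbb{N}}$, $(\tilde v_n)_{n\in\mathbb{N}}$ be the sequences ($x_n$, $u_n$, $v_n$ respectively) generated by SDR and, for every $n\in\mathbb{N}$, set $$\tilde p_{n+1}\in T^{-1}(-\tilde v_n),\qquad \tilde q_{n+1}=\Upsilon^{-1}(\tilde x_n-\tilde x_{n+1}-\Upsilon K\tilde v_n).$$ Moreover, let $p_1\in\mathcal{K}$ be such that $Tp_1=T\tilde p_1$, and set $q_1=\tilde q_1$, $x_1=\tilde x_1$. Then the sequences $(p_n)_{n\ge1}$, $(q_n)_{n\ge1}$, $(x_n)_{n\ge1}$ generated by SADMM (started from $(p_1,q_1,x_1)$ at index $n=1$) satisfy, for every $n\ge1$, $T\tilde p_n=Tp_n$, $\tilde q_n=q_n$, and $\tilde x_n=x_n$. (ii) (SADMM reduces to SDR) Let $(p_n)$, $(q_n)$, $(x_n)$ be sequences generated by SADMM (from initial data $p_0,q_0,x_0$) and define, for every $n\in\mathbb{N}$, $u_{n+1}=\Sigma K^*(x_{n+1}-x_n)-Tp_{n+1}$. Set $\tilde x_0=x_1$, $\tilde u_0=u_1$, and let $(\tilde x_n)_{n\in\mathbb{N}}$ and $(\tilde u_n)_{n\in\mathbb{N}}$ be the sequences generated by SDR from $(\tilde x_0,\tilde u_0)$. Then, for all $n\in\mathbb{N}$, $\tilde x_n=x_{n+1}$ and $\tilde u_n=u_{n+1}$. (iii) Let $(p_n)_{n\in\mathbb{N}}$, $(q_n)_{n\in\mathbb{N}}$,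 $(x_n)_{n\in\mathbb{N}}$ be sequences generated by SADMM. Then: (a) There exists $(\hat y,\hat x,\hat u)\in S_P\times S_D\times S_{P^*}$ such that $(x_n,-Tp_n,q_n)\rightharpoonup(\hat x,\hat u,-K\hat u)$ and $\hat u=-T\hat y$. (b) Suppose that $\mathrm{ran}\,T^*=\mathcal{K}$. Then there exists $\hat y\in S_P$ such that $p_n\rightharpoonup\hat y$.
   Context: $\Gamma_0(\mathcal{H})$ is the class of proper lower semicontinuous convex functions from $\mathcal{H}$ to $]-\infty,+\infty]$. $f^*$ is the Fenchel conjugate, $\partial f$ the subdifferential, $\mathrm{dom}\,f=\{f<+\infty\}$. $g^*\circ-T^*$ is the function $u\mapsto g^*(-T^*u)$ on $\mathcal{G}$, $(g^*\circ-T^* )^*$ its conjugate, and $\partial(g^*\circ-T^* )^*$ the subdifferential of that conjugate. $\mathrm{sri}\,C$ (strong relative interior of a convex set $C$) is the set of $x\in C$ such that the cone generated by $C-x$ is a closed linear subspace. A self-adjoint linear operator is strongly monotone if $\langle x\mid\Upsilon x\rangle\ge\beta\|x\|^2$ for some $\beta>0$ and all $x$; $\|x\|_{\Upsilon}=\sqrt{\langle x\mid\Upsilon x\rangle}$; $\mathrm{prox}^{\Upsilon}_f(x)=\mathrm{argmin}_y\big(f(y)+\tfrac12\|x-y\|_{\Upsilon}^2\big)$. $J_M=(\mathrm{Id}+M)^{-1}$ is the resolvent. $\rightharpoonup$ is weak convergence. $T^{-1}(w)=\{p: Tp=w\}$. SDR (Split-Douglas-Rachford), with initial point $(x_0,u_0)\in\mathcal{H}\times\mathcal{G}$: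 for every $n\in\mathbb{N}$, $$v_n=\Sigma(\mathrm{Id}-J_{\Sigma^{-1}B})(Lx_n+\Sigma^{-1}u_n),\quad z_n=x_n-\Upsilon L^*v_n,\quad x_{n+1}=J_{\Upsilon A}z_n,\quad u_{n+1}=\Sigma L(x_{n+1}-x_n)+v_n.$$ SADMM (Split-ADMM), with initial data $p_0\in\mathcal{K}$, $(q_0,x_0)\in\mathcal{H}\times\mathcal{H}$: for every $n\in\mathbb{N}$, $$\begin{aligned} y_n&=x_n+\Upsilon(KTp_n-q_n),\\ p_{n+1}&\in\operatorname*{argmin}_{p\in\mathcal{K}}\Big(g(p)+\tfrac12\|Tp-(Tp_n-\Sigma K^*y_n)\|_{\Sigma^{-1}}^2\Big),\\ q_{n+1}&=\mathrm{prox}^{\Upsilon}_f(\Upsilon^{-1}x_n+KTp_{n+1}),\\ x_{n+1}&=x_n+\Upsilon(KTp_{n+1}-q_{n+1}).\end{aligned}$$ *)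

theory Defs
  imports "HOL-Analysis.Analysis"
begin

text \<open>Real Hilbert spaces are types of sort \<open>{real_inner, complete_space}\<close>, extended-real-valued
  functions are \<open>ereal\<close>-valued, and set-valued operators are functions \<open>'a \<Rightarrow> 'a set\<close>.\<close>

definition edom :: "('a \<Rightarrow> ereal) \<Rightarrow> 'a set" where
  "edom f = {x. f x < \<infinity>}"

definition lsc :: "('a::topological_space \<Rightarrow> ereal) \<Rightarrow> bool" where
  "lsc f \<longleftrightarrow> (\<forall>x. f x \<le> Liminf (nhds x) f)"

text \<open>Values \<open>-\<infinity>\<close> are excluded, so the right-hand side of the convexity inequality never contains
  \<open>\<infinity> - \<infinity>\<close>.\<close>

definition Gamma0 :: "('a::real_inner \<Rightarrow> ereal) set" where
  "Gamma0 = {f. (\<forall>x. f x \<noteq> -\<infinity>) \<and> edom f \<noteq> {} \<and> lsc f \<and>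
     (\<forall>x y. \<forall>t\<in>{0<..<1::real}.
        f ((1 - t) *\<^sub>R x + t *\<^sub>R y) \<le> ereal (1 - t) * f x + ereal t * f y)}"

definition conjugate :: "('a::real_inner \<Rightarrow> ereal) \<Rightarrow> 'a \<Rightarrow> ereal" where
  "conjugate f u = (SUP x. ereal (x \<bullet> u) - f x)"

definition subdifferential :: "('a::real_inner \<Rightarrow> ereal) \<Rightarrow> 'a \<Rightarrow> 'a set" where
  "subdifferential f x = {u. \<forall>y. ereal ((y - x) \<bullet> u) + f x \<le> f y}"

text \<open>Since \<open>x \<in> C\<close>, the set of translates contains \<open>0\<close>, so it is irrelevant that the
  library's \<^term>\<open>cone\<close> admits the factor \<open>0\<close>.\<close>

definition sri :: "'a::real_normed_vector set \<Rightarrow> 'a set" where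
  "sri C = {x \<in> C. subspace (cone hull ((\<lambda>y. y - x) ` C)) \<and> closed (cone hull ((\<lambda>y. y - x) ` C))}"

text \<open>The adjoint condition is spelled out because \<^term>\<open>adjoint\<close> is defined by a choice operator
  and \<^term>\<open>M\<close> is not assumed to be bounded a priori.\<close>

definition self_adjoint :: "('a::real_inner \<Rightarrow> 'a) \<Rightarrow> bool" where
  "self_adjoint M \<longleftrightarrow> (\<forall>x y. M x \<bullet> y = x \<bullet> M y)"

definition strongly_monotone :: "('a::real_inner \<Rightarrow> 'a) \<Rightarrow> bool" where
  "strongly_monotone M \<longleftrightarrow> (\<exists>\<beta>>0. \<forall>x. x \<bullet> M x \<ge> \<beta> * (norm x)\<^sup>2)"

definition monotone_op :: "('a::real_inner \<Rightarrow> 'a) \<Rightarrow> bool" where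
  "monotone_op M \<longleftrightarrow> (\<forall>x y. (x - y) \<bullet> (M x - M y) \<ge> 0)"

definition norm_wrt :: "('a::real_inner \<Rightarrow> 'a) \<Rightarrow> 'a \<Rightarrow> real" where
  "norm_wrt M x = sqrt (x \<bullet> M x)"

definition Argmin :: "('a \<Rightarrow> ereal) \<Rightarrow> 'a set" where
  "Argmin F = {x. is_arg_min F (\<lambda>_. True) x}"

definition prox :: "('a::real_inner \<Rightarrow> 'a) \<Rightarrow> ('a \<Rightarrow> ereal) \<Rightarrow> 'a \<Rightarrow> 'a" where
  "prox M f x = (ARG_MIN (\<lambda>y. f y + ereal ((norm_wrt M (x - y))\<^sup>2 / 2)) y. True)"

text \<open>The value at \<open>x\<close> of \<open>(Id + M)\<^sup>-\<^sup>1\<close>, as a point; meaningful when this inverse is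
  single-valued with full domain.\<close>

definition resolvent :: "('a::real_vector \<Rightarrow> 'a set) \<Rightarrow> 'a \<Rightarrow> 'a" where
  "resolvent M x = (THE p. x \<in> (\<lambda>w. p + w) ` M p)"

definition weakly_converges :: "(nat \<Rightarrow> 'a::real_inner) \<Rightarrow> 'a \<Rightarrow> bool" where
  "weakly_converges s l \<longleftrightarrow> (\<forall>w. (\<lambda>n. s n \<bullet> w) \<longlonglongrightarrow> l \<bullet> w)"

definition SDR ::
  "('g::real_inner \<Rightarrow> 'g) \<Rightarrow> ('h::real_inner \<Rightarrow> 'h) \<Rightarrow> ('h \<Rightarrow> 'h set) \<Rightarrow> ('g \<Rightarrow> 'g set) \<Rightarrow>
   ('h \<Rightarrow> 'g) \<Rightarrow> (nat \<Rightarrow> 'h) \<Rightarrow> (nat \<Rightarrow> 'g) \<Rightarrow> (nat \<Rightarrow> 'g) \<Rightarrow> bool" where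
  "SDR \<Sigma> \<Upsilon> A B L x u v \<longleftrightarrow>
     (\<forall>n. let w = L (x n) + inv \<Sigma> (u n);
              z = x n - \<Upsilon> (adjoint L (v n))
          in v n = \<Sigma> (w - resolvent (\<lambda>s. inv \<Sigma> ` B s) w) \<and>
             x (Suc n) = resolvent (\<lambda>s. \<Upsilon> ` A s) z \<and>
             u (Suc n) = \<Sigma> (L (x (Suc n) - x n)) + v n)"

text \<open>The objective of the minimization step producing \<open>p\<^sub>n\<^sub>+\<^sub>1\<close> from \<open>(p\<^sub>n, q\<^sub>n, x\<^sub>n)\<close>.\<close>

definition SADMM_objective ::
  "('g::real_inner \<Rightarrow> 'g) \<Rightarrow> ('h::real_inner \<Rightarrow> 'h) \<Rightarrow> ('k \<Rightarrow> ereal) \<Rightarrow> ('k::real_inner \<Rightarrow> 'g) \<Rightarrow>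
   ('g \<Rightarrow> 'h) \<Rightarrow> 'k \<Rightarrow> 'h \<Rightarrow> 'h \<Rightarrow> 'k \<Rightarrow> ereal" where
  "SADMM_objective \<Sigma> \<Upsilon> g T K p q x =
     (let y = x + \<Upsilon> (K (T p) - q)
      in (\<lambda>p'. g p' + ereal ((norm_wrt (inv \<Sigma>) (T p' - (T p - \<Sigma> (adjoint K y))))\<^sup>2 / 2)))"

text \<open>\<open>m\<close> is the index at which the iteration is started; the sequence entries below \<open>m\<close> are
  unconstrained.\<close>

definition SADMM ::
  "('g::real_inner \<Rightarrow> 'g) \<Rightarrow> ('h::real_inner \<Rightarrow> 'h) \<Rightarrow> ('h \<Rightarrow> ereal) \<Rightarrow> ('k \<Rightarrow> ereal) \<Rightarrow>
   ('k::real_inner \<Rightarrow> 'g) \<Rightarrow> ('g \<Rightarrow> 'h) \<Rightarrow> nat \<Rightarrow> (nat \<Rightarrow> 'k) \<Rightarrow> (nat \<Rightarrow> 'h) \<Rightarrow> (nat \<Rightarrow> 'h) \<Rightarrow> bool" where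
  "SADMM \<Sigma> \<Upsilon> f g T K m p q x \<longleftrightarrow>
     (\<forall>n\<ge>m. p (Suc n) \<in> Argmin (SADMM_objective \<Sigma> \<Upsilon> g T K (p n) (q n) (x n)) \<and>
             q (Suc n) = prox \<Upsilon> f (inv \<Upsilon> (x n) + K (T (p (Suc n)))) \<and>
             x (Suc n) = x n + \<Upsilon> (K (T (p (Suc n))) - q (Suc n)))"

end

theory Submission
  imports Defs "HOL-Library.Diagonal_Subsequence"
begin

text \<open>Write \<open>\<phi> = conjugate g \<circ> - adjoint T\<close>. The qualification condition gives the chain rule
  \<open>\<partial>\<phi> = - T \<circ> \<partial>(conjugate g) \<circ> - adjoint T\<close>; hence every subgradient of \<open>\<phi>\<close> has the form \<open>- T p\<close>,
  which makes the minimization step of SADMM solvable and identifies it with the \<open>B\<close>-resolvent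
  step of SDR. Both algorithms are then the proximal point iteration
  \<open>W (z n - z (n + 1)) \<in> M (z (n + 1))\<close> for the Kuhn--Tucker operator
  \<open>M (x, u) = (\<partial>(conjugate f) x + K u, \<partial>(conjugate \<phi>) u - adjoint K x)\<close>, at
  \<open>z n = (x n, - T (p (n + 1)))\<close>, with the possibly degenerate metric
  \<open>W (x, u) = (inv \<Upsilon> x - K u, inv \<Sigma> u - adjoint K x)\<close>. Weak convergence survives degeneracy because
  the inverse of \<open>M + W\<close> is Lipschitz.\<close>

section \<open>Functions in \<open>Gamma0\<close>\<close>

text \<open>Most of the analysis grows out of one existence statement,
  \<open>ex_argmin_plus_quadratic\<close>. Fed with linear functionals, indicators of subspaces,
  scaled identities and penalty forms, it yields Riesz representation, orthogonal projections,
  Fenchel-Moreau, invertibility of \<open>\<Sigma>\<close> and \<open>\<Upsilon>\<close>, and the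
  approximate multipliers of the chain rule. The chain rule is the real obstacle: the quadratic in
  the \<open>p\<close>-step sees only \<open>T p\<close>, so a minimizer is not produced by
  coercivity and has to be lifted from a dual point. The index shift in
  \<open>(x n, - T (p (n + 1)))\<close> is forced by the arbitrary start. Nothing ties
  \<open>q 0\<close> to the other data; only a completed step gives
  \<open>K (T (p n)) - q n = inv \<Upsilon> (x n - x (n - 1))\<close>, and this turns
  \<open>y n\<close> into the extrapolation \<open>2 *\<^sub>R x n - x (n - 1)\<close> that the
  off-diagonal entries of \<open>W\<close> encode.\<close>

lemma lsc_iff:
  "lsc f \<longleftrightarrow> (\<forall>x r. ereal r < f x \<longrightarrow> eventually (\<lambda>z. ereal r < f z) (nhds x))"
proof
  assume "lsc f"
  then show "\<forall>x r. ereal r < f x \<longrightarrow> eventually (\<lambda>z. ereal r < f z) (nhds x)"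
    by (simp add: lsc_def le_Liminf_iff)
next
  assume *: "\<forall>x r. ereal r < f x \<longrightarrow> eventually (\<lambda>z. ereal r < f z) (nhds x)"
  have "eventually (\<lambda>z. y < f z) (nhds x)" if "y < f x" for x y
  proof -
    obtain r where "y < ereal r" "ereal r < f x"
      using \<open>y < f x\<close> ereal_dense2 by blast
    then have "eventually (\<lambda>z. ereal r < f z) (nhds x)"
      using * by blast
    then show ?thesis
      by (rule eventually_mono) (rule less_trans[OF \<open>y < ereal r\<close>])
  qed
  then show "lsc f"
    by (simp add: lsc_def le_Liminf_iff)
qed

lemma Gamma0_not_minus_inf: "f \<in> Gamma0 \<Longrightarrow> f x \<noteq> -\<infinity>"
  by (simp add: Gamma0_def)

lemma Gamma0_finite_point:
  assumes "f \<in> Gamma0" obtains x r where "f x = ereal r"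
proof -
  obtain x where "f x < \<infinity>"
    using assms by (auto simp: Gamma0_def edom_def)
  with Gamma0_not_minus_inf[OF assms, of x] that[of x "real_of_ereal (f x)"] show ?thesis
    by (cases "f x") auto
qed

lemma Gamma0_convexD:
  assumes "f \<in> Gamma0" "f x \<le> ereal a" "f y \<le> ereal b" "0 < t" "t < 1"
  shows "f ((1 - t) *\<^sub>R x + t *\<^sub>R y) \<le> ereal ((1 - t) * a + t * b)"
proof -
  have "f ((1 - t) *\<^sub>R x + t *\<^sub>R y) \<le> ereal (1 - t) * f x + ereal t * f y"
    using assms by (simp add: Gamma0_def)
  also have "\<dots> \<le> ereal (1 - t) * ereal a + ereal t * ereal b"
    using assms by (intro add_mono ereal_mult_left_mono) auto
  finally show ?thesis by simp
qed

lemma Gamma0_eventually_less: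
  assumes "f \<in> Gamma0" "ereal r < f x" "(s \<longlongrightarrow> x) F"
  shows "eventually (\<lambda>z. ereal r < f (s z)) F"
proof -
  have "eventually (\<lambda>z. ereal r < f z) (nhds x)"
    using assms by (simp add: Gamma0_def lsc_iff)
  then show ?thesis
    using assms(3) by (rule eventually_compose_filterlim)
qed

text \<open>Both weights are strictly positive and \<open>-\<infinity>\<close> is excluded, so an
  infinite value at either end makes the right-hand side infinite. Convexity therefore needs
  checking only between points of finite value.\<close>

lemma Gamma0I:
  fixes f :: "'a::real_inner \<Rightarrow> ereal"
  assumes "\<And>x. f x \<noteq> -\<infinity>" and "f x0 \<noteq> \<infinity>" and "lsc f"
    and conv: "\<And>x y a b t. f x = ereal a \<Longrightarrow> f y = ereal b \<Longrightarrow> 0 < t \<Longrightarrow> t < 1 \<Longrightarrow>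
        f ((1 - t) *\<^sub>R x + t *\<^sub>R y) \<le> ereal ((1 - t) * a + t * b)"
  shows "f \<in> Gamma0"
proof -
  have "f ((1 - t) *\<^sub>R x + t *\<^sub>R y) \<le> ereal (1 - t) * f x + ereal t * f y"
    if "0 < t" "t < 1" for x y and t :: real
  proof -
    have "ereal (1 - t) * \<infinity> = \<infinity>" "ereal t * \<infinity> = \<infinity>"
      using that by auto
    with that show ?thesis
      using assms(1)[of x] assms(1)[of y] conv[of x _ y _ t]
      by (cases "f x"; cases "f y") auto
  qed
  moreover have "edom f \<noteq> {}"
    using assms(2) by (auto simp: edom_def)
  ultimately show ?thesis
    using assms by (auto simp: Gamma0_def)
qed

lemma lsc_continuous:
  assumes "continuous_on UNIV h"
  shows "lsc (\<lambda>x. ereal (h x))"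
  unfolding lsc_iff
  using assms order_tendstoD(1)[of h]
  by (auto simp: continuous_on_def at_within_def[symmetric] tendsto_at_iff_tendsto_nhds)

lemma Gamma0_lsc_seq:
  assumes "f \<in> Gamma0" "s \<longlonglongrightarrow> l" "c \<longlonglongrightarrow> c0" "\<And>n::nat. f (s n) \<le> ereal (c n)"
  shows "f l \<le> ereal c0"
proof (rule ccontr)
  assume "\<not> f l \<le> ereal c0"
  then obtain r where r: "c0 < r" "ereal r < f l"
    using ereal_dense2[of "ereal c0" "f l"] by (metis ereal_less(2) less_ereal.simps(1) not_le)
  have "eventually (\<lambda>n. ereal r < f (s n)) sequentially"
    by (rule Gamma0_eventually_less[OF assms(1) r(2) assms(2)])
  moreover have "eventually (\<lambda>n. c n < r) sequentially"
    using assms(3) r(1) by (rule order_tendstoD(2))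
  ultimately have "eventually (\<lambda>n. False) sequentially"
  proof eventually_elim
    case (elim n)
    then show ?case using assms(4)[of n] by (metis ereal_less_eq(3) less_le_trans not_le order.trans order_less_imp_le)
  qed
  then show False by simp
qed

text \<open>Lower semicontinuity keeps \<open>f\<close> above \<open>r - 1\<close> on a ball around
  \<open>x0\<close>, and convexity along rays from \<open>x0\<close> then forbids a decrease steeper
  than \<open>1 / \<delta>\<close>. This takes the place of a separation argument.\<close>

lemma Gamma0_lower_bound:
  assumes f: "f \<in> Gamma0"
  obtains a b where "a \<ge> 0" "b \<ge> 0" "\<And>x. ereal (- a - b * norm x) \<le> f x"
proof -
  obtain x0 r where r: "f x0 = ereal r"
    using Gamma0_finite_point[OF f] .
  have "eventually (\<lambda>z. ereal (r - 1) < f z) (nhds x0)"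
    using f r by (simp add: Gamma0_def lsc_iff)
  then obtain d where d: "d > 0" "\<And>z. dist z x0 < d \<Longrightarrow> ereal (r - 1) < f z"
    by (auto simp: eventually_nhds_metric)
  define \<delta> where "\<delta> = d / 2"
  have \<delta>: "\<delta> > 0" "\<And>z. norm (z - x0) \<le> \<delta> \<Longrightarrow> ereal (r - 1) < f z"
    using d by (auto simp: \<delta>_def dist_norm)
  have *: "ereal (r - 1 - norm (x - x0) / \<delta>) \<le> f x" for x
  proof (cases "norm (x - x0) \<le> \<delta>")
    case True
    have "ereal (r - 1 - norm (x - x0) / \<delta>) \<le> ereal (r - 1)"
      using \<delta> by simp
    also have "\<dots> \<le> f x"
      using \<delta>(2)[OF True] by simp
    finally show ?thesis .
  next
    case False
    show ?thesis
    proof (cases "f x")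
      case (real q)
      \<comment> \<open>Chosen so that \<open>z\<close> lies on the segment from \<open>x0\<close>
        to \<open>x\<close> at distance \<open>\<delta>\<close> from \<open>x0\<close>.\<close>
      define t where "t = \<delta> / norm (x - x0)"
      have t: "0 < t" "t < 1"
        using False \<delta>(1) by (auto simp: t_def not_le divide_less_eq intro!: divide_pos_pos)
      define z where "z = (1 - t) *\<^sub>R x0 + t *\<^sub>R x"
      have "z - x0 = t *\<^sub>R (x - x0)"
        by (simp add: z_def algebra_simps)
      then have "norm (z - x0) \<le> \<delta>"
        using t False \<delta> by (auto simp: t_def)
      then have "ereal (r - 1) < f z" by (rule \<delta>(2))
      also have "f z \<le> ereal ((1 - t) * r + t * q)"
        unfolding z_def using f r real t by (intro Gamma0_convexD) auto
      finally have "- 1 < t * (q - r)"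
        by (simp add: algebra_simps)
      then have "- 1 / t < q - r"
        using t by (simp add: field_simps)
      then show ?thesis
        using real t by (simp add: t_def)
    qed (use Gamma0_not_minus_inf[OF f] in auto)
  qed
  show thesis
  proof (rule that)
    fix x
    have "norm (x - x0) / \<delta> \<le> (norm x + norm x0) / \<delta>"
      using \<delta> by (intro divide_right_mono norm_triangle_ineq4) auto
    then have "- (\<bar>r - 1\<bar> + norm x0 / \<delta>) - 1 / \<delta> * norm x \<le> r - 1 - norm (x - x0) / \<delta>"
      by (simp add: add_divide_distrib)
    then show "ereal (- (\<bar>r - 1\<bar> + norm x0 / \<delta>) - 1 / \<delta> * norm x) \<le> f x"
      using *[of x] order_trans ereal_less_eq(3) by blast
  qed (use \<delta> in auto)
qed

lemma Gamma0_continuous: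
  assumes "continuous_on UNIV h"
    and "\<And>x y t. 0 < t \<Longrightarrow> t < 1 \<Longrightarrow> h ((1 - t) *\<^sub>R x + t *\<^sub>R y) \<le> (1 - t) * h x + t * h y"
  shows "(\<lambda>x. ereal (h x)) \<in> Gamma0"
  using assms by (intro Gamma0I lsc_continuous) auto

lemma Gamma0_linear:
  assumes "bounded_linear l"
  shows "(\<lambda>x. ereal (l x)) \<in> Gamma0"
proof -
  interpret bounded_linear l by fact
  show ?thesis
    by (intro Gamma0_continuous linear_continuous_on assms) (simp add: add scaleR)
qed

lemma Gamma0_Times:
  fixes f :: "'a::real_inner \<Rightarrow> ereal" and g :: "'b::real_inner \<Rightarrow> ereal"
  assumes f: "f \<in> Gamma0" and g: "g \<in> Gamma0"
  shows "(\<lambda>z. f (fst z) + g (snd z)) \<in> Gamma0"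
proof -
  obtain x0 r where x0: "f x0 = ereal r" using Gamma0_finite_point[OF f] .
  obtain y0 q where y0: "g y0 = ereal q" using Gamma0_finite_point[OF g] .
  show ?thesis
  proof (rule Gamma0I)
    fix z
    show "f (fst z) + g (snd z) \<noteq> -\<infinity>"
      using Gamma0_not_minus_inf[OF f] Gamma0_not_minus_inf[OF g] by simp
  next
    show "f (fst (x0, y0)) + g (snd (x0, y0)) \<noteq> \<infinity>"
      using x0 y0 by simp
  next
    show "lsc (\<lambda>z. f (fst z) + g (snd z))"
      unfolding lsc_iff
    proof (intro allI impI)
      fix z and r
      assume r: "ereal r < f (fst z) + g (snd z)"
      \<comment> \<open>Splitting \<open>r\<close> into two thresholds lets semicontinuity act on
        each summand separately; an infinite first summand admits any threshold.\<close>
      obtain a b where ab: "ereal a < f (fst z)" "ereal b < g (snd z)" "r < a + b"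
      proof (cases "f (fst z)")
        case (real p)
        then have "ereal (r - p) < g (snd z)"
          using r by (cases "g (snd z)") auto
        then obtain b where b: "r - p < b" "ereal b < g (snd z)"
          using ereal_dense2 by force
        from b(1) obtain a where "a < p" "r - b < a" using dense[of "r - b" p] by auto
        with b real show ?thesis by (intro that[of a b]) auto
      next
        case PInf
        obtain b where "ereal b < g (snd z)"
          using Gamma0_not_minus_inf[OF g] less_ereal.simps ereal_dense2[of "-\<infinity>" "g (snd z)"] by auto
        with PInf show ?thesis by (intro that[of "r - b + 1" b]) auto
      qed (use Gamma0_not_minus_inf[OF f] in auto)
      have "eventually (\<lambda>z. ereal a < f (fst z)) (nhds z)"
        by (intro Gamma0_eventually_less[OF f ab(1)] tendsto_fst filterlim_ident)
      moreover have "eventually (\<lambda>z. ereal b < g (snd z)) (nhds z)"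
        by (intro Gamma0_eventually_less[OF g ab(2)] tendsto_snd filterlim_ident)
      ultimately show "eventually (\<lambda>z. ereal r < f (fst z) + g (snd z)) (nhds z)"
      proof eventually_elim
        case (elim z)
        then have "ereal a + ereal b \<le> f (fst z) + g (snd z)"
          by (intro add_mono) auto
        with ab(3) show ?case
          by (metis ereal_less_eq(3) leD leI less_le_trans plus_ereal.simps(1) ereal_less(1) less_ereal.simps(1))
      qed
    qed
  next
    fix z w a b and t :: real
    assume z: "f (fst z) + g (snd z) = ereal a" and w: "f (fst w) + g (snd w) = ereal b"
      and t: "0 < t" "t < 1"
    obtain a1 a2 where a: "f (fst z) = ereal a1" "g (snd z) = ereal a2"
      using z by (cases "f (fst z)"; cases "g (snd z)") auto
    obtain b1 b2 where b: "f (fst w) = ereal b1" "g (snd w) = ereal b2"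
      using w by (cases "f (fst w)"; cases "g (snd w)") auto
    have "f ((1 - t) *\<^sub>R fst z + t *\<^sub>R fst w) + g ((1 - t) *\<^sub>R snd z + t *\<^sub>R snd w)
      \<le> ereal ((1 - t) * a1 + t * b1) + ereal ((1 - t) * a2 + t * b2)"
      using a b t f g by (intro add_mono Gamma0_convexD) auto
    moreover have "((1 - t) * a1 + t * b1) + ((1 - t) * a2 + t * b2) = (1 - t) * a + t * b"
      using z w a b by (auto simp: algebra_simps)
    ultimately show "f (fst ((1 - t) *\<^sub>R z + t *\<^sub>R w)) + g (snd ((1 - t) *\<^sub>R z + t *\<^sub>R w))
      \<le> ereal ((1 - t) * a + t * b)"
      by simp
  qed
qed

lemma Gamma0_compose_linear:
  assumes h: "h \<in> Gamma0" and M: "bounded_linear M" and x0: "h (M x0) \<noteq> \<infinity>"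
  shows "(\<lambda>x. h (M x)) \<in> Gamma0"
proof -
  interpret bounded_linear M by fact
  show ?thesis
  proof (rule Gamma0I)
    show "h (M x0) \<noteq> \<infinity>" by fact
    have "(M \<longlongrightarrow> M x) (nhds x)" for x
by (rule tendsto) (rule filterlim_ident)
    then show "lsc (\<lambda>x. h (M x))"
      unfolding lsc_iff by (blast intro: Gamma0_eventually_less[OF h])
  qed (use h Gamma0_not_minus_inf[OF h] in \<open>auto simp: add scaleR intro: Gamma0_convexD\<close>)
qed

section \<open>Strongly convex minimization\<close>

lemma self_adjoint_form_add:
  assumes "linear R" "self_adjoint R"
  shows "(x + y) \<bullet> R (x + y) = x \<bullet> R x + 2 * (y \<bullet> R x) + y \<bullet> R y"
proof -
  have "x \<bullet> R y = y \<bullet> R x"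
    using assms(2) by (metis self_adjoint_def inner_commute)
  then show ?thesis
    by (simp add: linear_add[OF assms(1)] inner_add)
qed

lemma self_adjoint_form_scale:
  assumes "linear R"
  shows "(t *\<^sub>R y) \<bullet> R (t *\<^sub>R y) = t\<^sup>2 * (y \<bullet> R y)"
  by (simp add: linear_scale[OF assms] power2_eq_square)

text \<open>Serves to drop the second-order term after an optimality inequality has been divided by
  the step length \<open>t\<close>. A small enough \<open>t\<close> makes \<open>t * b\<close> at
  most \<open>- a / 2\<close>.\<close>

lemma nonneg_affine_at_0:
  fixes a b :: real
  assumes "\<And>t. 0 < t \<Longrightarrow> t < 1 \<Longrightarrow> 0 \<le> a + t * b"
  shows "0 \<le> a"
proof (rule ccontr)
  assume "\<not> 0 \<le> a"
  define t where "t = min (1/2) (- a / (2 * (\<bar>b\<bar> + 1)))"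
  have "0 < - a / (2 * (\<bar>b\<bar> + 1))"
    using \<open>\<not> 0 \<le> a\<close> by (intro divide_pos_pos) auto
  then
  have t: "0 < t" "t < 1" "t \<le> - a / (2 * (\<bar>b\<bar> + 1))"
    unfolding t_def by linarith+
  have "t * b \<le> t * (\<bar>b\<bar> + 1)"
    using t by (intro mult_left_mono) auto
  also have "\<dots> \<le> - a / (2 * (\<bar>b\<bar> + 1)) * (\<bar>b\<bar> + 1)"
    using t by (intro mult_right_mono) auto
  also have "\<dots> = - a / 2"
    by (simp add: field_simps)
  finally show False
    using assms[OF t(1,2)] \<open>\<not> 0 \<le> a\<close> by simp
qed

text \<open>Fermat's rule. Comparing \<open>p\<close> with points a fraction \<open>t\<close> of the
  way to \<open>y\<close> and letting \<open>t\<close> vanish gives the inclusion; conversely the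
  quadratic lies above its linearization. The map \<open>T\<close> inside the form lets one lemma
  cover proximity operators (identity) and the \<open>p\<close>-step of SADMM.\<close>

lemma argmin_plus_quadratic_iff:
  fixes f :: "'a::real_inner \<Rightarrow> ereal" and T :: "'a \<Rightarrow> 'b::real_inner"
  assumes f: "f \<in> Gamma0" and T: "linear T"
    and R: "linear R" "self_adjoint R" "\<And>x. 0 \<le> x \<bullet> R x"
  shows "(\<forall>y. f p + ereal ((T p - c) \<bullet> R (T p - c) / 2) \<le> f y + ereal ((T y - c) \<bullet> R (T y - c) / 2))
    \<longleftrightarrow> (\<forall>y. ereal (T (y - p) \<bullet> R (c - T p)) + f p \<le> f y)" (is "?L \<longleftrightarrow> ?R")
proof -
  have expand: "(T p - c + T d) \<bullet> R (T p - c + T d) =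
      (T p - c) \<bullet> R (T p - c) - 2 * (T d \<bullet> R (c - T p)) + T d \<bullet> R (T d)" for d
  proof -
    have "R (c - T p) = - R (T p - c)"
      using linear_neg[OF R(1), of "T p - c"] by simp
    then show ?thesis
      by (simp add: self_adjoint_form_add[OF R(1,2)])
  qed
  have Ty: "T y - c = T p - c + T (y - p)" for y
    by (simp add: linear_diff[OF T])
  show ?thesis
  proof
    assume ?R
    show ?L
    proof
      fix y
      have *: "(T p - c) \<bullet> R (T p - c) / 2 - T (y - p) \<bullet> R (c - T p) \<le> (T y - c) \<bullet> R (T y - c) / 2"
        unfolding Ty[of y] expand using R(3)[of "T (y - p)"] by simp
      from \<open>?R\<close> have "ereal (T (y - p) \<bullet> R (c - T p)) + f p \<le> f y" by blast
      with * show "f p + ereal ((T p - c) \<bullet> R (T p - c) / 2) \<le> f y + ereal ((T y - c) \<bullet> R (T y - c) / 2)"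
        by (cases "f p"; cases "f y") auto
    qed
  next
    assume L: ?L
    obtain x0 r where x0: "f x0 = ereal r" using Gamma0_finite_point[OF f] .
    obtain a where a: "f p = ereal a"
      using L[rule_format, of x0] x0 Gamma0_not_minus_inf[OF f, of p] by (cases "f p") auto
    show ?R
    proof
      fix y
      show "ereal (T (y - p) \<bullet> R (c - T p)) + f p \<le> f y"
      proof (cases "f y")
        case (real b)
        define d where "d = y - p"
        have "0 \<le> (b - a - T d \<bullet> R (c - T p)) + t * (T d \<bullet> R (T d) / 2)" if t: "0 < t" "t < 1" for t
        proof -
          define z where "z = (1 - t) *\<^sub>R p + t *\<^sub>R y"
          have z: "z - p = t *\<^sub>R d" by (simp add: z_def d_def algebra_simps)
          have Tz: "T z - c = T p - c + T (t *\<^sub>R d)" using Ty[of z] z by simp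
          have "f z \<le> ereal ((1 - t) * a + t * b)"
            unfolding z_def using a real t f by (intro Gamma0_convexD) auto
          then have "f z + ereal ((T z - c) \<bullet> R (T z - c) / 2) \<le>
              ereal ((1 - t) * a + t * b) + ereal ((T z - c) \<bullet> R (T z - c) / 2)"
            by (rule add_right_mono)
          then have "f p + ereal ((T p - c) \<bullet> R (T p - c) / 2) \<le>
              ereal ((1 - t) * a + t * b) + ereal ((T z - c) \<bullet> R (T z - c) / 2)"
            using L[rule_format, of z] by (rule order_trans[rotated])
          then have "a + (T p - c) \<bullet> R (T p - c) / 2 \<le> (1 - t) * a + t * b +
              ((T p - c) \<bullet> R (T p - c) - 2 * t * (T d \<bullet> R (c - T p)) + t\<^sup>2 * (T d \<bullet> R (T d))) / 2"
            using a unfolding Tz expand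
            by (simp add: linear_scale[OF T] linear_scale[OF R(1)] power2_eq_square mult.assoc)
          then have "0 \<le> t * ((b - a - T d \<bullet> R (c - T p)) + t * (T d \<bullet> R (T d) / 2))"
            by (simp add: algebra_simps power2_eq_square add_divide_distrib diff_divide_distrib)
          then show ?thesis
            using t by (simp add: zero_le_mult_iff)
        qed
        then have "0 \<le> b - a - T d \<bullet> R (c - T p)" by (rule nonneg_affine_at_0)
        then show ?thesis using a real by (simp add: d_def)
      qed (use Gamma0_not_minus_inf[OF f, of y] in auto)
    qed
  qed
qed

lemma strongly_monotone_form_nonneg:
  "strongly_monotone S \<Longrightarrow> 0 \<le> x \<bullet> S x"
  unfolding strongly_monotone_def by (meson order_trans mult_nonneg_nonneg less_imp_le zero_le_power2)

text \<open>A minimizing sequence is Cauchy by strong convexity. The quadratic form of \<open>S\<close>, which need not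
  be bounded a priori, is lower semicontinuous as a supremum of continuous affine functions.\<close>

theorem ex_argmin_plus_quadratic:
  fixes f :: "'a::{real_inner,complete_space} \<Rightarrow> ereal"
  assumes f: "f \<in> Gamma0" and S: "linear S" "self_adjoint S" "strongly_monotone S"
  shows "\<exists>p. \<forall>y. f p + ereal ((p - c) \<bullet> S (p - c) / 2) \<le> f y + ereal ((y - c) \<bullet> S (y - c) / 2)"
proof -
  define q where "q x = (x - c) \<bullet> S (x - c) / 2" for x
  obtain \<beta> where \<beta>: "\<beta> > 0" "\<And>x. \<beta> * (norm x)\<^sup>2 \<le> x \<bullet> S x"
    using S(3) by (auto simp: strongly_monotone_def)
  obtain a b where ab: "a \<ge> 0" "b \<ge> 0" "\<And>x. ereal (- a - b * norm x) \<le> f x"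
    using Gamma0_lower_bound[OF f] by blast
  define m where "m = (INF y. f y + ereal (q y))"
  have m_le: "m \<le> f y + ereal (q y)" for y
    unfolding m_def by (rule INF_lower) simp
  \<comment> \<open>The affine minorant loses at most \<open>b * s\<close> at distance
    \<open>s\<close> from \<open>c\<close>, while the form gains
    \<open>\<beta> * s\<^sup>2 / 2\<close>; completing the square leaves the constant
    \<open>b\<^sup>2 / (2 * \<beta>)\<close>.\<close>
  have "ereal (- a - b * norm c - b\<^sup>2 / (2 * \<beta>)) \<le> m"
    unfolding m_def
  proof (rule INF_greatest)
    fix y
    have 1: "norm y \<le> norm c + norm (y - c)"
      using norm_triangle_sub[of y c] by simp
    have "0 \<le> (\<beta> * norm (y - c) - b)\<^sup>2 / (2 * \<beta>)"
      using \<beta> by simp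
    also have "\<dots> = \<beta> * (norm (y - c))\<^sup>2 / 2 - b * norm (y - c) + b\<^sup>2 / (2 * \<beta>)"
      using \<beta> by (simp add: field_simps power2_eq_square)
    also have "\<dots> \<le> q y - b * norm (y - c) + b\<^sup>2 / (2 * \<beta>)"
      using \<beta>(2)[of "y - c"] by (simp add: q_def)
    finally have "- a - b * norm c - b\<^sup>2 / (2 * \<beta>) \<le> - a - b * norm y + q y"
      using mult_left_mono[OF 1 ab(2)] by (simp add: algebra_simps)
    then have "ereal (- a - b * norm c - b\<^sup>2 / (2 * \<beta>)) \<le> ereal (- a - b * norm y) + ereal (q y)"
      by simp
    also have "\<dots> \<le> f y + ereal (q y)"
      by (intro add_right_mono ab)
    finally show "ereal (- a - b * norm c - b\<^sup>2 / (2 * \<beta>)) \<le> f y + ereal (q y)" .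
  qed
  moreover obtain x0 r where x0: "f x0 = ereal r" using Gamma0_finite_point[OF f] .
  then have "m \<le> ereal (r + q x0)" using m_le[of x0] by simp
  ultimately obtain \<mu> where \<mu>: "m = ereal \<mu>"
    by (cases m) auto
  have "\<exists>y. f y + ereal (q y) < ereal (\<mu> + 1 / real (Suc n))" for n
    using \<mu> INF_less_iff[of "\<lambda>y. f y + ereal (q y)" UNIV "ereal (\<mu> + 1 / real (Suc n))"]
    by (auto simp: m_def[symmetric])
  then obtain y where y: "\<And>n. f (y n) + ereal (q (y n)) < ereal (\<mu> + 1 / real (Suc n))"
    by metis
  have fy: "f (y n) \<le> ereal (\<mu> + 1 / real (Suc n) - q (y n))" for n
    using y[of n] by (cases "f (y n)") auto
  have q_mid: "q ((1 - 1/2) *\<^sub>R u + (1/2) *\<^sub>R v) \<le> (q u + q v) / 2 - \<beta> * (norm (u - v))\<^sup>2 / 8" for u v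
  proof -
    define h where "h = (1/2) *\<^sub>R (v - u)"
    have h: "(1 - 1/2) *\<^sub>R u + (1/2) *\<^sub>R v - c = (u - c) + h" "v - c = (u - c) + 2 *\<^sub>R h"
      "u - v = (- 2) *\<^sub>R h"
      by (simp_all add: h_def algebra_simps flip: scaleR_2)
    have "q ((1 - 1/2) *\<^sub>R u + (1/2) *\<^sub>R v) = (q u + q v) / 2 - h \<bullet> S h / 2"
      unfolding q_def h(1,2)
      by (simp only: self_adjoint_form_add[OF S(1,2)] self_adjoint_form_scale[OF S(1)])
         (simp add: field_simps)
    moreover have "\<beta> * (norm (u - v))\<^sup>2 / 8 \<le> h \<bullet> S h / 2"
      using \<beta>(2)[of h] unfolding h(3) by (simp add: power_mult_distrib)
    ultimately show ?thesis by simp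
  qed
  \<comment> \<open>The midpoint costs at least \<open>\<mu>\<close>, yet at most the average of two
    nearly minimal values minus the gain in \<open>q_mid\<close>. The gain is therefore bounded by
    the excess of these values.\<close>
  have close: "\<beta> * (norm (y i - y j))\<^sup>2 / 8 \<le> 1 / real (Suc n)" if "i \<ge> n" "j \<ge> n" for i j n
  proof -
    let ?z = "(1 - 1/2) *\<^sub>R y i + (1/2) *\<^sub>R y j"
    have le: "1 / real (Suc i) \<le> 1 / real (Suc n)" "1 / real (Suc j) \<le> 1 / real (Suc n)"
      using that by (auto simp: field_simps)
    have "f ?z \<le> ereal ((1 - 1/2) * (\<mu> + 1 / real (Suc i) - q (y i)) + 1/2 * (\<mu> + 1 / real (Suc j) - q (y j)))"
      by (intro Gamma0_convexD f fy) auto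
    then have "f ?z + ereal (q ?z) \<le>
        ereal ((1 - 1/2) * (\<mu> + 1 / real (Suc i) - q (y i)) + 1/2 * (\<mu> + 1 / real (Suc j) - q (y j)))
        + ereal (q ?z)"
      by (rule add_right_mono)
    with m_le[of ?z] have "ereal \<mu> \<le>
        ereal ((1 - 1/2) * (\<mu> + 1 / real (Suc i) - q (y i)) + 1/2 * (\<mu> + 1 / real (Suc j) - q (y j)))
        + ereal (q ?z)"
      unfolding \<mu> by (rule order_trans)
    then have "\<mu> \<le> (1 - 1/2) * (\<mu> + 1 / real (Suc i) - q (y i)) + 1/2 * (\<mu> + 1 / real (Suc j) - q (y j))
      + q ?z" by simp
    with q_mid[of "y i" "y j"] le show ?thesis by argo
  qed
  have "Cauchy y"
  proof (rule metric_CauchyI)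
    fix e :: real assume "e > 0"
    obtain n where n: "1 / real (Suc n) < \<beta> * e\<^sup>2 / 8"
      using \<open>e > 0\<close> \<beta>(1) nat_approx_posE[of "\<beta> * e\<^sup>2 / 8"] by auto
    have "dist (y i) (y j) < e" if "i \<ge> n" "j \<ge> n" for i j
    proof -
      have "\<beta> * (norm (y i - y j))\<^sup>2 / 8 < \<beta> * e\<^sup>2 / 8"
        using close[OF that] n by linarith
      then have "(norm (y i - y j))\<^sup>2 < e\<^sup>2" using \<beta>(1) by simp
      then show ?thesis using \<open>e > 0\<close> by (simp add: dist_norm power_less_imp_less_base)
    qed
    then show "\<exists>M. \<forall>m\<ge>M. \<forall>n\<ge>M. dist (y m) (y n) < e" by blast
  qed
  then obtain p where p: "y \<longlonglongrightarrow> p"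
    using Cauchy_convergent convergent_def by blast
  have "f (y n) \<le> ereal (\<mu> + 1 / real (Suc n) - q p - (y n - p) \<bullet> S (p - c))" for n
  proof -
    have "q p + (y n - p) \<bullet> S (p - c) \<le> q (y n)"
      using self_adjoint_form_add[OF S(1,2), of "p - c" "y n - p"]
        strongly_monotone_form_nonneg[OF S(3), of "y n - p"]
      by (simp add: q_def)
    then show ?thesis
      using order_trans[OF fy[of n]] by simp
  qed
  moreover have "(\<lambda>n. \<mu> + 1 / real (Suc n) - q p - (y n - p) \<bullet> S (p - c)) \<longlonglongrightarrow> \<mu> + 0 - q p - (p - p) \<bullet> S (p - c)"
    by (intro tendsto_intros p LIMSEQ_Suc[OF lim_1_over_n])
  ultimately have "f p \<le> ereal (\<mu> + 0 - q p - (p - p) \<bullet> S (p - c))"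
    using Gamma0_lsc_seq[OF f p] by blast
  then have "f p + ereal (q p) \<le> m"
    using \<mu> by (cases "f p") auto
  then show ?thesis
    using order_trans[OF _ m_le] unfolding q_def by blast
qed

section \<open>Subdifferentials and the proximal inclusion\<close>

lemma subdifferentialI: "(\<And>y. ereal ((y - x) \<bullet> u) + f x \<le> f y) \<Longrightarrow> u \<in> subdifferential f x"
  by (simp add: subdifferential_def)

lemma subdifferentialD: "u \<in> subdifferential f x \<Longrightarrow> ereal ((y - x) \<bullet> u) + f x \<le> f y"
  by (simp add: subdifferential_def)

lemma subdifferential_finite:
  assumes "f \<in> Gamma0" "u \<in> subdifferential f x"
  obtains r where "f x = ereal r"
proof -
  obtain x0 r where "f x0 = ereal r" using Gamma0_finite_point[OF assms(1)] .
  with subdifferentialD[OF assms(2), of x0] Gamma0_not_minus_inf[OF assms(1), of x] that show ?thesis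
    by (cases "f x") auto
qed

lemma subdifferential_monotone:
  assumes f: "f \<in> Gamma0" and u: "u \<in> subdifferential f x" and v: "v \<in> subdifferential f y"
  shows "0 \<le> (x - y) \<bullet> (u - v)"
proof -
  obtain a b where "f x = ereal a" "f y = ereal b"
    using subdifferential_finite[OF f u] subdifferential_finite[OF f v] by metis
  with subdifferentialD[OF u, of y] subdifferentialD[OF v, of x] show ?thesis
    by (simp add: inner_diff algebra_simps)
qed

text \<open>Existence is the optimality condition of a minimizer; uniqueness plays monotonicity of
  the subdifferential against strong monotonicity of \<open>S\<close>. Resolvents, proximity
  operators and projections are all read off from this inclusion.\<close>

lemma ex1_subdifferential_prox:
  fixes f :: "'a::{real_inner,complete_space} \<Rightarrow> ereal"
  assumes f: "f \<in> Gamma0" and S: "linear S" "self_adjoint S" "strongly_monotone S"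
  shows "\<exists>!p. S (c - p) \<in> subdifferential f p"
proof -
  obtain p where "\<forall>y. f p + ereal ((p - c) \<bullet> S (p - c) / 2) \<le> f y + ereal ((y - c) \<bullet> S (y - c) / 2)"
    using ex_argmin_plus_quadratic[OF f S, of c] by blast
  then have p: "S (c - p) \<in> subdifferential f p"
    using argmin_plus_quadratic_iff[OF f linear_ident S(1,2) strongly_monotone_form_nonneg[OF S(3)], of p c]
    by (simp add: subdifferential_def)
  obtain \<beta> where \<beta>: "\<beta> > 0" "\<And>x. \<beta> * (norm x)\<^sup>2 \<le> x \<bullet> S x"
    using S(3) by (auto simp: strongly_monotone_def)
  have "p' = p" if "S (c - p') \<in> subdifferential f p'" for p'
  proof -
    have "0 \<le> (p' - p) \<bullet> (S (c - p') - S (c - p))"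
      by (rule subdifferential_monotone[OF f that p])
    also have "S (c - p') - S (c - p) = - S (p' - p)"
      by (simp add: linear_diff[OF S(1)])
    finally have "\<beta> * (norm (p' - p))\<^sup>2 \<le> 0"
      using \<beta>(2)[of "p' - p"] by simp
    then show ?thesis
      using \<beta>(1) by (simp add: mult_le_0_iff)
  qed
  with p show ?thesis by blast
qed

section \<open>Riesz representation, uniform boundedness and weak compactness\<close>

lemma id_strongly_monotone:
  "linear (\<lambda>x. x)" "self_adjoint (\<lambda>x. x)" "strongly_monotone (\<lambda>x. x)"
  by (auto simp: linear_ident self_adjoint_def strongly_monotone_def power2_norm_eq_inner intro: exI[of _ 1])

text \<open>The proximal point \<open>p\<close> of \<open>- l\<close> at \<open>0\<close> is the
  representing vector: the subgradient inequality reads \<open>l z \<le> z \<bullet> p\<close>, and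
  applying it to \<open>- z\<close> gives equality.\<close>

theorem riesz_representation:
  fixes l :: "'a::{real_inner,complete_space} \<Rightarrow> real"
  assumes "bounded_linear l"
  shows "\<exists>a. \<forall>x. l x = x \<bullet> a"
proof -
  interpret bounded_linear l by fact
  have "(\<lambda>x. ereal (- l x)) \<in> Gamma0"
    by (intro Gamma0_linear bounded_linear_minus assms)
  then obtain p where p: "0 - p \<in> subdifferential (\<lambda>x. ereal (- l x)) p"
    using ex1_subdifferential_prox[OF _ id_strongly_monotone] by blast
  have le: "l z \<le> z \<bullet> p" for z
    using subdifferentialD[OF p, of "p + z"] by (simp add: add)
  have "l z = z \<bullet> p" for z
    using le[of z] le[of "- z"] by (simp add: linear_neg[OF bounded_linear.linear[OF assms]])
  then show ?thesis by blast
qed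

text \<open>\<open>adjoint\<close> is defined by choice, so its defining equation holds as soon as
  some operator satisfies it; Riesz representation provides one, vector by vector.\<close>

lemma adjoint_inner:
  fixes T :: "'a::{real_inner,complete_space} \<Rightarrow> 'b::real_inner"
  assumes "bounded_linear T"
  shows "T x \<bullet> y = x \<bullet> adjoint T y"
proof -
  have "\<exists>a. \<forall>x. T x \<bullet> y = x \<bullet> a" for y
    by (intro riesz_representation bounded_linear_compose[OF bounded_linear_inner_left assms])
  then have "\<exists>T'. \<forall>x y. T x \<bullet> y = x \<bullet> T' y"
    by metis
  then show ?thesis
    unfolding adjoint_def by (rule someI2_ex) simp
qed

lemma adjoint_inner_left:
  fixes T :: "'a::{real_inner,complete_space} \<Rightarrow> 'b::real_inner"
  assumes "bounded_linear T"
  shows "adjoint T y \<bullet> x = y \<bullet> T x"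
  using adjoint_inner[OF assms, of x y] by (simp add: inner_commute)

lemma bounded_linear_hilbert_adjoint:
  fixes T :: "'a::{real_inner,complete_space} \<Rightarrow> 'b::real_inner"
  assumes "bounded_linear T"
  shows "bounded_linear (adjoint T)"
proof -
  interpret bounded_linear T by fact
  obtain B where B: "B \<ge> 0" "\<And>x. norm (T x) \<le> norm x * B"
    using nonneg_bounded by blast
  note adj = adjoint_inner[OF assms]
  show ?thesis
  proof (rule bounded_linear_intro)
    fix y z
    have "x \<bullet> adjoint T (y + z) = x \<bullet> (adjoint T y + adjoint T z)" for x
      by (simp flip: adj add: inner_add)
    then show "adjoint T (y + z) = adjoint T y + adjoint T z"
      using vector_eq_ldot by blast
  next
    fix r y
    have "x \<bullet> adjoint T (r *\<^sub>R y) = x \<bullet> (r *\<^sub>R adjoint T y)" for x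
      by (simp flip: adj)
    then show "adjoint T (r *\<^sub>R y) = r *\<^sub>R adjoint T y"
      using vector_eq_ldot by blast
  next
    fix y
    have "norm (adjoint T y) * norm (adjoint T y) = T (adjoint T y) \<bullet> y"
      by (simp add: adj flip: power2_eq_square power2_norm_eq_inner)
    also have "\<dots> \<le> norm (T (adjoint T y)) * norm y"
      by (rule norm_cauchy_schwarz)
    also have "\<dots> \<le> norm (adjoint T y) * B * norm y"
      using B by (intro mult_right_mono) auto
    finally have "norm (adjoint T y) * norm (adjoint T y) \<le> norm (adjoint T y) * (norm y * B)"
      by (simp add: mult_ac)
    then show "norm (adjoint T y) \<le> norm y * B"
      using B(1) by (cases "norm (adjoint T y) = 0") auto
  qed
qed

lemma adjoint_hilbert_adjoint:
  fixes T :: "'a::{real_inner,complete_space} \<Rightarrow> 'b::real_inner"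
  assumes "bounded_linear T"
  shows "adjoint (adjoint T) = T"
  by (rule adjoint_unique) (simp add: adjoint_inner_left[OF assms])

text \<open>The Baire category theorem, applied to the sets of points at which all functionals are
  bounded by \<open>n\<close>.\<close>

theorem uniform_boundedness:
  fixes S :: "'a::{real_inner,complete_space} set"
  assumes "\<And>y. \<exists>c. \<forall>a\<in>S. a \<bullet> y \<le> c"
  shows "\<exists>C>0. \<forall>a\<in>S. norm a \<le> C"
proof -
  define E where "E n = {y. \<forall>a\<in>S. \<bar>a \<bullet> y\<bar> \<le> real n}" for n
  have closed: "closed (E n)" for n
  proof -
    have "E n = (\<Inter>a\<in>S. {y. \<bar>a \<bullet> y\<bar> \<le> real n})" by (auto simp: E_def)
    moreover have "closed {y. \<bar>a \<bullet> y\<bar> \<le> real n}" for a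
      by (intro closed_Collect_le continuous_intros)
    ultimately show ?thesis by auto
  qed
  have "(\<Union>n. E n) = UNIV"
  proof (intro set_eqI iffI UNIV_I)
    fix y
    \<comment> \<open>The hypothesis is one-sided; at \<open>- y\<close> it supplies the missing
      lower bound.\<close>
    obtain c d where c: "\<forall>a\<in>S. a \<bullet> y \<le> c" and d: "\<forall>a\<in>S. a \<bullet> (- y) \<le> d"
      using assms by meson
    obtain n where n: "max c d \<le> real n" using real_arch_simple by blast
    have "\<bar>a \<bullet> y\<bar> \<le> real n" if "a \<in> S" for a
      using c d n that by (fastforce simp: abs_le_iff)
    then show "y \<in> (\<Union>n. E n)"
      by (auto simp: E_def)
  qed
  moreover have "interior (\<Union>n. E n) = {}" if "\<And>n. interior (E n) = {}"
    using Met_TC.metric_Baire_category_alt[of "range E :: 'a set set"] that closed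
    by (auto simp: complete_UNIV)
  ultimately obtain n where "interior (E n) \<noteq> {}"
    by force
  then obtain y0 e where e: "e > 0" "cball y0 e \<subseteq> E n"
    by (meson all_not_in_conv mem_interior_cball)
  have "norm a \<le> 2 * real n / e" if a: "a \<in> S" for a
  proof (cases "a = 0")
    case False
    \<comment> \<open>Displacing the centre by \<open>e\<close> in the direction of \<open>a\<close>
      changes the value of \<open>a\<close> by \<open>e * norm a\<close>, while both values are at
      most \<open>n\<close> in modulus.\<close>
    define z where "z = y0 + (e / norm a) *\<^sub>R a"
    have "z \<in> cball y0 e" "y0 \<in> cball y0 e"
      using e(1) False by (auto simp: z_def dist_norm)
    then have "z \<in> E n" "y0 \<in> E n"
      using e(2) by blast+
    then have "\<bar>a \<bullet> z\<bar> \<le> real n" "\<bar>a \<bullet> y0\<bar> \<le> real n"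
      using a by (simp_all add: E_def)
    moreover have "a \<bullet> z = a \<bullet> y0 + e * norm a"
      using False by (simp add: z_def inner_add power2_norm_eq_inner[symmetric] power2_eq_square)
    ultimately show ?thesis
      using e(1) by (simp add: field_simps)
  qed (use e in auto)
  then have "norm a \<le> 2 * real n / e + 1" if "a \<in> S" for a
    using that by fastforce
  moreover have "0 < 2 * real n / e + 1"
    using e(1) by (simp add: add_nonneg_pos)
  ultimately show ?thesis by blast
qed

text \<open>On a fixed \<open>y\<close>, the vector \<open>S x\<close> acts as \<open>x\<close> acts
  on \<open>S y\<close>, so the image of the unit ball is pointwise bounded and uniform boundedness
  applies. This makes \<open>\<Sigma>\<close>, \<open>\<Upsilon>\<close> and their inverses
  bounded.\<close>

lemma hellinger_toeplitz:
  fixes S :: "'a::{real_inner,complete_space} \<Rightarrow> 'a"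
  assumes "linear S" "self_adjoint S"
  shows "bounded_linear S"
proof -
  have "\<exists>C>0. \<forall>a\<in>S ` cball 0 1. norm a \<le> C"
  proof (rule uniform_boundedness)
    fix y
    have "S x \<bullet> y \<le> norm (S y)" if "norm x \<le> 1" for x
    proof -
      have "S x \<bullet> y = x \<bullet> S y" using assms(2) by (simp add: self_adjoint_def)
      also have "\<dots> \<le> norm x * norm (S y)" by (rule norm_cauchy_schwarz)
      also have "\<dots> \<le> 1 * norm (S y)" using that by (intro mult_right_mono) auto
      finally show ?thesis by simp
    qed
    then show "\<exists>c. \<forall>a\<in>S ` cball 0 1. a \<bullet> y \<le> c" by (intro exI[of _ "norm (S y)"]) auto
  qed
  then obtain C where C: "C > 0" "\<And>x. norm x \<le> 1 \<Longrightarrow> norm (S x) \<le> C"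
    by auto
  have "norm (S x) \<le> norm x * C" for x
  proof (cases "x = 0")
    case True
    then show ?thesis using linear_0[OF assms(1)] by simp
  next
    case False
    have "norm (S ((1 / norm x) *\<^sub>R x)) \<le> C" using False by (intro C) auto
    then show ?thesis using False by (simp add: linear_scale[OF assms(1)] field_simps)
  qed
  then show ?thesis
    using assms(1) by (auto intro!: bounded_linear_intro simp: linear_add linear_scale)
qed

text \<open>The projection is the proximal point of the indicator function of \<open>V\<close>;
  since \<open>V\<close> contains \<open>z\<close> together with \<open>- z\<close>, the variational
  inequality becomes orthogonality.\<close>

lemma ex_orthogonal_projection:
  fixes V :: "'a::{real_inner,complete_space} set"
  assumes V: "subspace V" "closed V"
  shows "\<exists>p\<in>V. \<forall>z\<in>V. z \<bullet> (x - p) = 0"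
proof -
  define f where "f v = (if v \<in> V then 0 else \<infinity> :: ereal)" for v
  have "f \<in> Gamma0"
  proof (rule Gamma0I)
    show "f 0 \<noteq> \<infinity>" using subspace_0[OF V(1)] by (simp add: f_def)
    show "lsc f"
      unfolding lsc_iff
    proof (intro allI impI)
      fix x r assume r: "ereal r < f x"
      show "eventually (\<lambda>z. ereal r < f z) (nhds x)"
      proof (cases "x \<in> V")
        case True
        with r have "r < 0" by (simp add: f_def zero_ereal_def)
        then show ?thesis by (auto simp: f_def zero_ereal_def)
      next
        case False
        have "open (- V)" using V(2) by (simp add: open_Compl)
        then have "eventually (\<lambda>z. z \<in> - V) (nhds x)" using False eventually_nhds by blast
        then show ?thesis by eventually_elim (simp add: f_def)
      qed
    qed
    fix u v a b and t :: real
    assume "f u = ereal a" "f v = ereal b"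
    then have "u \<in> V" "v \<in> V" "a = 0" "b = 0" by (auto simp: f_def zero_ereal_def split: if_splits)
    then show "f ((1 - t) *\<^sub>R u + t *\<^sub>R v) \<le> ereal ((1 - t) * a + t * b)"
      using V(1) by (auto simp: f_def zero_ereal_def subspace_add subspace_scale)
  qed (simp add: f_def)
  then obtain p where p: "x - p \<in> subdifferential f p"
    using ex1_subdifferential_prox[OF _ id_strongly_monotone] by blast
  have pV: "p \<in> V"
    using subdifferentialD[OF p, of 0] subspace_0[OF V(1)] by (auto simp: f_def split: if_splits)
  have le: "z \<bullet> (x - p) \<le> 0" if "z \<in> V" for z
    using subdifferentialD[OF p, of "p + z"] that pV subspace_add[OF V(1)]
    by (simp add: f_def zero_ereal_def)
  have "z \<bullet> (x - p) = 0" if "z \<in> V" for z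
    using le[OF that] le[of "- z"] subspace_neg[OF V(1) that] by simp
  with pV show ?thesis by blast
qed

section \<open>Weak convergence and weak sequential compactness\<close>

lemma weakly_convergesD: "weakly_converges s l \<Longrightarrow> (\<lambda>n. s n \<bullet> w) \<longlonglongrightarrow> l \<bullet> w"
  by (simp add: weakly_converges_def)

lemma weakly_converges_Suc_iff: "weakly_converges (\<lambda>n. s (Suc n)) l \<longleftrightarrow> weakly_converges s l"
  unfolding weakly_converges_def using filterlim_sequentially_Suc[of "\<lambda>n. s n \<bullet> _"] by auto

lemma tendsto_imp_weakly_converges: "s \<longlonglongrightarrow> l \<Longrightarrow> weakly_converges s l"
  unfolding weakly_converges_def by (auto intro: tendsto_intros)

lemma weakly_converges_add:
  "weakly_converges s l \<Longrightarrow> weakly_converges t m \<Longrightarrow> weakly_converges (\<lambda>n. s n + t n) (l + m)"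
  unfolding weakly_converges_def by (auto simp: inner_add intro: tendsto_intros)

lemma weakly_converges_minus:
  "weakly_converges s l \<Longrightarrow> weakly_converges (\<lambda>n. - s n) (- l)"
  unfolding weakly_converges_def by (auto intro: tendsto_intros)

lemma weakly_converges_bounded_linear:
  fixes M :: "'a::{real_inner,complete_space} \<Rightarrow> 'b::real_inner"
  assumes "weakly_converges s l" "bounded_linear M"
  shows "weakly_converges (\<lambda>n. M (s n)) (M l)"
  using assms(1) unfolding weakly_converges_def adjoint_inner[OF assms(2)] by blast

lemma weakly_converges_inner_tendsto:
  fixes s t :: "nat \<Rightarrow> 'a::real_inner"
  assumes s: "weakly_converges s l" and bdd: "\<And>n. norm (s n) \<le> C" and t: "t \<longlonglongrightarrow> m"
  shows "(\<lambda>n. s n \<bullet> t n) \<longlonglongrightarrow> l \<bullet> m"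
proof -
  have "(\<lambda>n. s n \<bullet> (t n - m)) \<longlonglongrightarrow> 0"
  proof (rule Lim_null_comparison)
    show "eventually (\<lambda>n. norm (s n \<bullet> (t n - m)) \<le> C * norm (t n - m)) sequentially"
      using order_trans[OF Cauchy_Schwarz_ineq2 mult_right_mono[OF bdd norm_ge_zero]] by auto
    have "(\<lambda>n. t n - m) \<longlonglongrightarrow> m - m" by (rule tendsto_diff[OF t tendsto_const])
    then have "(\<lambda>n. C * norm (t n - m)) \<longlonglongrightarrow> C * norm (m - m)"
      by (intro tendsto_mult_left tendsto_norm)
    then show "(\<lambda>n. C * norm (t n - m)) \<longlonglongrightarrow> 0" by simp
  qed
  then have "(\<lambda>n. s n \<bullet> (t n - m) + s n \<bullet> m) \<longlonglongrightarrow> 0 + l \<bullet> m"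
    by (intro tendsto_intros weakly_convergesD[OF s])
  then show ?thesis by (simp add: inner_diff)
qed

text \<open>A diagonal subsequence converges when tested against each \<open>x n\<close>. The set of vectors testing
  convergently is a closed subspace, and its orthogonal complement is orthogonal to all \<open>x n\<close>.\<close>

theorem bounded_imp_weakly_convergent_subsequence:
  fixes x :: "nat \<Rightarrow> 'a::{real_inner,complete_space}"
  assumes bdd: "\<And>n. norm (x n) \<le> C"
  shows "\<exists>r l. strict_mono r \<and> weakly_converges (\<lambda>n. x (r n)) l"
proof -
  have C: "0 \<le> C" using bdd[of 0] norm_ge_zero order_trans by blast
  have inner_bdd: "\<bar>x n \<bullet> w\<bar> \<le> C * norm w" for n w
    using order_trans[OF Cauchy_Schwarz_ineq2 mult_right_mono[OF bdd norm_ge_zero]] by auto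
  interpret subseqs "\<lambda>n s. convergent (\<lambda>k. x (s k) \<bullet> x n)"
  proof
    fix n and s :: "nat \<Rightarrow> nat"
    have "bounded (range (\<lambda>k. x (s k) \<bullet> x n))"
      using inner_bdd by (auto simp: bounded_iff)
    then obtain l r where "strict_mono (r :: nat \<Rightarrow> nat)" "((\<lambda>k. x (s k) \<bullet> x n) \<circ> r) \<longlonglongrightarrow> l"
      using bounded_imp_convergent_subsequence by blast
    then show "\<exists>r'. strict_mono r' \<and> convergent (\<lambda>k. x ((s \<circ> r') k) \<bullet> x n)"
      by (auto simp: convergent_def o_def)
  qed
  define r where "r = diagseq"
  have r: "strict_mono r" unfolding r_def by (rule subseq_diagseq)
  \<comment> \<open>Only the tail of the diagonal sequence beyond \<open>n\<close> is a subsequence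
    of the refinement made for \<open>x n\<close>; dropping finitely many terms does not affect
    convergence.\<close>
  have "convergent (\<lambda>k. x ((diagseq \<circ> (+) (Suc n)) k) \<bullet> x n)" for n
  proof (rule diagseq_holds)
    fix q s :: "nat \<Rightarrow> nat" and n
    assume "strict_mono q" "convergent (\<lambda>k. x (s k) \<bullet> x n)"
    then show "convergent (\<lambda>k. x ((s \<circ> q) k) \<bullet> x n)"
      using convergent_subseq_convergent[of "\<lambda>k. x (s k) \<bullet> x n" q] by (simp add: o_def)
  qed
  moreover have "(\<lambda>k. x ((diagseq \<circ> (+) (Suc n)) k) \<bullet> x n) = (\<lambda>k. x (r (k + Suc n)) \<bullet> x n)" for n
    by (simp add: r_def add.commute)
  ultimately have conv_x: "convergent (\<lambda>k. x (r k) \<bullet> x n)" for n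
    using convergent_ignore_initial_segment[of "\<lambda>k. x (r k) \<bullet> x n" "Suc n"] by metis
  define E where "E = {w. convergent (\<lambda>k. x (r k) \<bullet> w)}"
  have sub: "subspace E"
    unfolding E_def by (intro subspaceI)
      (auto simp: inner_add convergent_const intro: convergent_add convergent_mult)
  have "closed E"
    unfolding closed_sequential_limits
  proof (intro allI impI, elim conjE)
    fix w :: "nat \<Rightarrow> 'a" and l
    assume w: "\<forall>n. w n \<in> E" "w \<longlonglongrightarrow> l"
    have "Cauchy (\<lambda>k. x (r k) \<bullet> l)"
    proof (rule metric_CauchyI)
      fix e :: real assume e: "e > 0"
      \<comment> \<open>The summand \<open>1\<close> keeps the denominator positive when
        \<open>C = 0\<close>. The budget \<open>e / 4\<close> is spent twice on replacing
        \<open>l\<close> by \<open>w j\<close> and once on the Cauchy estimate for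
        \<open>w j\<close>.\<close>
      then have "e / (4 * (C + 1)) > 0" using C by simp
      then obtain j where j: "dist (w j) l < e / (4 * (C + 1))"
        using w(2) by (metis LIMSEQ_iff_nz order_refl metric_LIMSEQ_D)
      have small: "\<bar>x (r k) \<bullet> l - x (r k) \<bullet> w j\<bar> \<le> e / 4" for k
      proof -
        have "\<bar>x (r k) \<bullet> l - x (r k) \<bullet> w j\<bar> \<le> C * norm (l - w j)"
          using inner_bdd[of "r k" "l - w j"] by (simp add: inner_diff)
        also have "\<dots> \<le> (C + 1) * (e / (4 * (C + 1)))"
          using C j by (intro mult_mono) (auto simp: dist_norm norm_minus_commute)
        also have "\<dots> = e / 4" using C by (simp add: divide_eq_eq algebra_simps)
        finally show ?thesis .
      qed
      have "Cauchy (\<lambda>k. x (r k) \<bullet> w j)" using w(1) by (auto simp: E_def intro: convergent_Cauchy)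
      then obtain N where N: "\<And>m n. m \<ge> N \<Longrightarrow> n \<ge> N \<Longrightarrow> dist (x (r m) \<bullet> w j) (x (r n) \<bullet> w j) < e / 4"
        using e metric_CauchyD[of "\<lambda>k. x (r k) \<bullet> w j" "e / 4"] by (metis zero_less_divide_iff zero_less_numeral)
      have "dist (x (r m) \<bullet> l) (x (r n) \<bullet> l) < e" if "m \<ge> N" "n \<ge> N" for m n
        using N[OF that] small[of m] small[of n] e unfolding dist_real_def by argo
      then show "\<exists>M. \<forall>m\<ge>M. \<forall>n\<ge>M. dist (x (r m) \<bullet> l) (x (r n) \<bullet> l) < e" by blast
    qed
    then show "l \<in> E" by (simp add: E_def Cauchy_convergent)
  qed
  have "w \<in> E" for w
  proof -
    obtain p where p: "p \<in> E" "\<And>z. z \<in> E \<Longrightarrow> z \<bullet> (w - p) = 0"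
      using ex_orthogonal_projection[OF sub \<open>closed E\<close>] by blast
    have "x n \<bullet> (w - p) = 0" for n using p(2)[of "x n"] conv_x by (simp add: E_def)
    then have "x n \<bullet> w = x n \<bullet> p" for n by (simp add: inner_diff)
    with p(1) show ?thesis by (simp add: E_def)
  qed
  then have lim: "(\<lambda>k. x (r k) \<bullet> w) \<longlonglongrightarrow> lim (\<lambda>k. x (r k) \<bullet> w)" for w
    by (simp add: E_def convergent_LIMSEQ_iff)
  define \<phi> where "\<phi> w = lim (\<lambda>k. x (r k) \<bullet> w)" for w
  note lim = lim[folded \<phi>_def]
  have "bounded_linear \<phi>"
  proof (rule bounded_linear_intro)
    fix u v
    have "(\<lambda>k. x (r k) \<bullet> (u + v)) \<longlonglongrightarrow> \<phi> u + \<phi> v"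
      unfolding inner_add by (intro tendsto_add lim)
    then show "\<phi> (u + v) = \<phi> u + \<phi> v" using lim LIMSEQ_unique by blast
  next
    fix c u
    have "(\<lambda>k. x (r k) \<bullet> (c *\<^sub>R u)) \<longlonglongrightarrow> c * \<phi> u"
      unfolding inner_scaleR by (intro tendsto_intros lim)
    then show "\<phi> (c *\<^sub>R u) = c *\<^sub>R \<phi> u" using lim LIMSEQ_unique by (metis real_scaleR_def)
  next
    fix u
    have "(\<lambda>k. \<bar>x (r k) \<bullet> u\<bar>) \<longlonglongrightarrow> \<bar>\<phi> u\<bar>" by (intro tendsto_intros lim)
    then show "norm (\<phi> u) \<le> norm u * C"
      using inner_bdd by (auto intro!: LIMSEQ_le_const2 simp: mult.commute)
  qed
  then obtain l where "\<And>w. \<phi> w = w \<bullet> l" using riesz_representation by blast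
  with lim have "weakly_converges (\<lambda>n. x (r n)) l" by (simp add: weakly_converges_def inner_commute)
  with r show ?thesis by blast
qed

text \<open>A subsequence that stays away from \<open>l\<close> when tested against some
  \<open>w\<close> would, by weak compactness, contain a weakly convergent one, whose limit the
  hypothesis identifies as \<open>l\<close>.\<close>

lemma weakly_convergesI_subseq:
  fixes x :: "nat \<Rightarrow> 'a::{real_inner,complete_space}"
  assumes bdd: "\<And>n. norm (x n) \<le> C"
    and uniq: "\<And>r m. strict_mono (r :: nat \<Rightarrow> nat) \<Longrightarrow> weakly_converges (\<lambda>n. x (r n)) m \<Longrightarrow> m = l"
  shows "weakly_converges x l"
  unfolding weakly_converges_def
proof (rule allI, rule ccontr)
  fix w
  assume "\<not> (\<lambda>n. x n \<bullet> w) \<longlonglongrightarrow> l \<bullet> w"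
  then obtain e where e: "e > 0" "\<And>N. \<exists>n\<ge>N. e \<le> dist (x n \<bullet> w) (l \<bullet> w)"
    by (auto simp: lim_sequentially not_less)
  then have "infinite {n. e \<le> dist (x n \<bullet> w) (l \<bullet> w)}"
    unfolding infinite_nat_iff_unbounded_le by auto
  then obtain r :: "nat \<Rightarrow> nat" where r: "strict_mono r" "\<And>n. e \<le> dist (x (r n) \<bullet> w) (l \<bullet> w)"
    using infinite_enumerate by blast
  obtain q m where q: "strict_mono (q :: nat \<Rightarrow> nat)" "weakly_converges (\<lambda>n. x (r (q n))) m"
    using bounded_imp_weakly_convergent_subsequence[of "\<lambda>n. x (r n)" C] bdd by blast
  have "m = l" using uniq[of "r \<circ> q" m] strict_mono_o[OF r(1) q(1)] q(2) by (simp add: o_def)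
  with q(2) have "(\<lambda>n. x (r (q n)) \<bullet> w) \<longlonglongrightarrow> l \<bullet> w" by (simp add: weakly_converges_def)
  then obtain n where "dist (x (r (q n)) \<bullet> w) (l \<bullet> w) < e" using e(1) by (meson metric_LIMSEQ_D order_refl)
  with r(2)[of "q n"] show False by simp
qed

section \<open>Conjugation\<close>

lemma conjugate_ge: "ereal (x \<bullet> u) - f x \<le> conjugate f u"
  unfolding conjugate_def by (rule SUP_upper) simp

lemma conjugate_le_iff: "conjugate f u \<le> ereal r \<longleftrightarrow> (\<forall>x. ereal (x \<bullet> u - r) \<le> f x)"
proof -
  have "ereal (x \<bullet> u) - f x \<le> ereal r \<longleftrightarrow> ereal (x \<bullet> u - r) \<le> f x" for x
    by (cases "f x") auto
  then show ?thesis
    by (simp add: conjugate_def SUP_le_iff)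
qed

text \<open>The finite value at \<open>x0\<close> gives an affine minorant and so excludes
  \<open>-\<infinity>\<close>; \<open>u0\<close> supplies a point of the domain. The rest is
  inherited from a supremum of affine functions.\<close>

lemma Gamma0_conjugateI:
  assumes x0: "f x0 = ereal a" and u0: "conjugate f u0 \<noteq> \<infinity>"
  shows "conjugate f \<in> Gamma0"
proof (rule Gamma0I)
  fix u
  show "conjugate f u \<noteq> -\<infinity>"
    using conjugate_ge[of x0 u f] x0 by auto
next
  show "conjugate f u0 \<noteq> \<infinity>" by fact
next
  show "lsc (conjugate f)"
    unfolding lsc_iff
  proof (intro allI impI)
    fix u r
    assume "ereal r < conjugate f u"
    then obtain x where x: "ereal r < ereal (x \<bullet> u) - f x"
      by (auto simp: conjugate_def less_SUP_iff)
    have "eventually (\<lambda>z. ereal r < ereal (x \<bullet> z) - f x) (nhds u)"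
    proof (cases "f x")
      case (real b)
      have "((\<lambda>z. x \<bullet> z - b) \<longlongrightarrow> x \<bullet> u - b) (nhds u)"
        by (intro tendsto_intros filterlim_ident)
      then have "eventually (\<lambda>z. r < x \<bullet> z - b) (nhds u)"
        using x real by (intro order_tendstoD(1)) auto
      then show ?thesis using real by simp
    qed (use x in auto)
    then show "eventually (\<lambda>z. ereal r < conjugate f z) (nhds u)"
      by eventually_elim (rule less_le_trans[OF _ conjugate_ge])
  qed
next
  fix u v b c and t :: real
  assume "conjugate f u = ereal b" "conjugate f v = ereal c" and t: "0 < t" "t < 1"
  then have b: "\<And>x. ereal (x \<bullet> u - b) \<le> f x" and c: "\<And>x. ereal (x \<bullet> v - c) \<le> f x"
    by (metis conjugate_le_iff order_refl)+
  show "conjugate f ((1 - t) *\<^sub>R u + t *\<^sub>R v) \<le> ereal ((1 - t) * b + t * c)"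
    unfolding conjugate_le_iff
  proof
    fix x
    show "ereal (x \<bullet> ((1 - t) *\<^sub>R u + t *\<^sub>R v) - ((1 - t) * b + t * c)) \<le> f x"
    proof (cases "f x")
      case (real d)
      have "(1 - t) * (x \<bullet> u - b) + t * (x \<bullet> v - c) \<le> (1 - t) * d + t * d"
        using b[of x] c[of x] real t by (intro add_mono mult_left_mono) auto
      then show ?thesis using real by (simp add: inner_add algebra_simps)
    qed (use b[of x] in auto)
  qed
qed

lemma subdifferential_conjugate_le:
  assumes "u \<in> subdifferential f x" "f x = ereal a"
  shows "conjugate f u \<le> ereal (x \<bullet> u - a)"
  unfolding conjugate_le_iff
proof
  fix y
  show "ereal (y \<bullet> u - (x \<bullet> u - a)) \<le> f y"
    using subdifferentialD[OF assms(1), of y] assms(2) by (simp add: inner_diff algebra_simps)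
qed

text \<open>Only properness is at stake: the proximal point \<open>p\<close> of \<open>0\<close> has
  the subgradient \<open>- p\<close>, and the conjugate is finite there.\<close>

lemma Gamma0_conjugate:
  fixes f :: "'a::{real_inner,complete_space} \<Rightarrow> ereal"
  assumes f: "f \<in> Gamma0"
  shows "conjugate f \<in> Gamma0"
proof -
  obtain p where p: "0 - p \<in> subdifferential f p"
    using ex1_subdifferential_prox[OF f id_strongly_monotone] by blast
  obtain a where a: "f p = ereal a" using subdifferential_finite[OF f p] .
  then show ?thesis
    using subdifferential_conjugate_le[OF p a] by (intro Gamma0_conjugateI[of f p a "0 - p"]) auto
qed

text \<open>Young's inequality, weighted so that the square of the unknown \<open>y\<close> costs
  only a quarter and can be absorbed on the other side.\<close>

lemma mult_le_power2_add: "x * y \<le> x\<^sup>2 + y\<^sup>2 / 4" for x y :: real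
  using zero_le_power2[of "x - y / 2"] by (simp add: power2_diff power_divide)

lemma power2_le_inverse_Suc_imp_tendsto_0:
  fixes d :: "nat \<Rightarrow> real"
  assumes "\<And>n. (d n)\<^sup>2 \<le> D / real (Suc n)"
  shows "d \<longlonglongrightarrow> 0"
proof -
  have "(\<lambda>n. D / real (Suc n)) \<longlonglongrightarrow> 0"
    by (rule LIMSEQ_Suc[OF lim_const_over_n])
  moreover have "eventually (\<lambda>n. norm ((d n)\<^sup>2) \<le> D / real (Suc n)) sequentially"
    by (intro always_eventually allI) (simp only: real_norm_def abs_power2 assms)
  ultimately have "(\<lambda>n. (d n)\<^sup>2) \<longlonglongrightarrow> 0"
    by (rule Lim_null_comparison[rotated])
  then have "(\<lambda>n. sqrt ((d n)\<^sup>2)) \<longlonglongrightarrow> sqrt 0" by (rule tendsto_real_sqrt)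
  then show ?thesis by (simp add: tendsto_rabs_zero_iff)
qed

text \<open>With \<open>p n\<close> the proximal point of \<open>x\<close> for parameter \<open>1/(n+1)\<close>, the affine minorants of \<open>f\<close>
  exact at \<open>p n\<close> force \<open>p n \<longlonglongrightarrow> x\<close> and \<open>f (p n) \<le> r\<close> whenever the biconjugate is at most \<open>r\<close> at \<open>x\<close>.\<close>

theorem fenchel_moreau:
  fixes f :: "'a::{real_inner,complete_space} \<Rightarrow> ereal"
  assumes f: "f \<in> Gamma0"
  shows "conjugate (conjugate f) = f"
proof (rule ext, rule antisym)
  fix x
  show "conjugate (conjugate f) x \<le> f x"
  proof (cases "f x")
    case (real a)
    have "ereal (u \<bullet> x - a) \<le> conjugate f u" for u
      using conjugate_ge[of x u f] real by (simp add: inner_commute)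
    then show ?thesis using real conjugate_le_iff by metis
  qed (use Gamma0_not_minus_inf[OF f] in auto)
  show "f x \<le> conjugate (conjugate f) x"
  proof (rule ereal_le_real)
    fix r
    assume r: "conjugate (conjugate f) x \<le> ereal r"
    have "\<exists>p. real (Suc n) *\<^sub>R (x - p) \<in> subdifferential f p" for n
    proof -
      have "linear (\<lambda>y::'a. real (Suc n) *\<^sub>R y)" by (rule linear_scale_self)
      moreover have "self_adjoint (\<lambda>y::'a. real (Suc n) *\<^sub>R y)" by (simp add: self_adjoint_def)
      moreover have "strongly_monotone (\<lambda>y::'a. real (Suc n) *\<^sub>R y)"
        unfolding strongly_monotone_def by (intro exI[of _ "real (Suc n)"]) (simp add: power2_norm_eq_inner)
      ultimately show ?thesis using ex1_subdifferential_prox[OF f] by blast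
    qed
    then obtain p where p: "\<And>n. real (Suc n) *\<^sub>R (x - p n) \<in> subdifferential f (p n)" by metis
    have "\<exists>a. f (p n) = ereal a" for n using subdifferential_finite[OF f p] by metis
    then obtain a where a: "\<And>n. f (p n) = ereal (a n)" by metis
    define d where "d n = norm (x - p n)" for n
    \<comment> \<open>The bound on the biconjugate is tested at the subgradient \<open>?w\<close>,
      where the conjugate is at most \<open>p n \<bullet> ?w - a n\<close>; the difference of the
      linear terms is the squared distance times \<open>n + 1\<close>.\<close>
    have le: "a n + real (Suc n) * (d n)\<^sup>2 \<le> r" for n
    proof -
      let ?w = "real (Suc n) *\<^sub>R (x - p n)"
      have "ereal (?w \<bullet> x - r) \<le> conjugate f ?w" using r by (simp only: conjugate_le_iff)
      also have "\<dots> \<le> ereal (p n \<bullet> ?w - a n)" by (rule subdifferential_conjugate_le[OF p a])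
      finally have "a n + ?w \<bullet> (x - p n) \<le> r" by (simp add: inner_diff inner_commute algebra_simps)
      then show ?thesis by (simp add: d_def power2_norm_eq_inner)
    qed
    obtain \<alpha> \<beta> where ab: "\<alpha> \<ge> 0" "\<beta> \<ge> 0" "\<And>x. ereal (- \<alpha> - \<beta> * norm x) \<le> f x"
      using Gamma0_lower_bound[OF f] by blast
    define D where "D = r + \<alpha> + \<beta> * norm x + \<beta>\<^sup>2"
    \<comment> \<open>An affine minorant of \<open>f\<close> bounds \<open>a n\<close> below by a
      term linear in \<open>d n\<close>, which Young's inequality absorbs into the growing quadratic
      term.\<close>
    have d: "(d n)\<^sup>2 \<le> 2 * D / real (Suc n)" for n
    proof -
      have "norm (p n) \<le> norm x + d n" unfolding d_def
        by (metis norm_minus_commute norm_triangle_sub)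
      then have "\<beta> * norm (p n) \<le> \<beta> * (norm x + d n)" using ab by (intro mult_left_mono)
      then have "- \<alpha> - \<beta> * norm x - \<beta> * d n \<le> a n"
        using ab(3)[of "p n"] a[of n] by (simp add: algebra_simps)
      moreover have "\<beta> * d n \<le> \<beta>\<^sup>2 + (d n)\<^sup>2 / 4"
        by (rule mult_le_power2_add)
      moreover define X where X: "X = real (Suc n) * (d n)\<^sup>2"
      have "(d n)\<^sup>2 \<le> X" "0 \<le> X" by (simp_all add: X mult_le_cancel_right1)
      ultimately have "X \<le> 2 * D" using le[of n, folded X] unfolding D_def by argo
      then have "real (Suc n) * (d n)\<^sup>2 \<le> 2 * D" by (simp add: X)
      then show ?thesis by (simp add: field_simps)
    qed
    have "d \<longlonglongrightarrow> 0" by (rule power2_le_inverse_Suc_imp_tendsto_0[OF d])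
    then have "(\<lambda>n. norm (p n - x)) \<longlonglongrightarrow> 0" by (simp add: d_def[abs_def] norm_minus_commute)
    then have "p \<longlonglongrightarrow> x" by (simp add: tendsto_norm_zero_iff LIM_zero_iff)
    moreover have "f (p n) \<le> ereal r" for n
      using le[of n] a[of n] by (simp add: order_trans[rotated])
    ultimately show "f x \<le> ereal r" using Gamma0_lsc_seq[OF f _ tendsto_const] by blast
  qed
qed

lemma subdifferential_imp_conjugate:
  assumes f: "f \<in> Gamma0" and u: "u \<in> subdifferential f x"
  shows "x \<in> subdifferential (conjugate f) u"
proof (rule subdifferentialI)
  fix v
  obtain a where a: "f x = ereal a" using subdifferential_finite[OF f u] .
  have "ereal ((v - u) \<bullet> x) + conjugate f u \<le> ereal ((v - u) \<bullet> x) + ereal (x \<bullet> u - a)"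
    by (intro add_left_mono subdifferential_conjugate_le u a)
  also have "\<dots> = ereal (x \<bullet> v) - f x" using a by (simp add: inner_diff inner_commute)
  also have "\<dots> \<le> conjugate f v" by (rule conjugate_ge)
  finally show "ereal ((v - u) \<bullet> x) + conjugate f u \<le> conjugate f v" .
qed

lemma subdifferential_conjugate_iff:
  fixes f :: "'a::{real_inner,complete_space} \<Rightarrow> ereal"
  assumes f: "f \<in> Gamma0"
  shows "x \<in> subdifferential (conjugate f) u \<longleftrightarrow> u \<in> subdifferential f x"
  using subdifferential_imp_conjugate[OF f] subdifferential_imp_conjugate[OF Gamma0_conjugate[OF f], of x u]
  by (auto simp: fenchel_moreau[OF f])

text \<open>By Fenchel-Moreau \<open>f\<close> is a supremum of continuous affine functions, and
  each of these is weakly continuous. One of them already exceeds \<open>r\<close> at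
  \<open>l\<close>.\<close>

lemma Gamma0_weakly_eventually_less:
  fixes f :: "'a::{real_inner,complete_space} \<Rightarrow> ereal"
  assumes f: "f \<in> Gamma0" and s: "weakly_converges s l" and r: "ereal r < f l"
  shows "eventually (\<lambda>n. ereal r < f (s n)) sequentially"
proof -
  have "ereal r < conjugate (conjugate f) l" using r by (simp add: fenchel_moreau[OF f])
  then obtain u where u: "ereal r < ereal (u \<bullet> l) - conjugate f u"
    by (auto simp: conjugate_def[of "conjugate f"] less_SUP_iff)
  then obtain b where b: "conjugate f u = ereal b"
    using Gamma0_not_minus_inf[OF Gamma0_conjugate[OF f], of u] by (cases "conjugate f u") auto
  have "(\<lambda>n. s n \<bullet> u - b) \<longlonglongrightarrow> l \<bullet> u - b"
    by (intro tendsto_intros weakly_convergesD s)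
  then have "eventually (\<lambda>n. r < s n \<bullet> u - b) sequentially"
    using u b by (intro order_tendstoD(1)) (auto simp: inner_commute)
  then show ?thesis
  proof eventually_elim
    case (elim n)
    then have "ereal r < ereal (u \<bullet> s n) - conjugate f u" using b by (simp add: inner_commute)
    also have "\<dots> \<le> f (s n)" using conjugate_ge[of u "s n" "conjugate f"] by (simp add: fenchel_moreau[OF f])
    finally show ?case .
  qed
qed

lemma Gamma0_weakly_lsc_seq:
  fixes f :: "'a::{real_inner,complete_space} \<Rightarrow> ereal"
  assumes f: "f \<in> Gamma0" and s: "weakly_converges s l"
    and c: "c \<longlonglongrightarrow> c0" "\<And>n. f (s n) \<le> ereal (c n)"
  shows "f l \<le> ereal c0"
proof (rule ccontr)
  assume "\<not> f l \<le> ereal c0"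
  then obtain r where r: "c0 < r" "ereal r < f l"
    using ereal_dense2[of "ereal c0" "f l"] by (metis ereal_less(2) less_ereal.simps(1) not_le)
  have "eventually (\<lambda>n. ereal r < f (s n)) sequentially"
    by (rule Gamma0_weakly_eventually_less[OF f s r(2)])
  moreover have "eventually (\<lambda>n. c n < r) sequentially"
    using c(1) r(1) by (rule order_tendstoD(2))
  ultimately have "eventually (\<lambda>n. False) sequentially"
  proof eventually_elim
    case (elim n)
    then show ?case using c(2)[of n] by (metis ereal_less_eq(3) less_le_trans not_le order_less_imp_le)
  qed
  then show False by simp
qed

lemma subdifferential_Times_iff:
  assumes f: "f \<in> Gamma0" and g: "g \<in> Gamma0"
  shows "(u, v) \<in> subdifferential (\<lambda>z. f (fst z) + g (snd z)) (x, y) \<longleftrightarrow>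
    u \<in> subdifferential f x \<and> v \<in> subdifferential g y" (is "?L \<longleftrightarrow> ?R")
proof
  assume L: ?L
  obtain r where "f x + g y = ereal r"
    using subdifferential_finite[OF Gamma0_Times[OF f g] L] by auto
  then obtain a b where ab: "f x = ereal a" "g y = ereal b"
    by (cases "f x"; cases "g y") auto
  have "ereal ((x' - x) \<bullet> u) + f x \<le> f x'" for x'
    using subdifferentialD[OF L, of "(x', y)"] ab by (cases "f x'") auto
  moreover have "ereal ((y' - y) \<bullet> v) + g y \<le> g y'" for y'
    using subdifferentialD[OF L, of "(x, y')"] ab by (cases "g y'") auto
  ultimately show ?R by (simp add: subdifferential_def)
next
  assume R: ?R
  show ?L
  proof (rule subdifferentialI)
    fix z
    have "(ereal ((fst z - x) \<bullet> u) + f x) + (ereal ((snd z - y) \<bullet> v) + g y) \<le> f (fst z) + g (snd z)"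
      using R by (intro add_mono subdifferentialD) auto
    then show "ereal ((z - (x, y)) \<bullet> (u, v)) + (f (fst (x, y)) + g (snd (x, y))) \<le> f (fst z) + g (snd z)"
      by (cases z) (simp add: ac_simps flip: plus_ereal.simps(1))
  qed
qed

lemma subdifferential_minus_inner:
  assumes "u \<in> subdifferential (\<lambda>x. ereal (- (v \<bullet> x))) x"
  shows "u = - v"
proof -
  have "(u + v) \<bullet> (u + v) \<le> 0"
    using subdifferentialD[OF assms, of "x + (u + v)"] by (simp add: inner_add inner_commute)
  then have "u + v = 0"
    by (metis inner_eq_zero_iff inner_ge_zero order_antisym)
  then show ?thesis by (simp add: add_eq_0_iff2)
qed

section \<open>The chain rule under a qualification condition\<close>

text \<open>The Hessian of \<open>\<lambda>(t, y). (norm t)\<^sup>2 / 2 + N * (norm (y - M t))\<^sup>2 / 2\<close>.\<close>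

definition penalty :: "('a::real_inner \<Rightarrow> 'b::real_inner) \<Rightarrow> real \<Rightarrow> 'a \<times> 'b \<Rightarrow> 'a \<times> 'b" where
  "penalty M N z = (fst z - N *\<^sub>R adjoint M (snd z - M (fst z)), N *\<^sub>R (snd z - M (fst z)))"

context
  fixes M :: "'a::{real_inner,complete_space} \<Rightarrow> 'b::{real_inner,complete_space}"
  assumes M: "bounded_linear M"
begin

lemma inner_penalty:
  "w \<bullet> penalty M N z = fst w \<bullet> fst z + N * ((snd w - M (fst w)) \<bullet> (snd z - M (fst z)))"
  by (cases w) (simp add: penalty_def inner_diff algebra_simps flip: adjoint_inner[OF M])

lemma linear_penalty: "linear (penalty M N)"
proof -
  have lin: "linear M" "linear (adjoint M)"
    using M bounded_linear_hilbert_adjoint[OF M] by (simp_all add: bounded_linear.linear)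
  show ?thesis
    by (rule linearI)
      (simp_all add: penalty_def linear_add[OF lin(1)] linear_add[OF lin(2)] linear_diff[OF lin(2)]
        linear_scale[OF lin(1)] linear_scale[OF lin(2)] algebra_simps)
qed

lemma self_adjoint_penalty: "self_adjoint (penalty M N)"
  unfolding self_adjoint_def
proof (intro allI)
  fix x y
  have "penalty M N x \<bullet> y = y \<bullet> penalty M N x" by (rule inner_commute)
  also have "\<dots> = x \<bullet> penalty M N y" unfolding inner_penalty by (simp add: inner_commute)
  finally show "penalty M N x \<bullet> y = x \<bullet> penalty M N y" .
qed

lemma strongly_monotone_penalty:
  assumes "1 \<le> N" shows "strongly_monotone (penalty M N)"
proof -
  obtain m where m: "m > 0" "\<And>x. norm (M x) \<le> norm x * m"
    using bounded_linear.pos_bounded[OF M] by blast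
  \<comment> \<open>From \<open>norm y \<le> norm e + m * norm t\<close> the squared norm of
    \<open>(t, y)\<close> has coefficients \<open>1 + 2 * m\<^sup>2\<close> and \<open>2\<close>;
    the denominator dominates both.\<close>
  define \<beta> where "\<beta> = 1 / (3 + 2 * m\<^sup>2)"
  have \<beta>: "\<beta> > 0" unfolding \<beta>_def using zero_le_power2[of m] by (intro divide_pos_pos) linarith+
  have "\<beta> * (norm z)\<^sup>2 \<le> z \<bullet> penalty M N z" for z
  proof -
    obtain t y where z: "z = (t, y)" by (cases z)
    define e where "e = y - M t"
    have "norm y \<le> norm e + norm (M t)"
      unfolding e_def by (metis norm_triangle_sub add.commute)
    also have "\<dots> \<le> norm e + norm t * m" using m by simp
    finally have "(norm y)\<^sup>2 \<le> (norm e + norm t * m)\<^sup>2" by (intro power_mono) auto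
    also have "\<dots> \<le> 2 * (norm e)\<^sup>2 + 2 * (norm t * m)\<^sup>2"
      using zero_le_power2[of "norm e - norm t * m"] by (simp add: power2_sum power2_diff)
    finally have y: "(norm y)\<^sup>2 \<le> 2 * (norm e)\<^sup>2 + 2 * m\<^sup>2 * (norm t)\<^sup>2"
      by (simp add: power_mult_distrib mult_ac)
    have "(norm e)\<^sup>2 \<le> N * (norm e)\<^sup>2" using assms by (simp add: mult_le_cancel_right1)
    then have form: "(norm t)\<^sup>2 + (norm e)\<^sup>2 \<le> z \<bullet> penalty M N z"
      unfolding inner_penalty z e_def by (simp add: power2_norm_eq_inner)
    have "(norm z)\<^sup>2 = (norm t)\<^sup>2 + (norm y)\<^sup>2" by (simp add: z power2_norm_eq_inner)
    also have "\<dots> \<le> (norm t)\<^sup>2 + 2 * (norm e)\<^sup>2 + 2 * m\<^sup>2 * (norm t)\<^sup>2" using y by simp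
    also have "\<dots> \<le> (3 + 2 * m\<^sup>2) * ((norm t)\<^sup>2 + (norm e)\<^sup>2)"
      by (simp add: algebra_simps)
    finally have "\<beta> * (norm z)\<^sup>2 \<le> \<beta> * ((3 + 2 * m\<^sup>2) * ((norm t)\<^sup>2 + (norm e)\<^sup>2))"
      using \<beta> by (intro mult_left_mono) auto
    moreover have "\<beta> * (3 + 2 * m\<^sup>2) = 1"
      using \<beta> unfolding \<beta>_def by (simp add: field_simps)
    ultimately have "\<beta> * (norm z)\<^sup>2 \<le> (norm t)\<^sup>2 + (norm e)\<^sup>2"
      by (metis mult.assoc mult_1)
    with form show ?thesis by simp
  qed
  with \<beta> show ?thesis unfolding strongly_monotone_def by blast
qed

text \<open>The constraint \<open>y = M t\<close> is relaxed to a penalty of weight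
  \<open>N\<close>, whose scaled residual \<open>p\<close> acts as a multiplier: an exact
  subgradient at the nearby point \<open>y\<close>, with adjoint image off from \<open>v\<close> by
  \<open>t - s\<close>. The final inequality compares the minimum with the value at
  \<open>(s, M s)\<close>.\<close>

lemma penalized_minimizer:
  assumes h: "h \<in> Gamma0" and hs: "h (M s) = ereal a" and N: "1 \<le> N"
  obtains t y p b where "h y = ereal b" "p \<in> subdifferential h y" "p = N *\<^sub>R (M t - y)"
    "adjoint M p = v - (t - s)"
    "b + ((norm (t - s))\<^sup>2 + N * (norm (M t - y))\<^sup>2) / 2 \<le> a + v \<bullet> (t - s)"
proof -
  interpret M: bounded_linear M by (rule M)
  define l where "l t = ereal (- (v \<bullet> t))" for t :: 'a
  have l: "l \<in> Gamma0"
    unfolding l_def by (intro Gamma0_linear bounded_linear_minus bounded_linear_inner_right)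
  define G where "G z = l (fst z) + h (snd z)" for z :: "'a \<times> 'b"
  have G: "G \<in> Gamma0" unfolding G_def by (intro Gamma0_Times l h)
  \<comment> \<open>This centre satisfies the constraint, so the penalty form at
    \<open>z - c\<close> splits into the distance of \<open>t\<close> from \<open>s\<close> and the
    residual \<open>y - M t\<close>.\<close>
  define c where "c = (s, M s)"
  note Q = linear_penalty self_adjoint_penalty strongly_monotone_penalty[OF N]
  obtain z where z: "\<And>w. G z + ereal ((z - c) \<bullet> penalty M N (z - c) / 2) \<le> G w + ereal ((w - c) \<bullet> penalty M N (w - c) / 2)"
    using ex_argmin_plus_quadratic[OF G Q] by blast
  then have opt: "penalty M N (c - z) \<in> subdifferential G z"
    using argmin_plus_quadratic_iff[OF G linear_ident Q(1,2) strongly_monotone_form_nonneg[OF Q(3)], of z c]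
    by (simp add: subdifferential_def)
  obtain t y where ty: "z = (t, y)" by (cases z)
  define p where "p = N *\<^sub>R (M t - y)"
  have pen: "penalty M N (c - z) = (s - t - adjoint M p, p)"
    by (simp add: penalty_def c_def ty p_def M.diff
        linear_scale[OF bounded_linear.linear[OF bounded_linear_hilbert_adjoint[OF M]]])
  have sub: "s - t - adjoint M p \<in> subdifferential l t" "p \<in> subdifferential h y"
    using opt[unfolded pen] subdifferential_Times_iff[OF l h] unfolding ty G_def[abs_def] by blast+
  have "s - t - adjoint M p = - v"
    using sub(1) unfolding l_def[abs_def] by (rule subdifferential_minus_inner)
  then have adj: "adjoint M p = v - (t - s)"
    by (simp add: algebra_simps)
  obtain b where b: "h y = ereal b" using subdifferential_finite[OF h sub(2)] .
  have form: "(z - c) \<bullet> penalty M N (z - c) = (norm (t - s))\<^sup>2 + N * (norm (M t - y))\<^sup>2"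
  proof -
    have "snd (z - c) - M (fst (z - c)) = y - M t"
      by (simp add: ty c_def M.diff)
    then show ?thesis
      unfolding inner_penalty norm_minus_commute[of "M t" y]
      by (simp only:) (simp add: ty c_def power2_norm_eq_inner)
  qed
  have "b + ((norm (t - s))\<^sup>2 + N * (norm (M t - y))\<^sup>2) / 2 \<le> a + v \<bullet> (t - s)"
    using z[of c] b hs unfolding form by (simp add: G_def l_def ty c_def inner_diff linear_0[OF linear_penalty])
  with b sub(2) p_def adj show thesis by (rule that)
qed

end

text \<open>The Attouch--Brezis chain rule. The dual variables \<open>p n\<close> of quadratically penalized problems lie
  in the closed subspace generated by \<open>edom h - range M\<close> and are bounded on every element of the
  generating set, hence bounded in norm; a weak cluster point is the required subgradient.\<close>

theorem subdifferential_compose_linear: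
  fixes M :: "'a::{real_inner,complete_space} \<Rightarrow> 'b::{real_inner,complete_space}"
  assumes h: "h \<in> Gamma0" and M: "bounded_linear M"
    and sri: "0 \<in> sri {a - b |a b. a \<in> edom h \<and> b \<in> range M}"
    and v: "v \<in> subdifferential (\<lambda>s. h (M s)) s"
  shows "\<exists>p\<in>subdifferential h (M s). adjoint M p = v"
proof -
  interpret M: bounded_linear M by (rule M)
  define C where "C = {a - b |a b. a \<in> edom h \<and> b \<in> range M}"
  define V where "V = cone hull C"
  have C0: "0 \<in> C" and V: "subspace V" "closed V"
    using sri by (simp_all add: sri_def V_def flip: C_def)
  have CV: "C \<subseteq> V" unfolding V_def by (rule hull_subset)
  obtain s0 where s0: "M s0 \<in> edom h"
    using C0 by (force simp: C_def)
  have dom_V: "a \<in> V" if "a \<in> edom h" for a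
  proof -
    have "a - M 0 \<in> C" using that unfolding C_def by blast
    then show ?thesis using CV M.zero by auto
  qed
  have ran_V: "M t \<in> V" for t
  proof -
    have "M s0 - M t \<in> V" using s0 CV unfolding C_def by blast
    then have "M s0 - (M s0 - M t) \<in> V" using dom_V[OF s0] V(1) subspace_diff by blast
    then show ?thesis by simp
  qed
  have "(\<lambda>s. h (M s)) \<in> Gamma0"
    by (rule Gamma0_compose_linear[OF h M, of s0]) (use s0 in \<open>simp add: edom_def\<close>)
  then obtain a where a: "h (M s) = ereal a" using subdifferential_finite[OF _ v] by blast
  have v_le: "ereal (v \<bullet> (t - s) + a) \<le> h (M t)" for t
    using subdifferentialD[OF v, of t] a by (simp add: inner_commute)
  have "\<forall>n. \<exists>t y p b. h y = ereal b \<and> p \<in> subdifferential h y \<and> p = real (Suc n) *\<^sub>R (M t - y) \<and>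
    adjoint M p = v - (t - s) \<and>
    b + ((norm (t - s))\<^sup>2 + real (Suc n) * (norm (M t - y))\<^sup>2) / 2 \<le> a + v \<bullet> (t - s)" (is "\<forall>n. ?P n")
  proof
    fix n
    have "1 \<le> real (Suc n)" by simp
    from penalized_minimizer[OF M h a this, of v] show "?P n" by metis
  qed
  then obtain t y p b where
      b: "\<And>n. h (y n) = ereal (b n)" and p: "\<And>n. p n \<in> subdifferential h (y n)"
    and p_eq: "\<And>n. p n = real (Suc n) *\<^sub>R (M (t n) - y n)"
    and adj: "\<And>n. adjoint M (p n) = v - (t n - s)"
    and val: "\<And>n. b n + ((norm (t n - s))\<^sup>2 + real (Suc n) * (norm (M (t n) - y n))\<^sup>2) / 2 \<le> a + v \<bullet> (t n - s)"
    unfolding choice_iff by blast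
  obtain \<alpha> \<beta> where \<alpha>\<beta>: "\<alpha> \<ge> 0" "\<beta> \<ge> 0" "\<And>x. ereal (- \<alpha> - \<beta> * norm x) \<le> h x"
    using Gamma0_lower_bound[OF h] by blast
  obtain m where m: "m \<ge> 0" "\<And>x. norm (M x) \<le> norm x * m"
    using M.nonneg_bounded by blast
  have M_adj: "p n \<bullet> M w = (v - (t n - s)) \<bullet> w" for n w
    using adjoint_inner_left[OF M, of "p n" w] adj by simp
  have y_norm: "norm (y n) \<le> norm (M (t n) - y n) + m * norm (t n - s) + m * norm s" for n
  proof -
    have "norm (y n) \<le> norm (M (t n)) + norm (M (t n) - y n)"
      by (metis norm_minus_commute norm_triangle_sub)
    also have "norm (M (t n)) \<le> norm (t n) * m" by (rule m)
    also have "norm (t n) * m \<le> (norm (t n - s) + norm s) * m"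
      using m(1) norm_triangle_sub[of "t n" s] by (intro mult_right_mono) (auto simp: add.commute)
    finally show ?thesis by (simp add: algebra_simps)
  qed
  have b_low: "- \<alpha> - \<beta> * norm (y n) \<le> b n" for n
    using \<alpha>\<beta>(3)[of "y n"] b by simp
  \<comment> \<open>The constants that remain once Young's inequality has absorbed the terms linear
    in the residual and in \<open>norm (t n - s)\<close>; the two squares are those of their
    coefficients.\<close>
  define D where "D = (a + \<alpha> + \<beta> * m * norm s) + \<beta>\<^sup>2 + (norm v + \<beta> * m)\<^sup>2"
  have D: "(norm (t n - s))\<^sup>2 + real (Suc n) * (norm (M (t n) - y n))\<^sup>2 \<le> 4 * D" for n
  proof -
    let ?\<sigma> = "norm (t n - s)" and ?e = "norm (M (t n) - y n)"
    define X where X: "X = real (Suc n) * ?e\<^sup>2"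
    have "v \<bullet> (t n - s) \<le> norm v * ?\<sigma>" by (rule norm_cauchy_schwarz)
    moreover have "\<beta> * norm (y n) \<le> \<beta> * (?e + m * ?\<sigma> + m * norm s)"
      using y_norm \<alpha>\<beta>(2) by (intro mult_left_mono)
    ultimately have "(?\<sigma>\<^sup>2 + X) / 2
        \<le> (a + \<alpha> + \<beta> * m * norm s) + \<beta> * ?e + (norm v + \<beta> * m) * ?\<sigma>"
      using val[of n, folded X] b_low[of n] unfolding distrib_left distrib_right mult.assoc[symmetric] by argo
    moreover have "\<beta> * ?e \<le> \<beta>\<^sup>2 + ?e\<^sup>2 / 4"
      by (rule mult_le_power2_add)
    moreover have "(norm v + \<beta> * m) * ?\<sigma> \<le> (norm v + \<beta> * m)\<^sup>2 + ?\<sigma>\<^sup>2 / 4"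
      by (rule mult_le_power2_add)
    moreover have "?e\<^sup>2 \<le> X" by (simp add: X mult_le_cancel_right1)
    ultimately have "?\<sigma>\<^sup>2 + X \<le> 4 * D" unfolding D_def by argo
    then show ?thesis by (simp add: X)
  qed
  define E where "E = sqrt (4 * D)"
  have t_bdd: "norm (t n - s) \<le> E" for n
  proof -
    have "0 \<le> real (Suc n) * (norm (M (t n) - y n))\<^sup>2" by simp
    with D[of n] have "(norm (t n - s))\<^sup>2 \<le> 4 * D" by linarith
    then show ?thesis unfolding E_def by (rule real_le_rsqrt)
  qed
  have e_sq: "(norm (M (t n) - y n))\<^sup>2 \<le> 4 * D / real (Suc n)" for n
  proof -
    have "real (Suc n) * (norm (M (t n) - y n))\<^sup>2 \<le> 4 * D" using D[of n] zero_le_power2[of "norm (t n - s)"] by linarith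
    then show ?thesis by (simp add: field_simps)
  qed
  have "(\<lambda>n. norm (M (t n) - y n)) \<longlonglongrightarrow> 0"
    by (rule power2_le_inverse_Suc_imp_tendsto_0[OF e_sq])
  then have e_lim: "(\<lambda>n. M (t n) - y n) \<longlonglongrightarrow> 0" by (simp add: tendsto_norm_zero_iff)
  have "norm (t n) \<le> E + norm s" for n
    using t_bdd[of n] norm_triangle_sub[of "t n" s] by simp
  then obtain r tb where r: "strict_mono (r :: nat \<Rightarrow> nat)" "weakly_converges (\<lambda>n. t (r n)) tb"
    using bounded_imp_weakly_convergent_subsequence by blast
  have e_lim_r: "(\<lambda>n. M (t (r n)) - y (r n)) \<longlonglongrightarrow> 0"
    using LIMSEQ_subseq_LIMSEQ[OF e_lim r(1)] by (simp add: o_def)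
  have y_weak: "weakly_converges (\<lambda>n. y (r n)) (M tb)"
    using weakly_converges_add[OF weakly_converges_bounded_linear[OF r(2) M]
        weakly_converges_minus[OF tendsto_imp_weakly_converges[OF e_lim_r]]] by simp
  \<comment> \<open>By weak lower semicontinuity the values \<open>b\<close> are asymptotically at
    least \<open>h (M tb)\<close>, which \<open>v_le\<close> bounds below by
    \<open>a + v \<bullet> (tb - s)\<close>. Inequality \<open>val\<close> then leaves no room for
    \<open>norm (t n - s)\<close>, which gives strong convergence and identifies the limit at
    once.\<close>
  have t_lim: "(\<lambda>n. t (r n)) \<longlonglongrightarrow> s"
  proof (rule tendstoI)
    fix \<epsilon> :: real assume \<epsilon>: "\<epsilon> > 0"
    define \<delta> where "\<delta> = \<epsilon>\<^sup>2 / 4"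
    have \<delta>: "\<delta> > 0" using \<epsilon> by (simp add: \<delta>_def)
    have "ereal (a + v \<bullet> (tb - s) - \<delta>) < ereal (v \<bullet> (tb - s) + a)" using \<delta> by simp
    also have "\<dots> \<le> h (M tb)" by (rule v_le)
    finally have "eventually (\<lambda>n. ereal (a + v \<bullet> (tb - s) - \<delta>) < h (y (r n))) sequentially"
      by (rule Gamma0_weakly_eventually_less[OF h y_weak])
    moreover have "eventually (\<lambda>n. t (r n) \<bullet> v < tb \<bullet> v + \<delta>) sequentially"
      using weakly_convergesD[OF r(2), of v] \<delta> by (intro order_tendstoD(2)) auto
    ultimately show "eventually (\<lambda>n. dist (t (r n)) s < \<epsilon>) sequentially"
    proof eventually_elim
      case (elim n)
      have "0 \<le> real (Suc (r n)) * (norm (M (t (r n)) - y (r n)))\<^sup>2" by simp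
      then have "(norm (t (r n) - s))\<^sup>2 / 2 \<le> a + v \<bullet> (t (r n) - s) - b (r n)"
        using val[of "r n"] by argo
      also have "\<dots> < 2 * \<delta>"
        using elim b[of "r n"] by (simp add: inner_diff inner_commute)
      finally have "(norm (t (r n) - s))\<^sup>2 < \<epsilon>\<^sup>2" by (simp add: \<delta>_def)
      then show ?case using \<epsilon> by (simp add: dist_norm power_less_imp_less_base)
    qed
  qed
  have y_lim: "(\<lambda>n. y (r n)) \<longlonglongrightarrow> M s"
    using tendsto_diff[OF M.tendsto[OF t_lim] e_lim_r] by simp
  obtain Y where Y: "\<And>n. norm (y (r n)) \<le> Y"
    using convergent_imp_bounded[OF y_lim] by (auto simp: bounded_iff)
  define F where "F = norm v + E"
  have F: "norm (v - (t n - s)) \<le> F" for n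
    using norm_triangle_ineq4[of v "t n - s"] t_bdd[of n] by (simp add: F_def)
  have E0: "0 \<le> E" using t_bdd[of 0] norm_ge_zero order_trans by blast
  have pair_le: "\<bar>(v - (t n - s)) \<bullet> w\<bar> \<le> F * norm w" for n w
    using order_trans[OF Cauchy_Schwarz_ineq2 mult_right_mono[OF F norm_ge_zero]] by blast
  \<comment> \<open>As \<open>p\<close> is a positive multiple of \<open>M t - y\<close>, replacing
    \<open>y\<close> by \<open>M t\<close> only increases the pairing, and on the range of
    \<open>M\<close> the pairing is controlled through the adjoint.\<close>
  have p_y: "p (r n) \<bullet> y (r n) \<le> F * (E + norm s)" for n
  proof -
    have "0 \<le> p (r n) \<bullet> (M (t (r n)) - y (r n))" unfolding p_eq by simp
    then have "p (r n) \<bullet> y (r n) \<le> p (r n) \<bullet> M (t (r n))" by (simp add: inner_diff)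
    also have "\<dots> \<le> F * norm (t (r n))" using pair_le[of "r n" "t (r n)"] unfolding M_adj by simp
    also have "\<dots> \<le> F * (E + norm s)"
      using t_bdd[of "r n"] norm_triangle_sub[of "t (r n)" s] E0 by (intro mult_left_mono) (auto simp: F_def)
    finally show ?thesis .
  qed
  have "\<exists>B>0. \<forall>q\<in>range (\<lambda>n. p (r n)). norm q \<le> B"
  proof (rule uniform_boundedness)
    fix x
    obtain x' where x': "x' \<in> V" "\<And>z. z \<in> V \<Longrightarrow> z \<bullet> (x - x') = 0"
      using ex_orthogonal_projection[OF V] by blast
    have pV: "p n \<in> V" for n
    proof -
      have "y n \<in> edom h" using b[of n] by (simp add: edom_def)
      then have "M (t n) - y n \<in> V" using dom_V ran_V subspace_diff[OF V(1)] by blast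
      then show ?thesis unfolding p_eq by (rule subspace_scale[OF V(1)])
    qed
    have px: "p n \<bullet> x = p n \<bullet> x'" for n using x'(2)[OF pV[of n]] by (simp add: inner_diff)
    \<comment> \<open>Here the qualification condition acts: the cone hull is itself the closed
      subspace, so \<open>x'\<close> is one nonnegative multiple of some \<open>d - M w\<close>. The
      subgradient inequality bounds \<open>p\<close> on \<open>d\<close> from above, and
      \<open>M_adj\<close> bounds it on \<open>M w\<close>.\<close>
    obtain c d w where x'_eq: "x' = c *\<^sub>R (d - M w)" and c: "c \<ge> 0" and d: "d \<in> edom h"
      using x'(1) by (auto simp: V_def cone_hull_expl C_def)
    obtain \<gamma> where \<gamma>: "h d \<le> ereal \<gamma>"
      using d by (cases "h d") (auto simp: edom_def)
    have "p (r n) \<bullet> (d - M w) \<le> \<gamma> + \<alpha> + \<beta> * Y + F * (E + norm s) + F * norm w" for n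
    proof -
      have "ereal ((d - y (r n)) \<bullet> p (r n) + b (r n)) \<le> h d"
        using subdifferentialD[OF p, of d "r n"] b[of "r n"] by simp
      then have "ereal ((d - y (r n)) \<bullet> p (r n) + b (r n)) \<le> ereal \<gamma>" using \<gamma> by (rule order_trans)
      then have "p (r n) \<bullet> d \<le> \<gamma> - b (r n) + p (r n) \<bullet> y (r n)"
        by (simp add: inner_diff inner_commute)
      moreover have "- \<alpha> - \<beta> * Y \<le> b (r n)"
        using b_low[of "r n"] mult_left_mono[OF Y[of n] \<alpha>\<beta>(2)] by linarith
      moreover have "- (F * norm w) \<le> p (r n) \<bullet> M w"
        using pair_le[of "r n" w] unfolding M_adj by linarith
      ultimately show ?thesis using p_y[of n] by (simp add: inner_diff)
    qed
    then have "p (r n) \<bullet> x \<le> c * (\<gamma> + \<alpha> + \<beta> * Y + F * (E + norm s) + F * norm w)" for n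
      unfolding px x'_eq inner_scaleR using c by (intro mult_left_mono)
    then show "\<exists>c. \<forall>q\<in>range (\<lambda>n. p (r n)). q \<bullet> x \<le> c" by blast
  qed
  then obtain B where B: "\<And>n. norm (p (r n)) \<le> B" by auto
  then obtain q pb where q: "strict_mono (q :: nat \<Rightarrow> nat)" "weakly_converges (\<lambda>n. p (r (q n))) pb"
    using bounded_imp_weakly_convergent_subsequence[of "\<lambda>n. p (r n)" B] by blast
  have y_lim': "(\<lambda>n. y (r (q n))) \<longlonglongrightarrow> M s" and t_lim': "(\<lambda>n. t (r (q n))) \<longlonglongrightarrow> s"
    using LIMSEQ_subseq_LIMSEQ[OF y_lim q(1)] LIMSEQ_subseq_LIMSEQ[OF t_lim q(1)] by (simp_all add: o_def)
  \<comment> \<open>The pairing of the weakly convergent \<open>p\<close> with \<open>d - y\<close>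
    passes to the limit because \<open>y\<close> converges strongly, which is what the strong
    convergence of \<open>t\<close> provides.\<close>
  have "pb \<in> subdifferential h (M s)"
  proof (rule subdifferentialI)
    fix d
    show "ereal ((d - M s) \<bullet> pb) + h (M s) \<le> h d"
    proof (cases "h d")
      case (real \<gamma>)
      have "h (y (r (q n))) \<le> ereal (\<gamma> - p (r (q n)) \<bullet> (d - y (r (q n))))" for n
        using subdifferentialD[OF p, of d "r (q n)"] real b[of "r (q n)"] by (simp add: inner_commute)
      moreover have "(\<lambda>n. \<gamma> - p (r (q n)) \<bullet> (d - y (r (q n)))) \<longlonglongrightarrow> \<gamma> - pb \<bullet> (d - M s)"
        by (intro tendsto_diff[OF tendsto_const] weakly_converges_inner_tendsto[OF q(2) B] tendsto_diff[OF tendsto_const] y_lim')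
      ultimately have "h (M s) \<le> ereal (\<gamma> - pb \<bullet> (d - M s))"
        using Gamma0_lsc_seq[OF h y_lim'] by blast
      then show ?thesis using a real by (simp add: inner_commute)
    qed (use Gamma0_not_minus_inf[OF h] in auto)
  qed
  moreover have "adjoint M pb = v"
  proof -
    have "adjoint M pb \<bullet> w = v \<bullet> w" for w
    proof -
      have "(\<lambda>n. (v - (t (r (q n)) - s)) \<bullet> w) \<longlonglongrightarrow> (v - (s - s)) \<bullet> w"
        by (intro tendsto_inner tendsto_diff t_lim' tendsto_const)
      moreover have "(\<lambda>n. (v - (t (r (q n)) - s)) \<bullet> w) \<longlonglongrightarrow> pb \<bullet> M w"
        using weakly_convergesD[OF q(2), of "M w"] unfolding M_adj .
      ultimately show ?thesis
        using LIMSEQ_unique by (force simp: adjoint_inner_left[OF M])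
    qed
    then show ?thesis using vector_eq_rdot by blast
  qed
  ultimately show ?thesis by blast
qed

section \<open>Degenerate proximal point iterations\<close>

text \<open>The form is evaluated at \<open>z - W z / B\<close>: a root-free Cauchy-Schwarz
  inequality for a possibly degenerate semi-inner product. It turns smallness in the seminorm into
  norm smallness of \<open>W z\<close>.\<close>

lemma norm_power2_le_form:
  fixes W :: "'a::real_inner \<Rightarrow> 'a"
  assumes W: "bounded_linear W" "self_adjoint W" and psd: "\<And>z. 0 \<le> z \<bullet> W z"
  obtains B where "B > 0" "\<And>z. (norm (W z))\<^sup>2 \<le> B * (z \<bullet> W z)"
proof -
  interpret bounded_linear W by (rule W)
  obtain B where B: "B > 0" "\<And>z. norm (W z) \<le> norm z * B"
    using pos_bounded by blast
  have "(norm (W z))\<^sup>2 \<le> B * (z \<bullet> W z)" for z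
  proof -
    have "W z \<bullet> W (W z) \<le> norm (W z) * norm (W (W z))" by (rule norm_cauchy_schwarz)
    also have "\<dots> \<le> norm (W z) * (norm (W z) * B)" using B by (intro mult_left_mono) auto
    also have "\<dots> = B * (norm (W z))\<^sup>2" by (simp add: power2_eq_square)
    finally have 1: "W z \<bullet> W (W z) \<le> B * (norm (W z))\<^sup>2" .
    have "0 \<le> (z + (- (1 / B)) *\<^sub>R W z) \<bullet> W (z + (- (1 / B)) *\<^sub>R W z)" by (rule psd)
    also have "\<dots> = z \<bullet> W z - 2 / B * (norm (W z))\<^sup>2 + (1 / B)\<^sup>2 * (W z \<bullet> W (W z))"
      unfolding self_adjoint_form_add[OF linear_axioms W(2)] self_adjoint_form_scale[OF linear_axioms]
      by (simp add: power2_norm_eq_inner)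
    also have "\<dots> \<le> z \<bullet> W z - 2 / B * (norm (W z))\<^sup>2 + (1 / B)\<^sup>2 * (B * (norm (W z))\<^sup>2)"
      using 1 by (intro add_left_mono mult_left_mono) auto
    also have "\<dots> = z \<bullet> W z - (norm (W z))\<^sup>2 / B"
      using B(1) by (simp add: power2_eq_square field_simps)
    finally show ?thesis using B(1) by (simp add: field_simps)
  qed
  with B(1) show thesis by (rule that)
qed

text \<open>The iteration is Fejer monotone for the seminorm of \<open>W\<close>. Since \<open>W\<close> may be singular, this
  controls only \<open>W (z n)\<close>; the Lipschitz hypothesis on the inverse of \<open>\<partial>\<Phi> + S + W\<close> recovers
  boundedness of \<open>z n\<close> and uniqueness of the weak cluster point.\<close>

theorem degenerate_proximal_point:
  fixes \<Phi> :: "'a::{real_inner,complete_space} \<Rightarrow> ereal" and S W :: "'a \<Rightarrow> 'a"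
  assumes \<Phi>: "\<Phi> \<in> Gamma0"
    and S: "bounded_linear S" and skew: "\<And>z. z \<bullet> S z = 0"
    and W: "bounded_linear W" "self_adjoint W" and psd: "\<And>z. 0 \<le> z \<bullet> W z"
    and lip: "\<And>z z' w w'. w - W z - S z \<in> subdifferential \<Phi> z \<Longrightarrow>
      w' - W z' - S z' \<in> subdifferential \<Phi> z' \<Longrightarrow> norm (z - z') \<le> C * norm (w - w')"
    and zero: "- S z0 \<in> subdifferential \<Phi> z0"
    and step: "\<And>n. W (z n - z (Suc n)) - S (z (Suc n)) \<in> subdifferential \<Phi> (z (Suc n))"
  shows "\<exists>l. - S l \<in> subdifferential \<Phi> l \<and> weakly_converges z l"
proof -
  interpret S: bounded_linear S by (rule S)
  interpret W: bounded_linear W by (rule W)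
  define E where "E y n = (z n - y) \<bullet> W (z n - y)" for y n
  define D where "D n = (z n - z (Suc n)) \<bullet> W (z n - z (Suc n))" for n
  \<comment> \<open>Monotonicity is tested between the new iterate and a zero. Skewness removes
    \<open>S\<close>, and what remains is the cross term of the form at \<open>z n - y\<close>,
    split as \<open>(z n - z (Suc n)) + (z (Suc n) - y)\<close>.\<close>
  have fejer: "E y (Suc n) + D n \<le> E y n" if y: "- S y \<in> subdifferential \<Phi> y" for y n
  proof -
    have "0 \<le> (z (Suc n) - y) \<bullet> (W (z n - z (Suc n)) - S (z (Suc n)) - (- S y))"
      by (rule subdifferential_monotone[OF \<Phi> step y])
    also have "\<dots> = (z (Suc n) - y) \<bullet> W (z n - z (Suc n)) - (z (Suc n) - y) \<bullet> S (z (Suc n) - y)"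
      by (simp add: S.diff inner_diff_right inner_add_right)
    finally have "0 \<le> (z (Suc n) - y) \<bullet> W (z n - z (Suc n))" by (simp add: skew)
    moreover have "E y n = D n + 2 * ((z (Suc n) - y) \<bullet> W (z n - z (Suc n))) + E y (Suc n)"
      using self_adjoint_form_add[OF W.linear_axioms W(2), of "z n - z (Suc n)" "z (Suc n) - y"]
      by (simp add: E_def D_def)
    ultimately show ?thesis by linarith
  qed
  have E0: "0 \<le> E y n" and D0: "0 \<le> D n" for y n
    by (simp_all add: E_def D_def psd)
  have dec: "decseq (E y)" if "- S y \<in> subdifferential \<Phi> y" for y
    unfolding decseq_Suc_iff
  proof
    fix n show "E y (Suc n) \<le> E y n" using fejer[OF that, of n] D0[of n] by linarith
  qed
  have E_conv: "convergent (E y)" if "- S y \<in> subdifferential \<Phi> y" for y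
    by (rule decseq_convergent[OF dec[OF that], of 0]) (auto simp: E0 convergent_def)
  obtain B where B: "B > 0" "\<And>z. (norm (W z))\<^sup>2 \<le> B * (z \<bullet> W z)"
    using norm_power2_le_form[OF W psd] by blast
  have W_step: "(\<lambda>n. W (z n - z (Suc n))) \<longlonglongrightarrow> 0"
  proof -
    obtain e where e: "E z0 \<longlonglongrightarrow> e" using E_conv[OF zero] by (auto simp: convergent_def)
    have "(\<lambda>n. E z0 n - E z0 (Suc n)) \<longlonglongrightarrow> e - e" by (intro tendsto_diff e LIMSEQ_Suc[OF e])
    then have "(\<lambda>n. B * (E z0 n - E z0 (Suc n))) \<longlonglongrightarrow> B * (e - e)" by (rule tendsto_mult_left)
    then have lim0: "(\<lambda>n. B * (E z0 n - E z0 (Suc n))) \<longlonglongrightarrow> 0" by simp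
    have "norm ((norm (W (z n - z (Suc n))))\<^sup>2) \<le> B * (E z0 n - E z0 (Suc n))" for n
    proof -
      have "(norm (W (z n - z (Suc n))))\<^sup>2 \<le> B * D n" unfolding D_def by (rule B)
      also have "\<dots> \<le> B * (E z0 n - E z0 (Suc n))"
        using fejer[OF zero, of n] B(1) by (intro mult_left_mono) auto
      finally show ?thesis by simp
    qed
    then have "(\<lambda>n. (norm (W (z n - z (Suc n))))\<^sup>2) \<longlonglongrightarrow> 0"
      by (intro Lim_null_comparison[OF always_eventually lim0] allI)
    then have "(\<lambda>n. sqrt ((norm (W (z n - z (Suc n))))\<^sup>2)) \<longlonglongrightarrow> sqrt 0" by (rule tendsto_real_sqrt)
    then show ?thesis by (simp add: tendsto_norm_zero_iff)
  qed
  \<comment> \<open>\<open>z (Suc n)\<close> is the image of \<open>W (z n)\<close> under the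
    Lipschitz inverse, and a zero \<open>y\<close> is the image of \<open>W y\<close>. The starting
    point \<open>z 0\<close> is not such an image, so bounds begin at index one.\<close>
  have lip0: "norm (z (Suc n) - y) \<le> C * norm (W (z n) - W y)" if "- S y \<in> subdifferential \<Phi> y" for n y
    using lip[of "W (z n)" "z (Suc n)" "W y" y] step[of n] that by (simp add: W.diff)
  define R where "R = \<bar>C\<bar> * sqrt (B * E z0 0) + norm z0"
  have bdd: "norm (z (Suc n)) \<le> R" for n
  proof -
    have "(norm (W (z n - z0)))\<^sup>2 \<le> B * E z0 n" unfolding E_def by (rule B)
    also have "\<dots> \<le> B * E z0 0"
      using B(1) decseqD[OF dec[OF zero], of 0 n] by (intro mult_left_mono) auto
    finally have "norm (W (z n - z0)) \<le> sqrt (B * E z0 0)" by (rule real_le_rsqrt)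
    have "norm (z (Suc n) - z0) \<le> C * norm (W (z n - z0))"
      using lip0[OF zero] by (simp add: W.diff)
    also have "\<dots> \<le> \<bar>C\<bar> * norm (W (z n - z0))" by (intro mult_right_mono) auto
    also have "\<dots> \<le> \<bar>C\<bar> * sqrt (B * E z0 0)" by (intro mult_left_mono) (fact, simp)
    finally show ?thesis
      using norm_triangle_sub[of "z (Suc n)" z0] by (simp add: R_def)
  qed
  have cluster_zero: "- S l \<in> subdifferential \<Phi> l"
    if r: "strict_mono (r :: nat \<Rightarrow> nat)" and l: "weakly_converges (\<lambda>n. z (Suc (r n))) l" for r l
  proof (rule subdifferentialI)
    fix y
    show "ereal ((y - l) \<bullet> (- S l)) + \<Phi> l \<le> \<Phi> y"
    proof (cases "\<Phi> y")
      case (real b)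
      define e where "e n = W (z (r n) - z (Suc (r n)))" for n
      have e: "e \<longlonglongrightarrow> 0"
        using LIMSEQ_subseq_LIMSEQ[OF W_step r] by (simp add: e_def[abs_def] o_def)
      \<comment> \<open>Skewness cancels the pairing of \<open>S z\<close> with \<open>z\<close>,
        the only product of two merely weakly convergent factors; every remaining term has a
        limit.\<close>
      have "\<Phi> (z (Suc (r n))) \<le> ereal (b - y \<bullet> e n + z (Suc (r n)) \<bullet> e n + S (z (Suc (r n))) \<bullet> y)" for n
      proof -
        obtain a where a: "\<Phi> (z (Suc (r n))) = ereal a" using subdifferential_finite[OF \<Phi> step] .
        have eq: "(y - z (Suc (r n))) \<bullet> (e n - S (z (Suc (r n)))) =
            y \<bullet> e n - z (Suc (r n)) \<bullet> e n - S (z (Suc (r n))) \<bullet> y"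
          unfolding inner_diff_left inner_diff_right skew inner_commute[of y "S (z (Suc (r n)))"] by simp
        have "ereal ((y - z (Suc (r n))) \<bullet> (e n - S (z (Suc (r n))))) + \<Phi> (z (Suc (r n))) \<le> \<Phi> y"
          unfolding e_def by (rule subdifferentialD[OF step])
        then show ?thesis
          unfolding eq real a by simp
      qed
      moreover have "(\<lambda>n. b - y \<bullet> e n + z (Suc (r n)) \<bullet> e n + S (z (Suc (r n))) \<bullet> y)
          \<longlonglongrightarrow> b - y \<bullet> 0 + l \<bullet> 0 + S l \<bullet> y"
        by (rule tendsto_add[OF tendsto_add[OF
                tendsto_diff[OF tendsto_const tendsto_inner[OF tendsto_const e]]
                weakly_converges_inner_tendsto[OF l bdd e]]
              weakly_convergesD[OF weakly_converges_bounded_linear[OF l S]]])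
      ultimately have "\<Phi> l \<le> ereal (b - y \<bullet> 0 + l \<bullet> 0 + S l \<bullet> y)"
        using Gamma0_weakly_lsc_seq[OF \<Phi> l] by blast
      then have "\<Phi> l \<le> ereal (b + y \<bullet> S l)" by (simp add: inner_commute)
      then show ?thesis using real by (cases "\<Phi> l") (auto simp: inner_diff_left skew)
    qed (use Gamma0_not_minus_inf[OF \<Phi>] in auto)
  qed
  have unique: "m = l"
    if r: "strict_mono (r :: nat \<Rightarrow> nat)" "weakly_converges (\<lambda>n. z (Suc (r n))) l"
      and q: "strict_mono (q :: nat \<Rightarrow> nat)" "weakly_converges (\<lambda>n. z (Suc (q n))) m" for r q l m
  proof -
    note zl = cluster_zero[OF r] and zm = cluster_zero[OF q]
    \<comment> \<open>Opial's argument: the quadratic part in \<open>z n\<close> cancels, so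
      \<open>z n \<bullet> W (l - m)\<close> converges along the whole sequence, and the two
      subsequences must give it the same limit.\<close>
    have "E l n - E m n = - 2 * (z n \<bullet> W (l - m)) + (l \<bullet> W l - m \<bullet> W m)" for n
    proof -
      have "E y n = z n \<bullet> W (z n) - 2 * (z n \<bullet> W y) + y \<bullet> W y" for y
      proof -
        have "y \<bullet> W (z n) = z n \<bullet> W y"
          using W(2) by (metis self_adjoint_def inner_commute)
        then show ?thesis
          using self_adjoint_form_add[OF W.linear_axioms W(2), of "z n" "- y"]
          by (simp add: E_def W.neg)
      qed
      then show ?thesis by (simp add: W.diff inner_diff_right)
    qed
    then have eq: "z n \<bullet> W (l - m) = ((l \<bullet> W l - m \<bullet> W m) - (E l n - E m n)) / 2" for n
      by (simp add: field_simps)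
    obtain e1 e2 where "E l \<longlonglongrightarrow> e1" "E m \<longlonglongrightarrow> e2"
      using E_conv[OF zl] E_conv[OF zm] by (auto simp: convergent_def)
    then have "(\<lambda>n. z n \<bullet> W (l - m)) \<longlonglongrightarrow> ((l \<bullet> W l - m \<bullet> W m) - (e1 - e2)) / 2"
      unfolding eq by (intro tendsto_intros) auto
    then obtain c where "(\<lambda>n. z n \<bullet> W (l - m)) \<longlonglongrightarrow> c" by blast
    then have c: "(\<lambda>n. z (Suc n) \<bullet> W (l - m)) \<longlonglongrightarrow> c" by (rule LIMSEQ_Suc)
    have "l \<bullet> W (l - m) = c"
      using LIMSEQ_subseq_LIMSEQ[OF c r(1)] weakly_convergesD[OF r(2), of "W (l - m)"]
      by (intro LIMSEQ_unique[of "\<lambda>n. z (Suc (r n)) \<bullet> W (l - m)"]) (auto simp: o_def)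
    moreover have "m \<bullet> W (l - m) = c"
      using LIMSEQ_subseq_LIMSEQ[OF c q(1)] weakly_convergesD[OF q(2), of "W (l - m)"]
      by (intro LIMSEQ_unique[of "\<lambda>n. z (Suc (q n)) \<bullet> W (l - m)"]) (auto simp: o_def)
    ultimately have "(l - m) \<bullet> W (l - m) = 0" by (simp add: inner_diff_left)
    then have "W (l - m) = 0" using B(2)[of "l - m"] by simp
    \<comment> \<open>Two zeros with the same image under \<open>W\<close> solve one and the same
      inclusion, so the Lipschitz inverse separates what a singular \<open>W\<close> cannot.\<close>
    moreover have "norm (l - m) \<le> C * norm (W l - W m)"
      using lip[of "W l" l "W m" m] zl zm by simp
    ultimately show ?thesis by (simp add: W.diff)
  qed
  obtain r l where r: "strict_mono (r :: nat \<Rightarrow> nat)" "weakly_converges (\<lambda>n. z (Suc (r n))) l"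
    using bounded_imp_weakly_convergent_subsequence[of "\<lambda>n. z (Suc n)" R] bdd by blast
  have "weakly_converges (\<lambda>n. z (Suc n)) l"
    by (rule weakly_convergesI_subseq[of _ R]) (use bdd unique[OF r] in auto)
  then show ?thesis
    using cluster_zero[OF r] weakly_converges_Suc_iff by blast
qed

section \<open>Resolvents and proximity operators\<close>

text \<open>Surjectivity comes from minimizing half the form of \<open>S\<close> minus
  \<open>c \<bullet> x\<close>, whose optimality condition is \<open>S p = c\<close>.\<close>

lemma strongly_monotone_bij:
  fixes S :: "'a::{real_inner,complete_space} \<Rightarrow> 'a"
  assumes S: "linear S" "self_adjoint S" "strongly_monotone S"
  shows "bij S"
proof (rule bijI)
  show "inj S"
    unfolding linear_injective_0[OF S(1)]
  proof (intro allI impI)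
    fix x assume "S x = 0"
    then show "x = 0"
      using S(3) by (auto simp: strongly_monotone_def mult_le_0_iff dest!: spec[of _ x])
  qed
  show "surj S"
  proof (rule surjI)
    fix c :: 'a
    have "(\<lambda>x. ereal (- (c \<bullet> x))) \<in> Gamma0"
      by (intro Gamma0_linear bounded_linear_minus bounded_linear_inner_right)
    then obtain p where "S (0 - p) \<in> subdifferential (\<lambda>x. ereal (- (c \<bullet> x))) p"
      using ex1_subdifferential_prox[OF _ S] by blast
    then have "S p = c"
      using subdifferential_minus_inner linear_neg[OF S(1)] by force
    then show "S (SOME p. S p = c) = c" by (rule someI)
  qed
qed

lemma strongly_monotone_inv:
  fixes S :: "'a::{real_inner,complete_space} \<Rightarrow> 'a"
  assumes S: "linear S" "self_adjoint S" "strongly_monotone S"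
  shows "S (inv S x) = x" "inv S (S x) = x"
    "linear (inv S)" "self_adjoint (inv S)" "strongly_monotone (inv S)"
proof -
  note bij = strongly_monotone_bij[OF S]
  show S_inv: "S (inv S x) = x" for x by (rule surj_f_inv_f[OF bij_is_surj[OF bij]])
  show inv_S: "inv S (S x) = x" for x by (rule inv_f_f[OF bij_is_inj[OF bij]])
  show "linear (inv S)"
    by (rule linearI) (metis S_inv inv_S linear_add[OF S(1)] linear_scale[OF S(1)])+
  show "self_adjoint (inv S)"
    using S(2) unfolding self_adjoint_def by (metis S_inv)
  obtain \<beta> where \<beta>: "\<beta> > 0" "\<And>x. \<beta> * (norm x)\<^sup>2 \<le> x \<bullet> S x"
    using S(3) by (auto simp: strongly_monotone_def)
  obtain c where c: "c > 0" "\<And>x. norm (S x) \<le> norm x * c"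
    using bounded_linear.pos_bounded[OF hellinger_toeplitz[OF S(1,2)]] by blast
  \<comment> \<open>Strong monotonicity of \<open>S\<close> at \<open>inv S u\<close>, combined with
    \<open>norm u \<le> c * norm (inv S u)\<close> from the boundedness of \<open>S\<close>.\<close>
  have "\<beta> / c\<^sup>2 * (norm u)\<^sup>2 \<le> u \<bullet> inv S u" for u
  proof -
    have "(norm u)\<^sup>2 \<le> (norm (inv S u) * c)\<^sup>2" using c(2)[of "inv S u"] by (intro power_mono) (auto simp: S_inv)
    then have "\<beta> / c\<^sup>2 * (norm u)\<^sup>2 \<le> \<beta> / c\<^sup>2 * (norm (inv S u) * c)\<^sup>2"
      using \<beta>(1) by (intro mult_left_mono) auto
    also have "\<dots> = \<beta> * (norm (inv S u))\<^sup>2" using c(1) by (simp add: power_mult_distrib)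
    also have "\<dots> \<le> u \<bullet> inv S u" using \<beta>(2)[of "inv S u"] by (simp add: S_inv inner_commute)
    finally show ?thesis .
  qed
  moreover have "\<beta> / c\<^sup>2 > 0" using \<beta>(1) c(1) by simp
  ultimately show "strongly_monotone (inv S)" unfolding strongly_monotone_def by blast
qed

text \<open>Unique solvability gives meaning to the description operator in
  \<open>resolvent\<close>. Multiplying by \<open>S\<close> shows that preconditioning by
  \<open>inv S\<close> amounts to a proximal step in the metric of \<open>S\<close>.\<close>

lemma resolvent_subdifferential_eq_iff:
  fixes f :: "'a::{real_inner,complete_space} \<Rightarrow> ereal"
  assumes f: "f \<in> Gamma0" and S: "linear S" "self_adjoint S" "strongly_monotone S"
  shows "resolvent (\<lambda>s. inv S ` subdifferential f s) w = p \<longleftrightarrow> S (w - p) \<in> subdifferential f p"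
proof -
  have iff: "w \<in> (\<lambda>y. p + y) ` inv S ` subdifferential f p \<longleftrightarrow> S (w - p) \<in> subdifferential f p" for p
  proof
    assume "S (w - p) \<in> subdifferential f p"
    then have "p + inv S (S (w - p)) \<in> (\<lambda>y. p + y) ` inv S ` subdifferential f p" by blast
    then show "w \<in> (\<lambda>y. p + y) ` inv S ` subdifferential f p"
      by (simp add: strongly_monotone_inv(2)[OF S])
  qed (auto simp: strongly_monotone_inv(1)[OF S])
  obtain q where q: "S (w - q) \<in> subdifferential f q"
    "\<And>p. S (w - p) \<in> subdifferential f p \<Longrightarrow> p = q"
    using ex1_subdifferential_prox[OF f S, of w] by blast
  have "resolvent (\<lambda>s. inv S ` subdifferential f s) w = q"
    unfolding resolvent_def iff by (rule the_equality) (rule q, erule q)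
  then show ?thesis
    using q by metis
qed

lemma Argmin_iff: "x \<in> Argmin F \<longleftrightarrow> (\<forall>y. F x \<le> F y)" for F :: "'a \<Rightarrow> ereal"
  by (auto simp: Argmin_def is_arg_min_def not_less)

text \<open>The terms \<open>c y\<close> and \<open>- c y\<close> cancel in the sum. In applications
  they come from a subgradient of one summand and the opposite subgradient of the other.\<close>

lemma Argmin_addI:
  fixes F G :: "'a \<Rightarrow> ereal"
  assumes "\<And>y. ereal (c y) + F x \<le> F y" "\<And>y. ereal (- c y) + G x \<le> G y"
  shows "x \<in> Argmin (\<lambda>y. F y + G y)"
  unfolding Argmin_iff
proof
  fix y
  have "(ereal (c y) + F x) + (ereal (- c y) + G x) \<le> F y + G y"
    by (intro add_mono assms)
  then show "F x + G x \<le> F y + G y"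
    by (cases "F x"; cases "G x") auto
qed

lemma prox_eq_iff:
  fixes f :: "'a::{real_inner,complete_space} \<Rightarrow> ereal"
  assumes f: "f \<in> Gamma0" and S: "linear S" "self_adjoint S" "strongly_monotone S"
  shows "prox S f x = p \<longleftrightarrow> S (x - p) \<in> subdifferential f p"
proof -
  have form: "(norm_wrt S (x - y))\<^sup>2 = (y - x) \<bullet> S (y - x)" for y
  proof -
    have "S (x - y) = - S (y - x)" using linear_neg[OF S(1), of "y - x"] by simp
    then have "(x - y) \<bullet> S (x - y) = (y - x) \<bullet> S (y - x)" by (simp add: inner_diff_left)
    then show ?thesis
      using strongly_monotone_form_nonneg[OF S(3), of "y - x"] by (simp add: norm_wrt_def)
  qed
  have argmin: "is_arg_min (\<lambda>y. f y + ereal ((norm_wrt S (x - y))\<^sup>2 / 2)) (\<lambda>_. True) q \<longleftrightarrow>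
      S (x - q) \<in> subdifferential f q" for q
    using argmin_plus_quadratic_iff[OF f linear_ident S(1,2) strongly_monotone_form_nonneg[OF S(3)], of q x]
    unfolding form by (simp add: is_arg_min_def subdifferential_def not_less)
  obtain q where q: "S (x - q) \<in> subdifferential f q"
    "\<And>p. S (x - p) \<in> subdifferential f p \<Longrightarrow> p = q"
    using ex1_subdifferential_prox[OF f S, of x] by blast
  have "prox S f x = q"
    unfolding prox_def arg_min_def argmin by (rule some_equality) (rule q, erule q)
  then show ?thesis
    using q by metis
qed

text \<open>Monotonicity leaves the coercive term of \<open>R\<close> bounded by
  \<open>(x - y) \<bullet> (a - b)\<close>, and one factor \<open>norm (x - y)\<close>
  cancels.\<close>

lemma subdifferential_strong_Lipschitz:
  assumes f: "f \<in> Gamma0" and R: "linear R" "\<And>x. \<gamma> * (norm x)\<^sup>2 \<le> x \<bullet> R x"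
    and x: "a - R x \<in> subdifferential f x" and y: "b - R y \<in> subdifferential f y"
  shows "\<gamma> * norm (x - y) \<le> norm (a - b)"
proof -
  have "0 \<le> (x - y) \<bullet> ((a - R x) - (b - R y))"
    by (rule subdifferential_monotone[OF f x y])
  also have "\<dots> = (x - y) \<bullet> (a - b) - (x - y) \<bullet> R (x - y)"
    by (simp add: linear_diff[OF R(1)] inner_diff_right)
  finally have "\<gamma> * (norm (x - y))\<^sup>2 \<le> (x - y) \<bullet> (a - b)"
    using R(2)[of "x - y"] by linarith
  also have "\<dots> \<le> norm (x - y) * norm (a - b)" by (rule norm_cauchy_schwarz)
  finally have "norm (x - y) * (\<gamma> * norm (x - y)) \<le> norm (x - y) * norm (a - b)"
    by (simp add: power2_eq_square mult_ac)
  then show ?thesis by (cases "x = y") auto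
qed

lemma weakly_converges_Pair_iff:
  fixes s :: "nat \<Rightarrow> 'a::real_inner" and t :: "nat \<Rightarrow> 'b::real_inner"
  shows "weakly_converges (\<lambda>n. (s n, t n)) (a, b) \<longleftrightarrow> weakly_converges s a \<and> weakly_converges t b"
proof
  assume *: "weakly_converges (\<lambda>n. (s n, t n)) (a, b)"
  show "weakly_converges s a \<and> weakly_converges t b"
    using weakly_convergesD[OF *, of "(w, 0)" for w] weakly_convergesD[OF *, of "(0, w)" for w]
    by (simp add: weakly_converges_def)
next
  assume "weakly_converges s a \<and> weakly_converges t b"
  then show "weakly_converges (\<lambda>n. (s n, t n)) (a, b)"
    by (auto simp: weakly_converges_def intro: tendsto_add)
qed

section \<open>SDR and SADMM as degenerate proximal point iterations\<close>

locale split_problem =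
  fixes f :: "'h::{real_inner,complete_space} \<Rightarrow> ereal"
    and g :: "'k::{real_inner,complete_space} \<Rightarrow> ereal"
    and T :: "'k \<Rightarrow> 'g::{real_inner,complete_space}"
    and K :: "'g \<Rightarrow> 'h"
    and \<Sigma> :: "'g \<Rightarrow> 'g"
    and \<Upsilon> :: "'h \<Rightarrow> 'h"
  assumes f: "f \<in> Gamma0" and g: "g \<in> Gamma0"
    and T: "bounded_linear T" and K: "bounded_linear K"
    and sri: "0 \<in> sri {a - b |a b. a \<in> edom (conjugate g) \<and> b \<in> range (adjoint T)}"
    and \<Sigma>: "linear \<Sigma>" "self_adjoint \<Sigma>" "strongly_monotone \<Sigma>"
    and \<Upsilon>: "linear \<Upsilon>" "self_adjoint \<Upsilon>" "strongly_monotone \<Upsilon>"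
begin

definition \<phi> :: "'g \<Rightarrow> ereal" where
  "\<phi> s = conjugate g (- adjoint T s)"

sublocale T: bounded_linear T by (rule T)
sublocale K: bounded_linear K by (rule K)
sublocale Tadj: bounded_linear "adjoint T" by (rule bounded_linear_hilbert_adjoint[OF T])
sublocale Kadj: bounded_linear "adjoint K" by (rule bounded_linear_hilbert_adjoint[OF K])

lemmas \<Sigma>inv = strongly_monotone_inv[OF \<Sigma>]
lemmas \<Upsilon>inv = strongly_monotone_inv[OF \<Upsilon>]
lemmas lin_simps = linear_diff[OF \<Sigma>(1)] linear_add[OF \<Sigma>(1)] linear_diff[OF \<Sigma>inv(3)] linear_add[OF \<Sigma>inv(3)]
  linear_neg[OF \<Sigma>(1)] linear_neg[OF \<Sigma>inv(3)] linear_neg[OF \<Upsilon>(1)] linear_neg[OF \<Upsilon>inv(3)]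
  linear_diff[OF \<Upsilon>(1)] linear_add[OF \<Upsilon>(1)] linear_diff[OF \<Upsilon>inv(3)] linear_add[OF \<Upsilon>inv(3)]
  \<Sigma>inv(1,2) \<Upsilon>inv(1,2)

lemma adjoint_neg_adjoint: "adjoint (\<lambda>s. - adjoint T s) = (\<lambda>p. - T p)"
  by (rule adjoint_unique) (simp add: adjoint_inner_left[OF T])

lemma \<phi>_Gamma0: "\<phi> \<in> Gamma0"
proof -
  obtain a s where "a \<in> edom (conjugate g)" "0 = a - adjoint T s"
    using sri by (auto simp: sri_def)
  then have "conjugate g (- adjoint T (- s)) \<noteq> \<infinity>"
    by (simp add: edom_def Tadj.neg)
  then show ?thesis
    unfolding \<phi>_def[abs_def]
    by (intro Gamma0_compose_linear[of "conjugate g" "\<lambda>s. - adjoint T s"] Gamma0_conjugate g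
        bounded_linear_minus Tadj.bounded_linear_axioms)
qed

text \<open>The forward direction is the chain rule for \<open>conjugate g\<close> and the map
  \<open>- adjoint T\<close>, whose adjoint is \<open>- T\<close>, followed by inversion of the
  subdifferential of \<open>g\<close>. The backward direction is substitution.\<close>

lemma subdifferential_\<phi>_iff:
  "v \<in> subdifferential \<phi> s \<longleftrightarrow> (\<exists>p. T p = - v \<and> - adjoint T s \<in> subdifferential g p)"
proof
  assume v: "v \<in> subdifferential \<phi> s"
  \<comment> \<open>The sign leaves the range unchanged, so the qualification condition carries over
    to the map inside \<open>\<phi>\<close>.\<close>
  have "range (\<lambda>s. - adjoint T s) = range (adjoint T)"
    by (auto simp: image_iff simp flip: Tadj.neg) (metis minus_minus Tadj.neg)+
  then have "0 \<in> sri {a - b |a b. a \<in> edom (conjugate g) \<and> b \<in> range (\<lambda>s. - adjoint T s)}"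
    using sri by simp
  then obtain p where p: "p \<in> subdifferential (conjugate g) (- adjoint T s)" "adjoint (\<lambda>s. - adjoint T s) p = v"
    using subdifferential_compose_linear[of "conjugate g" "\<lambda>s. - adjoint T s" v s] v
      Gamma0_conjugate[OF g] bounded_linear_minus[OF Tadj.bounded_linear_axioms]
    unfolding \<phi>_def[abs_def] by blast
  then show "\<exists>p. T p = - v \<and> - adjoint T s \<in> subdifferential g p"
    using subdifferential_conjugate_iff[OF g] by (auto simp: adjoint_neg_adjoint)
next
  assume "\<exists>p. T p = - v \<and> - adjoint T s \<in> subdifferential g p"
  then obtain p where p: "v = - T p" "p \<in> subdifferential (conjugate g) (- adjoint T s)"
    using subdifferential_conjugate_iff[OF g] by (metis minus_minus)
  show "v \<in> subdifferential \<phi> s"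
  proof (rule subdifferentialI)
    fix y
    have "(y - s) \<bullet> v = (- adjoint T y - (- adjoint T s)) \<bullet> p"
      by (simp add: p(1) adjoint_inner_left[OF T] inner_diff_left)
    then show "ereal ((y - s) \<bullet> v) + \<phi> s \<le> \<phi> y"
      using subdifferentialD[OF p(2), of "- adjoint T y"] by (simp add: \<phi>_def)
  qed
qed

text \<open>In the unknown \<open>s = c - inv \<Sigma> v\<close> the inclusion is proximal, because
  \<open>\<Sigma> (c - s) = v\<close>; uniqueness of \<open>s\<close> passes back to
  \<open>v\<close>.\<close>

lemma \<phi>_prox_unique:
  assumes "v \<in> subdifferential \<phi> (c - inv \<Sigma> v)" "v' \<in> subdifferential \<phi> (c - inv \<Sigma> v')"
  shows "v = v'"
proof -
  have "\<Sigma> (c - (c - inv \<Sigma> w)) = w" for w by (simp add: lin_simps)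
  then have "c - inv \<Sigma> v = c - inv \<Sigma> v'"
    using ex1_subdifferential_prox[OF \<phi>_Gamma0 \<Sigma>, of c] assms by metis
  then show ?thesis by (metis \<Sigma>inv(1) diff_left_imp_eq add_diff_cancel_left' diff_diff_eq2)
qed

lemma conjugate_prox_unique:
  assumes "d - inv \<Upsilon> x \<in> subdifferential (conjugate f) x" "d - inv \<Upsilon> x' \<in> subdifferential (conjugate f) x'"
  shows "x = x'"
proof -
  have "inv \<Upsilon> (\<Upsilon> d - w) = d - inv \<Upsilon> w" for w by (simp add: lin_simps)
  then show ?thesis
    using ex1_subdifferential_prox[OF Gamma0_conjugate[OF f] \<Upsilon>inv(3-5), of "\<Upsilon> d"] assms by metis
qed

section \<open>The steps of SADMM and SDR as inclusions\<close>

lemma Argmin_SADMM_objective_iff: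
  "p' \<in> Argmin (SADMM_objective \<Sigma> \<Upsilon> g T K p q x) \<longleftrightarrow>
    - adjoint T (inv \<Sigma> (T p' - T p) + adjoint K (x + \<Upsilon> (K (T p) - q))) \<in> subdifferential g p'"
proof -
  define c where "c = T p - \<Sigma> (adjoint K (x + \<Upsilon> (K (T p) - q)))"
  have form: "(norm_wrt (inv \<Sigma>) u)\<^sup>2 = u \<bullet> inv \<Sigma> u" for u
    using strongly_monotone_form_nonneg[OF \<Sigma>inv(5), of u] by (simp add: norm_wrt_def)
  have "T (y - p') \<bullet> inv \<Sigma> (c - T p') =
      (y - p') \<bullet> (- adjoint T (inv \<Sigma> (T p' - T p) + adjoint K (x + \<Upsilon> (K (T p) - q))))" for y
  proof -
    have "inv \<Sigma> (c - T p') = - (inv \<Sigma> (T p' - T p) + adjoint K (x + \<Upsilon> (K (T p) - q)))"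
      by (simp add: c_def lin_simps)
    then show ?thesis by (simp only: adjoint_inner[OF T] Tadj.neg)
  qed
  then show ?thesis
    using argmin_plus_quadratic_iff[OF g T.linear_axioms \<Sigma>inv(3,4) strongly_monotone_form_nonneg[OF \<Sigma>inv(5)], of p' c]
    by (simp add: Argmin_iff SADMM_objective_def form subdifferential_def flip: c_def)
qed

text \<open>The minimizer is constructed backwards: a proximal step for \<open>\<phi>\<close> yields
  \<open>s\<close> and the subgradient \<open>\<Sigma> (w - s)\<close>, and the chain rule lifts the
  latter to a point \<open>p'\<close>. The vector \<open>w\<close> is chosen so that
  \<open>s\<close> is the argument of \<open>adjoint T\<close> in the optimality condition.\<close>

lemma Argmin_SADMM_objective_nonempty: "Argmin (SADMM_objective \<Sigma> \<Upsilon> g T K p q x) \<noteq> {}"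
proof -
  define w where "w = adjoint K (x + \<Upsilon> (K (T p) - q)) - inv \<Sigma> (T p)"
  obtain s where "\<Sigma> (w - s) \<in> subdifferential \<phi> s"
    using ex1_subdifferential_prox[OF \<phi>_Gamma0 \<Sigma>] by blast
  then obtain p' where p': "T p' = - \<Sigma> (w - s)" "- adjoint T s \<in> subdifferential g p'"
    unfolding subdifferential_\<phi>_iff by blast
  have "inv \<Sigma> (T p' - T p) + adjoint K (x + \<Upsilon> (K (T p) - q)) = s"
    by (simp add: p'(1) w_def lin_simps)
  then show ?thesis using p'(2) Argmin_SADMM_objective_iff by auto
qed

lemma SADMM_ex:
  "\<exists>p q x. p 0 = p0 \<and> q 0 = q0 \<and> x 0 = x0 \<and> SADMM \<Sigma> \<Upsilon> f g T K 0 p q x"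
proof -
  define P where "P p q x = (SOME p'. p' \<in> Argmin (SADMM_objective \<Sigma> \<Upsilon> g T K p q x))" for p q x
  have P: "P p q x \<in> Argmin (SADMM_objective \<Sigma> \<Upsilon> g T K p q x)" for p q x
    unfolding P_def using Argmin_SADMM_objective_nonempty some_in_eq by blast
  define Q where "Q p x = prox \<Upsilon> f (inv \<Upsilon> x + K (T p))" for p x
  define F where "F z = (case z of (p, q, x) \<Rightarrow>
    (P p q x, Q (P p q x) x, x + \<Upsilon> (K (T (P p q x)) - Q (P p q x) x)))" for z
  define z where "z n = (F ^^ n) (p0, q0, x0)" for n
  define p where "p n = fst (z n)" for n
  define q where "q n = fst (snd (z n))" for n
  define x where "x n = snd (snd (z n))" for n
  have z: "z n = (p n, q n, x n)" for n by (simp add: p_def q_def x_def)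
  have "(p (Suc n), q (Suc n), x (Suc n)) = F (p n, q n, x n)" for n
    unfolding z[symmetric] by (simp add: z_def)
  then have "p (Suc n) = P (p n) (q n) (x n)" "q (Suc n) = Q (p (Suc n)) (x n)"
    "x (Suc n) = x n + \<Upsilon> (K (T (p (Suc n))) - q (Suc n))" for n
    by (simp_all add: F_def)
  moreover have "p 0 = p0" "q 0 = q0" "x 0 = x0" by (simp_all add: p_def q_def x_def z_def)
  ultimately show ?thesis
    unfolding SADMM_def using P by (intro exI[of _ p] exI[of _ q] exI[of _ x]) (simp add: Q_def)
qed

text \<open>The update of \<open>x\<close> makes \<open>x (Suc n)\<close> the
  \<open>\<Upsilon>\<close>-scaled residual of the proximity step, hence a subgradient of
  \<open>f\<close> at \<open>q (Suc n)\<close>; conjugation exchanges the two. Solving that update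
  for \<open>q\<close> gives the second claim.\<close>

lemma SADMM_step:
  assumes "SADMM \<Sigma> \<Upsilon> f g T K m p q x" "m \<le> n"
  shows "- T (p (Suc n)) \<in> subdifferential \<phi> (adjoint K (x n + \<Upsilon> (K (T (p n)) - q n)) - inv \<Sigma> (T (p n)) - inv \<Sigma> (- T (p (Suc n))))"
    and "q (Suc n) = inv \<Upsilon> (x n) + K (T (p (Suc n))) - inv \<Upsilon> (x (Suc n))"
    and "q (Suc n) \<in> subdifferential (conjugate f) (x (Suc n))"
proof -
  have p: "p (Suc n) \<in> Argmin (SADMM_objective \<Sigma> \<Upsilon> g T K (p n) (q n) (x n))"
    and q: "q (Suc n) = prox \<Upsilon> f (inv \<Upsilon> (x n) + K (T (p (Suc n))))"
    and x: "x (Suc n) = x n + \<Upsilon> (K (T (p (Suc n))) - q (Suc n))"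
    using assms by (auto simp: SADMM_def)
  have "inv \<Sigma> (T (p (Suc n)) - T (p n)) + adjoint K (x n + \<Upsilon> (K (T (p n)) - q n)) =
    adjoint K (x n + \<Upsilon> (K (T (p n)) - q n)) - inv \<Sigma> (T (p n)) - inv \<Sigma> (- T (p (Suc n)))"
    by (simp add: lin_simps)
  with p show "- T (p (Suc n)) \<in> subdifferential \<phi> (adjoint K (x n + \<Upsilon> (K (T (p n)) - q n)) - inv \<Sigma> (T (p n)) - inv \<Sigma> (- T (p (Suc n))))"
    unfolding Argmin_SADMM_objective_iff subdifferential_\<phi>_iff by (metis minus_minus)
  show "q (Suc n) = inv \<Upsilon> (x n) + K (T (p (Suc n))) - inv \<Upsilon> (x (Suc n))"
    unfolding x by (simp add: lin_simps)
  have "\<Upsilon> (inv \<Upsilon> (x n) + K (T (p (Suc n))) - q (Suc n)) = x (Suc n)"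
    unfolding x by (simp add: lin_simps)
  then have "x (Suc n) \<in> subdifferential f (q (Suc n))"
    using q prox_eq_iff[OF f \<Upsilon>] by metis
  then show "q (Suc n) \<in> subdifferential (conjugate f) (x (Suc n))"
    by (rule subdifferential_imp_conjugate[OF f])
qed

text \<open>A completed step comes first, since only then is \<open>q\<close> given by its update
  formula and \<open>y\<close> equal to the extrapolated point.\<close>

lemma SADMM_step_Suc:
  assumes S: "SADMM \<Sigma> \<Upsilon> f g T K m p q x" and n: "m \<le> n"
  shows "- T (p (Suc (Suc n))) \<in> subdifferential \<phi>
    (adjoint K (2 *\<^sub>R x (Suc n) - x n) - inv \<Sigma> (T (p (Suc n))) - inv \<Sigma> (- T (p (Suc (Suc n)))))"
proof -
  have "x (Suc n) + \<Upsilon> (K (T (p (Suc n))) - q (Suc n)) = 2 *\<^sub>R x (Suc n) - x n"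
    unfolding SADMM_step(2)[OF S n] by (simp add: lin_simps scaleR_2)
  then show ?thesis using SADMM_step(1)[OF S, of "Suc n"] n by simp
qed

text \<open>Moreau's decomposition: the scaled residual \<open>v n\<close> is a subgradient of
  \<open>\<phi>\<close> at the resolvent point, and that point is recovered as
  \<open>w - inv \<Sigma> (v n)\<close>. Without resolvents, SDR becomes directly comparable with
  SADMM.\<close>

lemma SDR_step:
  assumes "SDR \<Sigma> \<Upsilon> (subdifferential (conjugate f)) (subdifferential \<phi>) (adjoint K) x u v"
  shows "v n \<in> subdifferential \<phi> (adjoint K (x n) + inv \<Sigma> (u n) - inv \<Sigma> (v n))"
    and "inv \<Upsilon> (x n) - K (v n) - inv \<Upsilon> (x (Suc n)) \<in> subdifferential (conjugate f) (x (Suc n))"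
    and "u (Suc n) = \<Sigma> (adjoint K (x (Suc n) - x n)) + v n"
proof -
  define w where "w = adjoint K (x n) + inv \<Sigma> (u n)"
  define z where "z = x n - \<Upsilon> (K (v n))"
  define r where "r = resolvent (\<lambda>s. inv \<Sigma> ` subdifferential \<phi> s) w"
  have v: "v n = \<Sigma> (w - r)"
    and x: "x (Suc n) = resolvent (\<lambda>s. \<Upsilon> ` subdifferential (conjugate f) s) z"
    using assms by (simp_all add: SDR_def Let_def w_def z_def r_def adjoint_hilbert_adjoint[OF K])
  show "u (Suc n) = \<Sigma> (adjoint K (x (Suc n) - x n)) + v n"
    using assms by (simp add: SDR_def Let_def)
  have "v n \<in> subdifferential \<phi> r"
    using resolvent_subdifferential_eq_iff[OF \<phi>_Gamma0 \<Sigma>, of w r] by (simp add: v r_def)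
  moreover have "r = w - inv \<Sigma> (v n)" by (simp add: v lin_simps)
  ultimately show "v n \<in> subdifferential \<phi> (adjoint K (x n) + inv \<Sigma> (u n) - inv \<Sigma> (v n))"
    by (simp add: w_def)
  \<comment> \<open>The resolvent lemma preconditions by an inverse, so a factor
    \<open>\<Upsilon>\<close> requires the metric \<open>inv \<Upsilon>\<close>.\<close>
  have "inv (inv \<Upsilon>) = \<Upsilon>" by (rule inv_inv_eq[OF strongly_monotone_bij[OF \<Upsilon>]])
  then have "inv \<Upsilon> (z - x (Suc n)) \<in> subdifferential (conjugate f) (x (Suc n))"
    using resolvent_subdifferential_eq_iff[OF Gamma0_conjugate[OF f] \<Upsilon>inv(3-5), of z "x (Suc n)"] x by simp
  then show "inv \<Upsilon> (x n) - K (v n) - inv \<Upsilon> (x (Suc n)) \<in> subdifferential (conjugate f) (x (Suc n))"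
    by (simp add: z_def lin_simps)
qed

text \<open>Both methods solve the same two inclusions, each with a unique solution, so agreement of
  \<open>x\<close> and of the argument of the \<open>\<phi>\<close>-resolvent propagates. The
  indices \<open>k\<close> and \<open>n\<close> are separate because the second reduction runs with
  a lag of one.\<close>

lemma SDR_SADMM_step_unique:
  assumes D: "SDR \<Sigma> \<Upsilon> (subdifferential (conjugate f)) (subdifferential \<phi>) (adjoint K) xt ut vt"
    and S: "SADMM \<Sigma> \<Upsilon> f g T K m p q x" and n: "m \<le> n"
    and x: "xt k = x n"
    and s: "adjoint K (xt k) + inv \<Sigma> (ut k) = adjoint K (x n + \<Upsilon> (K (T (p n)) - q n)) - inv \<Sigma> (T (p n))"
  shows "vt k = - T (p (Suc n))" and "xt (Suc k) = x (Suc n)"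
proof -
  show v: "vt k = - T (p (Suc n))"
    using \<phi>_prox_unique[OF _ SADMM_step(1)[OF S n]] SDR_step(1)[OF D, of k] s by metis
  have "q (Suc n) = inv \<Upsilon> (xt k) - K (vt k) - inv \<Upsilon> (x (Suc n))"
    using SADMM_step(2)[OF S n] x v by (simp add: K.neg)
  then show "xt (Suc k) = x (Suc n)"
    using SDR_step(2)[OF D, of k] SADMM_step(3)[OF S n] conjugate_prox_unique by metis
qed

theorem SDR_reduces_to_SADMM:
  assumes D: "SDR \<Sigma> \<Upsilon> (subdifferential (conjugate f)) (subdifferential \<phi>) (adjoint K) xt ut vt"
    and pt: "\<And>n. T (pt (Suc n)) = - vt n"
    and qt: "\<And>n. qt (Suc n) = inv \<Upsilon> (xt n - xt (Suc n) - \<Upsilon> (K (vt n)))"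
    and p1: "T (p 1) = T (pt 1)" and q1: "q 1 = qt 1" and x1: "x 1 = xt 1"
    and S: "SADMM \<Sigma> \<Upsilon> f g T K 1 p q x"
  shows "T (pt (Suc n)) = T (p (Suc n)) \<and> qt (Suc n) = q (Suc n) \<and> xt (Suc n) = x (Suc n)"
proof (induction n)
  case 0
  then show ?case using p1 q1 x1 by simp
next
  case (Suc n)
  have Tp: "T (p (Suc n)) = - vt n" using Suc pt by simp
  \<comment> \<open>Taken from the definition of \<open>qt\<close> through the induction hypothesis:
    at its starting index SADMM itself imposes no relation on \<open>q\<close>, and this one makes
    the extrapolation valid from the start.\<close>
  have q: "q (Suc n) = inv \<Upsilon> (xt n - xt (Suc n)) - K (vt n)"
    using Suc[THEN conjunct2, THEN conjunct1, symmetric] qt[of n] by (simp add: lin_simps)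
  have "x (Suc n) + \<Upsilon> (K (T (p (Suc n))) - q (Suc n)) = xt (Suc n) + (xt (Suc n) - xt n)"
    using Suc unfolding Tp q by (simp add: lin_simps K.neg)
  then have "adjoint K (xt (Suc n)) + inv \<Sigma> (ut (Suc n)) =
      adjoint K (x (Suc n) + \<Upsilon> (K (T (p (Suc n))) - q (Suc n))) - inv \<Sigma> (T (p (Suc n)))"
    unfolding SDR_step(3)[OF D] Tp by (simp add: lin_simps Kadj.add)
  then have v: "vt (Suc n) = - T (p (Suc (Suc n)))" and x: "xt (Suc (Suc n)) = x (Suc (Suc n))"
    using SDR_SADMM_step_unique[OF D S, of "Suc n" "Suc n"] Suc by simp_all
  have "qt (Suc (Suc n)) = q (Suc (Suc n))"
    using SADMM_step(2)[OF S, of "Suc n"] Suc v x unfolding qt by (simp add: lin_simps K.neg)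
  then show ?case using v x pt by simp
qed

theorem SADMM_reduces_to_SDR:
  assumes S: "SADMM \<Sigma> \<Upsilon> f g T K 0 p q x"
    and u: "\<And>n. u (Suc n) = \<Sigma> (adjoint K (x (Suc n) - x n)) - T (p (Suc n))"
    and init: "xt 0 = x 1" "ut 0 = u 1"
    and D: "SDR \<Sigma> \<Upsilon> (subdifferential (conjugate f)) (subdifferential \<phi>) (adjoint K) xt ut vt"
  shows "xt n = x (Suc n) \<and> ut n = u (Suc n)"
proof (induction n)
  case 0
  then show ?case using init by simp
next
  case (Suc n)
  have "x (Suc n) + \<Upsilon> (K (T (p (Suc n))) - q (Suc n)) = x (Suc n) + (x (Suc n) - x n)"
    unfolding SADMM_step(2)[OF S le0] by (simp add: lin_simps)
  \<comment> \<open>By the choice of \<open>u\<close> both sides equal \<open>adjoint K (2 *\<^sub>R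
    x (Suc n) - x n) - inv \<Sigma> (T (p (Suc n)))\<close>. The first SADMM step only prepares
    these data, hence the shift by one.\<close>
  then have "adjoint K (xt n) + inv \<Sigma> (ut n) =
      adjoint K (x (Suc n) + \<Upsilon> (K (T (p (Suc n))) - q (Suc n))) - inv \<Sigma> (T (p (Suc n)))"
    using Suc by (simp add: u lin_simps Kadj.add)
  then have "vt n = - T (p (Suc (Suc n)))" "xt (Suc n) = x (Suc (Suc n))"
    using SDR_SADMM_step_unique[OF D S, of "Suc n" n] Suc by simp_all
  then show ?case using Suc by (simp add: SDR_step(3)[OF D] u)
qed

section \<open>Weak convergence of SADMM and optimality of the limit\<close>

definition skew :: "'h \<times> 'g \<Rightarrow> 'h \<times> 'g" where
  "skew z = (K (snd z), - adjoint K (fst z))"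

definition metric :: "'h \<times> 'g \<Rightarrow> 'h \<times> 'g" where
  "metric z = (inv \<Upsilon> (fst z) - K (snd z), inv \<Sigma> (snd z) - adjoint K (fst z))"

definition saddle :: "'h \<times> 'g \<Rightarrow> ereal" where
  "saddle z = conjugate f (fst z) + conjugate \<phi> (snd z)"

lemma saddle_Gamma0: "saddle \<in> Gamma0"
  unfolding saddle_def[abs_def] by (intro Gamma0_Times Gamma0_conjugate f \<phi>_Gamma0)

lemma subdifferential_saddle_iff:
  "w \<in> subdifferential saddle z \<longleftrightarrow>
    fst w \<in> subdifferential (conjugate f) (fst z) \<and> snd w \<in> subdifferential (conjugate \<phi>) (snd z)"
  using subdifferential_Times_iff[OF Gamma0_conjugate[OF f] Gamma0_conjugate[OF \<phi>_Gamma0], of "fst w" "snd w" "fst z" "snd z"]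
  by (simp add: saddle_def[abs_def])

lemma bounded_linear_skew: "bounded_linear skew"
  unfolding skew_def[abs_def]
  by (rule bounded_linear_Pair[OF bounded_linear_compose[OF K bounded_linear_snd]
        bounded_linear_minus[OF bounded_linear_compose[OF Kadj.bounded_linear_axioms bounded_linear_fst]]])

lemma bounded_linear_inv: "bounded_linear (inv \<Upsilon>)" "bounded_linear (inv \<Sigma>)"
  using \<Upsilon>inv \<Sigma>inv by (simp_all add: hellinger_toeplitz)

lemma bounded_linear_metric: "bounded_linear metric"
  unfolding metric_def[abs_def]
  by (rule bounded_linear_Pair[OF
        bounded_linear_sub[OF bounded_linear_compose[OF bounded_linear_inv(1) bounded_linear_fst]
          bounded_linear_compose[OF K bounded_linear_snd]]
        bounded_linear_sub[OF bounded_linear_compose[OF bounded_linear_inv(2) bounded_linear_snd]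
          bounded_linear_compose[OF Kadj.bounded_linear_axioms bounded_linear_fst]]])

lemma inner_skew: "z \<bullet> skew z = 0"
  by (cases z) (simp add: skew_def inner_commute flip: adjoint_inner_left[OF K])

lemma self_adjoint_metric: "self_adjoint metric"
  unfolding self_adjoint_def
proof (intro allI)
  fix y z
  have "inv \<Upsilon> (fst y) \<bullet> fst z = fst y \<bullet> inv \<Upsilon> (fst z)" "inv \<Sigma> (snd y) \<bullet> snd z = snd y \<bullet> inv \<Sigma> (snd z)"
    using \<Upsilon>inv(4) \<Sigma>inv(4) unfolding self_adjoint_def by blast+
  then show "metric y \<bullet> z = y \<bullet> metric z"
    by (simp add: metric_def inner_prod_def inner_diff_left inner_diff_right
        adjoint_inner[OF K, of "snd y" "fst z"] adjoint_inner_left[OF K, of "fst y" "snd z"])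
qed

text \<open>A Schur complement: with \<open>x = \<Upsilon> y\<close> the form is the
  \<open>\<Upsilon>\<close>-form of \<open>y - K v\<close> plus the form of
  \<open>inv \<Sigma> - adjoint K \<circ> \<Upsilon> \<circ> K\<close> at \<open>v\<close>,
  nonnegative by the monotonicity assumption.\<close>

lemma metric_nonneg:
  assumes mono: "monotone_op (\<lambda>u. inv \<Sigma> u - adjoint K (\<Upsilon> (K u)))"
  shows "0 \<le> z \<bullet> metric z"
proof -
  obtain x v where z: "z = (x, v)" by (cases z)
  define y where "y = inv \<Upsilon> x"
  have x: "x = \<Upsilon> y" by (simp add: y_def lin_simps)
  have "0 \<le> (v - 0) \<bullet> ((inv \<Sigma> v - adjoint K (\<Upsilon> (K v))) - (inv \<Sigma> 0 - adjoint K (\<Upsilon> (K 0))))"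
    using mono unfolding monotone_op_def by blast
  then have 1: "K v \<bullet> \<Upsilon> (K v) \<le> v \<bullet> inv \<Sigma> v"
    by (simp add: inner_diff_right linear_0[OF \<Sigma>inv(3)] linear_0[OF \<Upsilon>(1)] K.zero Kadj.zero adjoint_inner[OF K])
  have "0 \<le> (y + - K v) \<bullet> \<Upsilon> (y + - K v)"
    by (rule strongly_monotone_form_nonneg[OF \<Upsilon>(3)])
  also have "\<dots> = y \<bullet> \<Upsilon> y - 2 * (K v \<bullet> \<Upsilon> y) + K v \<bullet> \<Upsilon> (K v)"
    unfolding self_adjoint_form_add[OF \<Upsilon>(1,2)] by (simp add: linear_neg[OF \<Upsilon>(1)])
  also have "\<dots> \<le> z \<bullet> metric z"
    using 1 by (simp add: z metric_def inner_diff_right x \<Upsilon>inv(2) inner_commute flip: adjoint_inner[OF K])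
  finally show ?thesis .
qed

text \<open>The sum of \<open>metric\<close> and \<open>skew\<close> maps \<open>(x, u)\<close> to
  \<open>(inv \<Upsilon> x, inv \<Sigma> u - 2 *\<^sub>R adjoint K x)\<close>: the terms
  \<open>K u\<close> cancel and the system is triangular. The first block is Lipschitz in
  \<open>w\<close> alone, and the second once \<open>2 *\<^sub>R adjoint K x\<close> is counted
  among its data.\<close>

lemma saddle_inverse_Lipschitz:
  obtains C where "\<And>z z' w w'. w - metric z - skew z \<in> subdifferential saddle z \<Longrightarrow>
      w' - metric z' - skew z' \<in> subdifferential saddle z' \<Longrightarrow> norm (z - z') \<le> C * norm (w - w')"
proof -
  obtain \<gamma> where \<gamma>: "\<gamma> > 0" "\<And>x. \<gamma> * (norm x)\<^sup>2 \<le> x \<bullet> inv \<Upsilon> x"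
    using \<Upsilon>inv(5) by (auto simp: strongly_monotone_def)
  obtain \<beta> where \<beta>: "\<beta> > 0" "\<And>x. \<beta> * (norm x)\<^sup>2 \<le> x \<bullet> inv \<Sigma> x"
    using \<Sigma>inv(5) by (auto simp: strongly_monotone_def)
  obtain k where k: "k > 0" "\<And>x. norm (adjoint K x) \<le> norm x * k"
    using Kadj.pos_bounded by blast
  show thesis
  proof (rule that)
    fix z z' w w'
    assume zw: "w - metric z - skew z \<in> subdifferential saddle z"
      "w' - metric z' - skew z' \<in> subdifferential saddle z'"
    let ?N = "norm (w - w')"
    have dw: "w - w' = (fst w - fst w', snd w - snd w')" and dz: "z - z' = (fst z - fst z', snd z - snd z')"
      by (simp_all add: prod_eq_iff)
    have "\<gamma> * norm (fst z - fst z') \<le> norm (fst w - fst w')"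
      using zw by (intro subdifferential_strong_Lipschitz[OF Gamma0_conjugate[OF f] \<Upsilon>inv(3) \<gamma>(2)])
        (simp_all add: subdifferential_saddle_iff metric_def skew_def)
    also have "\<dots> \<le> ?N" unfolding dw by (rule norm_fst_le)
    finally have 1: "norm (fst z - fst z') \<le> ?N / \<gamma>" using \<gamma>(1) by (simp add: field_simps)
    have "\<beta> * norm (snd z - snd z') \<le>
        norm ((snd w + 2 *\<^sub>R adjoint K (fst z)) - (snd w' + 2 *\<^sub>R adjoint K (fst z')))"
      using zw by (intro subdifferential_strong_Lipschitz[OF Gamma0_conjugate[OF \<phi>_Gamma0] \<Sigma>inv(3) \<beta>(2)])
        (simp_all add: subdifferential_saddle_iff metric_def skew_def scaleR_2 algebra_simps)
    also have "\<dots> = norm ((snd w - snd w') + 2 *\<^sub>R adjoint K (fst z - fst z'))"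
      by (simp add: Kadj.diff algebra_simps)
    also have "\<dots> \<le> norm (snd w - snd w') + 2 * norm (adjoint K (fst z - fst z'))"
      using norm_triangle_ineq[of "snd w - snd w'" "2 *\<^sub>R adjoint K (fst z - fst z')"] by simp
    also have "\<dots> \<le> ?N + 2 * (?N / \<gamma> * k)"
    proof -
      have "norm (snd w - snd w') \<le> ?N" unfolding dw by (rule norm_snd_le)
      moreover have "norm (adjoint K (fst z - fst z')) \<le> ?N / \<gamma> * k"
        using k(2)[of "fst z - fst z'"] mult_right_mono[OF 1, of k] k(1) by linarith
      ultimately show ?thesis by simp
    qed
    finally have 2: "norm (snd z - snd z') \<le> (?N + 2 * (?N / \<gamma> * k)) / \<beta>"
      using \<beta>(1) by (simp add: field_simps)
    have "norm (z - z') \<le> norm (fst z - fst z') + norm (snd z - snd z')"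
      unfolding dz by (rule norm_Pair_le)
    also have "\<dots> \<le> ?N / \<gamma> + (?N + 2 * (?N / \<gamma> * k)) / \<beta>" using 1 2 by simp
    also have "\<dots> = (1 / \<gamma> + (1 + 2 * k / \<gamma>) / \<beta>) * ?N"
      by (simp add: algebra_simps add_divide_distrib)
    finally show "norm (z - z') \<le> (1 / \<gamma> + (1 + 2 * k / \<gamma>) / \<beta>) * ?N" .
  qed
qed

lemma SADMM_weakly_converges:
  assumes mono: "monotone_op (\<lambda>u. inv \<Sigma> u - adjoint K (\<Upsilon> (K u)))"
    and kkt: "- K u0 \<in> subdifferential (conjugate f) x0" "adjoint K x0 \<in> subdifferential (conjugate \<phi>) u0"
    and S: "SADMM \<Sigma> \<Upsilon> f g T K 0 p q x"
  obtains xh uh where "- K uh \<in> subdifferential (conjugate f) xh" "uh \<in> subdifferential \<phi> (adjoint K xh)"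
    "weakly_converges x xh" "weakly_converges (\<lambda>n. - T (p n)) uh" "weakly_converges q (- K uh)"
proof -
  define z where "z n = (x n, - T (p (Suc n)))" for n
  obtain C where C: "\<And>z z' w w'. w - metric z - skew z \<in> subdifferential saddle z \<Longrightarrow>
      w' - metric z' - skew z' \<in> subdifferential saddle z' \<Longrightarrow> norm (z - z') \<le> C * norm (w - w')"
    using saddle_inverse_Lipschitz by blast
  have zero: "- skew (x0, u0) \<in> subdifferential saddle (x0, u0)"
    using kkt by (simp add: subdifferential_saddle_iff skew_def)
  have step: "metric (z n - z (Suc n)) - skew (z (Suc n)) \<in> subdifferential saddle (z (Suc n))" for n
  proof -
    have 1: "inv \<Upsilon> (x n - x (Suc n)) - K (- T (p (Suc n))) \<in> subdifferential (conjugate f) (x (Suc n))"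
      using SADMM_step(3)[OF S le0, of n] unfolding SADMM_step(2)[OF S le0, of n]
      by (simp add: lin_simps K.neg algebra_simps)
    have 2: "adjoint K (2 *\<^sub>R x (Suc n) - x n) - inv \<Sigma> (T (p (Suc n))) - inv \<Sigma> (- T (p (Suc (Suc n))))
        \<in> subdifferential (conjugate \<phi>) (- T (p (Suc (Suc n))))"
      by (rule subdifferential_imp_conjugate[OF \<phi>_Gamma0 SADMM_step_Suc[OF S le0]])
    show ?thesis
      unfolding subdifferential_saddle_iff
      using 1 2 by (simp add: z_def metric_def skew_def lin_simps K.neg K.diff K.add Kadj.diff scaleR_2 Kadj.add algebra_simps)
  qed
  have "\<exists>l. - skew l \<in> subdifferential saddle l \<and> weakly_converges z l"
    by (rule degenerate_proximal_point[where z = z and S = skew and W = metric and C = C,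
          OF saddle_Gamma0 bounded_linear_skew inner_skew bounded_linear_metric
          self_adjoint_metric metric_nonneg[OF mono] C zero step])
  then obtain l where l: "- skew l \<in> subdifferential saddle l" "weakly_converges z l" by blast
  obtain xh uh where lh: "l = (xh, uh)" by (cases l)
  have x: "weakly_converges x xh" and Tp: "weakly_converges (\<lambda>n. - T (p (Suc n))) uh"
    using l(2) unfolding lh z_def[abs_def] weakly_converges_Pair_iff by auto
  \<comment> \<open>In the formula for \<open>q (Suc n)\<close> the images of \<open>x n\<close> and
    \<open>x (Suc n)\<close> have the same weak limit and cancel, leaving
    \<open>K (T (p (Suc n)))\<close>.\<close>
  have Yx: "weakly_converges (\<lambda>n. inv \<Upsilon> (x n)) (inv \<Upsilon> xh)"
    by (rule weakly_converges_bounded_linear[OF x bounded_linear_inv(1)])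
  have "weakly_converges (\<lambda>n. (inv \<Upsilon> (x n) + - inv \<Upsilon> (x (Suc n))) + - K (- T (p (Suc n)))) ((inv \<Upsilon> xh + - inv \<Upsilon> xh) + - K uh)"
    by (intro weakly_converges_add weakly_converges_minus Yx weakly_converges_bounded_linear[OF Tp K])
      (rule Yx[THEN weakly_converges_Suc_iff[THEN iffD2]])
  then have "weakly_converges (\<lambda>n. q (Suc n)) (- K uh)"
    unfolding SADMM_step(2)[OF S le0] by (simp add: K.neg algebra_simps)
  then have "weakly_converges q (- K uh)" unfolding weakly_converges_Suc_iff .
  moreover have "weakly_converges (\<lambda>n. - T (p n)) uh"
    using Tp weakly_converges_Suc_iff[of "\<lambda>n. - T (p n)"] by simp
  moreover have "- K uh \<in> subdifferential (conjugate f) xh" "uh \<in> subdifferential \<phi> (adjoint K xh)"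
    using l(1) by (simp_all add: lh subdifferential_saddle_iff skew_def subdifferential_conjugate_iff[OF \<phi>_Gamma0])
  ultimately show thesis using x that by blast
qed

text \<open>For each of the three problems the inclusions, or their conjugate forms, provide two
  subgradient inequalities with opposite linear parts. The point \<open>yh\<close> is the one that
  the chain rule attaches to \<open>uh\<close>.\<close>

lemma kkt_imp_optimal:
  assumes x: "- K uh \<in> subdifferential (conjugate f) xh" and u: "uh \<in> subdifferential \<phi> (adjoint K xh)"
  obtains yh where "uh = - T yh" "yh \<in> Argmin (\<lambda>y. g y + f (K (T y)))"
    "xh \<in> Argmin (\<lambda>x. conjugate f x + \<phi> (adjoint K x))"
    "uh \<in> Argmin (\<lambda>u. conjugate \<phi> u + f (- K u))"
proof -
  obtain yh where yh: "T yh = - uh" "- adjoint T (adjoint K xh) \<in> subdifferential g yh"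
    using u unfolding subdifferential_\<phi>_iff by blast
  have xf: "xh \<in> subdifferential f (- K uh)"
    using x subdifferential_conjugate_iff[OF f] by blast
  show thesis
  proof (rule that)
    show "uh = - T yh" using yh(1) by simp
    show "yh \<in> Argmin (\<lambda>y. g y + f (K (T y)))"
    proof (rule Argmin_addI[where c = "\<lambda>y. (y - yh) \<bullet> (- adjoint T (adjoint K xh))"])
      fix y
      show "ereal ((y - yh) \<bullet> (- adjoint T (adjoint K xh))) + g yh \<le> g y"
        by (rule subdifferentialD[OF yh(2)])
      have "- ((y - yh) \<bullet> (- adjoint T (adjoint K xh))) = (K (T y) - - K uh) \<bullet> xh"
        by (simp add: yh(1) T.diff K.neg K.add inner_diff_left inner_add_left flip: adjoint_inner[OF T] adjoint_inner[OF K])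
      then show "ereal (- ((y - yh) \<bullet> (- adjoint T (adjoint K xh)))) + f (K (T yh)) \<le> f (K (T y))"
        using subdifferentialD[OF xf, of "K (T y)"] by (simp add: yh(1) K.neg)
    qed
    show "xh \<in> Argmin (\<lambda>x. conjugate f x + \<phi> (adjoint K x))"
    proof (rule Argmin_addI[where c = "\<lambda>y. (y - xh) \<bullet> (- K uh)"])
      fix y
      show "ereal ((y - xh) \<bullet> (- K uh)) + conjugate f xh \<le> conjugate f y"
        by (rule subdifferentialD[OF x])
      have "- ((y - xh) \<bullet> (- K uh)) = (adjoint K y - adjoint K xh) \<bullet> uh"
        by (simp add: adjoint_inner_left[OF K] inner_diff_left)
      then show "ereal (- ((y - xh) \<bullet> (- K uh))) + \<phi> (adjoint K xh) \<le> \<phi> (adjoint K y)"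
        using subdifferentialD[OF u, of "adjoint K y"] by simp
    qed
    show "uh \<in> Argmin (\<lambda>u. conjugate \<phi> u + f (- K u))"
    proof (rule Argmin_addI[where c = "\<lambda>y. (y - uh) \<bullet> adjoint K xh"])
      fix y
      show "ereal ((y - uh) \<bullet> adjoint K xh) + conjugate \<phi> uh \<le> conjugate \<phi> y"
        by (rule subdifferentialD[OF subdifferential_imp_conjugate[OF \<phi>_Gamma0 u]])
      have "- ((y - uh) \<bullet> adjoint K xh) = (- K y - - K uh) \<bullet> xh"
        by (simp add: K.diff inner_diff_left flip: adjoint_inner[OF K])
      then show "ereal (- ((y - uh) \<bullet> adjoint K xh)) + f (- K uh) \<le> f (- K y)"
        using subdifferentialD[OF xf, of "- K y"] by simp
    qed
  qed
qed

end

theorem theorem4p6: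
  fixes f :: "'h::{real_inner,complete_space} \<Rightarrow> ereal"
    and g :: "'k::{real_inner,complete_space} \<Rightarrow> ereal"
    and T :: "'k \<Rightarrow> 'g::{real_inner,complete_space}"
    and K :: "'g \<Rightarrow> 'h"
    and \<Sigma> :: "'g \<Rightarrow> 'g"
    and \<Upsilon> :: "'h \<Rightarrow> 'h"
    and A :: "'h \<Rightarrow> 'h set"
    and B :: "'g \<Rightarrow> 'g set"
    and L :: "'h \<Rightarrow> 'g"
    and S_P :: "'k set" and S_D :: "'h set" and S_Pstar :: "'g set"
  assumes g: "g \<in> Gamma0" and f: "f \<in> Gamma0"
    and T: "bounded_linear T" "T \<noteq> (\<lambda>_. 0)"
    and K: "bounded_linear K" "K \<noteq> (\<lambda>_. 0)"
    and ran_dom: "range (adjoint T) \<inter> edom (conjugate g) \<noteq> {}"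
    and S_P: "S_P = Argmin (\<lambda>y. g y + f (K (T y)))"
    and S_D: "S_D = Argmin (\<lambda>x. conjugate f x + conjugate g (- adjoint T (adjoint K x)))"
    and S_Pstar: "S_Pstar =
          Argmin (\<lambda>u. conjugate (\<lambda>s. conjugate g (- adjoint T s)) u + f (- K u))"
    and kkt: "\<exists>xh uh. 0 \<in> (\<lambda>a. a + K uh) ` subdifferential (conjugate f) xh \<and>
          0 \<in> (\<lambda>b. b - adjoint K xh) `
                subdifferential (conjugate (\<lambda>s. conjugate g (- adjoint T s))) uh"
    and A: "A = subdifferential (conjugate f)"
    and B: "B = subdifferential (\<lambda>s. conjugate g (- adjoint T s))"
    and L: "L = adjoint K"
    and sri: "0 \<in> sri {a - b |a b. a \<in> edom (conjugate g) \<and> b \<in> range (adjoint T)}"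
    and \<Sigma>: "linear \<Sigma>" "self_adjoint \<Sigma>" "strongly_monotone \<Sigma>"
    and \<Upsilon>: "linear \<Upsilon>" "self_adjoint \<Upsilon>" "strongly_monotone \<Upsilon>"
    and mono: "monotone_op (\<lambda>u. inv \<Sigma> u - adjoint K (\<Upsilon> (K u)))"
  shows
    "\<comment> \<open>existence of the SADMM sequences\<close>
     ((\<forall>p q x. Argmin (SADMM_objective \<Sigma> \<Upsilon> g T K p q x) \<noteq> {}) \<and>
      (\<forall>p0 q0 x0. \<exists>p q x. p 0 = p0 \<and> q 0 = q0 \<and> x 0 = x0 \<and> SADMM \<Sigma> \<Upsilon> f g T K 0 p q x)) \<and>
     \<comment> \<open>(i)\<close>
     (\<forall>xt ut vt. SDR \<Sigma> \<Upsilon> A B L xt ut vt \<longrightarrow>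
        (\<forall>n. T -` {- vt n} \<noteq> {}) \<and>
        (\<forall>pt qt. (\<forall>n. pt (Suc n) \<in> T -` {- vt n} \<and>
                      qt (Suc n) = inv \<Upsilon> (xt n - xt (Suc n) - \<Upsilon> (K (vt n)))) \<longrightarrow>
           (\<forall>p q x. T (p 1) = T (pt 1) \<and> q 1 = qt 1 \<and> x 1 = xt 1 \<and>
                    SADMM \<Sigma> \<Upsilon> f g T K 1 p q x \<longrightarrow>
              (\<forall>n\<ge>1. T (pt n) = T (p n) \<and> qt n = q n \<and> xt n = x n)))) \<and>
     \<comment> \<open>(ii)\<close>
     (\<forall>p q x u xt ut vt.
        SADMM \<Sigma> \<Upsilon> f g T K 0 p q x \<and>
        (\<forall>n. u (Suc n) = \<Sigma> (adjoint K (x (Suc n) - x n)) - T (p (Suc n))) \<and>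
        xt 0 = x 1 \<and> ut 0 = u 1 \<and> SDR \<Sigma> \<Upsilon> A B L xt ut vt \<longrightarrow>
        (\<forall>n. xt n = x (Suc n) \<and> ut n = u (Suc n))) \<and>
     \<comment> \<open>(iii)\<close>
     (\<forall>p q x. SADMM \<Sigma> \<Upsilon> f g T K 0 p q x \<longrightarrow>
        (\<exists>yh xh uh. yh \<in> S_P \<and> xh \<in> S_D \<and> uh \<in> S_Pstar \<and>
           weakly_converges (\<lambda>n. (x n, - T (p n), q n)) (xh, uh, - K uh) \<and> uh = - T yh) \<and>
        (range (adjoint T) = UNIV \<longrightarrow> (\<exists>yh\<in>S_P. weakly_converges p yh)))"
proof -
  interpret split_problem f g T K \<Sigma> \<Upsilon>
    by (rule split_problem.intro[OF f g T(1) K(1) sri \<Sigma> \<Upsilon>])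
  have \<phi>: "(\<lambda>s. conjugate g (- adjoint T s)) = \<phi>"
    by (simp add: \<phi>_def[abs_def])
  have exist: "\<forall>p q x. Argmin (SADMM_objective \<Sigma> \<Upsilon> g T K p q x) \<noteq> {}"
    "\<forall>p0 q0 x0. \<exists>p q x. p 0 = p0 \<and> q 0 = q0 \<and> x 0 = x0 \<and> SADMM \<Sigma> \<Upsilon> f g T K 0 p q x"
    using Argmin_SADMM_objective_nonempty SADMM_ex by blast+
  have i: "(\<forall>n. T -` {- vt n} \<noteq> {}) \<and>
      (\<forall>pt qt. (\<forall>n. pt (Suc n) \<in> T -` {- vt n} \<and>
                    qt (Suc n) = inv \<Upsilon> (xt n - xt (Suc n) - \<Upsilon> (K (vt n)))) \<longrightarrow>
         (\<forall>p q x. T (p 1) = T (pt 1) \<and> q 1 = qt 1 \<and> x 1 = xt 1 \<and>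
                  SADMM \<Sigma> \<Upsilon> f g T K 1 p q x \<longrightarrow>
            (\<forall>n\<ge>1. T (pt n) = T (p n) \<and> qt n = q n \<and> xt n = x n)))"
    if D: "SDR \<Sigma> \<Upsilon> A B L xt ut vt" for xt ut vt
  proof -
    note D' = D[unfolded A B L \<phi>]
    \<comment> \<open>Makes the selection of \<open>pt\<close> possible: each \<open>vt n\<close> is
      a subgradient of \<open>\<phi>\<close>.\<close>
    have ne: "\<forall>n. T -` {- vt n} \<noteq> {}"
      using SDR_step(1)[OF D'] unfolding subdifferential_\<phi>_iff by blast
    have eq: "T (pt n) = T (p n) \<and> qt n = q n \<and> xt n = x n"
      if pq: "\<forall>n. pt (Suc n) \<in> T -` {- vt n} \<and> qt (Suc n) = inv \<Upsilon> (xt n - xt (Suc n) - \<Upsilon> (K (vt n)))"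
        and init: "T (p 1) = T (pt 1)" "q 1 = qt 1" "x 1 = xt 1"
        and S: "SADMM \<Sigma> \<Upsilon> f g T K 1 p q x" and n: "1 \<le> n" for pt qt p q x n
    proof -
      have pt: "\<And>n. T (pt (Suc n)) = - vt n"
        and qt: "\<And>n. qt (Suc n) = inv \<Upsilon> (xt n - xt (Suc n) - \<Upsilon> (K (vt n)))"
        using pq by auto
      obtain m where "n = Suc m" using n by (cases n) auto
      then show ?thesis using SDR_reduces_to_SADMM[OF D' pt qt init S, of m] by simp
    qed
    show ?thesis
      by (rule conjI[OF ne], (rule allI | rule impI)+, (erule conjE)+, rule eq)
  qed
  have ii: "xt n = x (Suc n) \<and> ut n = u (Suc n)"
    if S: "SADMM \<Sigma> \<Upsilon> f g T K 0 p q x"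
      and u: "\<forall>n. u (Suc n) = \<Sigma> (adjoint K (x (Suc n) - x n)) - T (p (Suc n))"
      and init: "xt 0 = x 1" "ut 0 = u 1"
      and D: "SDR \<Sigma> \<Upsilon> A B L xt ut vt" for p q x u xt ut vt n
    by (rule SADMM_reduces_to_SDR[OF S u[rule_format] init D[unfolded A B L \<phi>]])
  have iii: "(\<exists>yh xh uh. yh \<in> S_P \<and> xh \<in> S_D \<and> uh \<in> S_Pstar \<and>
         weakly_converges (\<lambda>n. (x n, - T (p n), q n)) (xh, uh, - K uh) \<and> uh = - T yh) \<and>
      (range (adjoint T) = UNIV \<longrightarrow> (\<exists>yh\<in>S_P. weakly_converges p yh))"
    if S: "SADMM \<Sigma> \<Upsilon> f g T K 0 p q x" for p q x
  proof -
    obtain x0 u0 where "0 \<in> (\<lambda>a. a + K u0) ` subdifferential (conjugate f) x0"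
      "0 \<in> (\<lambda>b. b - adjoint K x0) ` subdifferential (conjugate \<phi>) u0"
      using kkt unfolding \<phi> by blast
    then have kkt': "- K u0 \<in> subdifferential (conjugate f) x0" "adjoint K x0 \<in> subdifferential (conjugate \<phi>) u0"
      by (auto simp: eq_neg_iff_add_eq_0 [symmetric])
    obtain xh uh where opt: "- K uh \<in> subdifferential (conjugate f) xh" "uh \<in> subdifferential \<phi> (adjoint K xh)"
      and conv: "weakly_converges x xh" "weakly_converges (\<lambda>n. - T (p n)) uh" "weakly_converges q (- K uh)"
      using SADMM_weakly_converges[OF mono kkt' S] .
    obtain yh where yh: "uh = - T yh" "yh \<in> S_P" "xh \<in> S_D" "uh \<in> S_Pstar"
    proof (rule kkt_imp_optimal[OF opt])
      fix yh
      assume "uh = - T yh" "yh \<in> Argmin (\<lambda>y. g y + f (K (T y)))"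
        "xh \<in> Argmin (\<lambda>x. conjugate f x + \<phi> (adjoint K x))"
        "uh \<in> Argmin (\<lambda>u. conjugate \<phi> u + f (- K u))"
      then show thesis
        by (intro that[of yh]) (simp_all only: S_P S_D S_Pstar \<phi> \<phi>_def)
    qed
    \<comment> \<open>When \<open>adjoint T\<close> is onto, testing \<open>p n\<close> against
      \<open>w = adjoint T s\<close> amounts to testing \<open>T (p n)\<close> against
      \<open>s\<close>.\<close>
    have wp: "weakly_converges p yh" if ran: "range (adjoint T) = UNIV"
      unfolding weakly_converges_def
    proof
      fix w
      obtain s where w: "w = adjoint T s" using ran by (metis rangeE UNIV_I)
      have "(\<lambda>n. - (- T (p n) \<bullet> s)) \<longlonglongrightarrow> - (uh \<bullet> s)"
        by (intro tendsto_minus weakly_convergesD conv(2))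
      then show "(\<lambda>n. p n \<bullet> w) \<longlonglongrightarrow> yh \<bullet> w"
        by (simp add: w yh(1) flip: adjoint_inner[OF T(1)])
    qed
    have "weakly_converges (\<lambda>n. (x n, - T (p n), q n)) (xh, uh, - K uh)"
      unfolding weakly_converges_Pair_iff by (intro conjI conv)
    then show ?thesis
      by (intro conjI exI[of _ yh] exI[of _ xh] exI[of _ uh] impI bexI[of _ yh] yh wp)
  qed
  show ?thesis
  proof (rule conjI[OF conjI[OF exist] conjI[OF _ conjI]], goal_cases)
    case 1
    show ?case by (intro allI impI i)
  next
    case 2
    show ?case by (intro allI impI, elim conjE) (rule ii; assumption)
  next
    case 3
    show ?case by (intro allI impI iii)
  qed
qed

end
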